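(* Let $K$ be a field, $n\ge 1$, $S=K[x_1,\ldots,x_n]$, and let $0\le s\le n$. Let $\alpha: a_1<a_2<\cdots<a_s$ and $\beta: b_1<b_2<\cdots<b_s$ be sequences of integers with $1\le a_1$, $b_s\le n$ and $a_i\le b_i$ for all $1\le i\le s$, and let $I_{\alpha,\beta}=(x_{a_1}x_{a_1+1}\cdots x_{b_1},\ldots,x_{a_s}x_{a_s+1}\cdots x_{b_s})\subset S$ (with $I_{\alpha,\beta}=0$ if $s=0$). If $a_{k+2}>b_k+1$ for all $1\le k\le s-2$, then $$\operatorname{sdepth}(S/I_{\alpha,\beta}^t)=\operatorname{depth}(S/I_{\alpha,\beta}^t)=n-s\quad\text{for all } t\ge1.$$
   Context: Stanley depth: for a finitely generated $\mathbb Z^n$-graded $S$-module $M$, a Stanley decomposition of $M$ is a direct sum $\mathcal D: M=\bigoplus_{i=1}^r m_iK[Z_i]$ as $\mathbb Z^n$-graded $K$-vector spaces, where each $m_i\in M$ is homogeneous for the $\mathbb Z^n$-grading, $Z_i\subset\{x_1,\ldots,x_n\}$, and $m_iK[Z_i]=\{um_i: u\in K[Z_i]\}$ is a free $K[Z_i]$-submodule of $M$. Set $\operatorname{sdepth}(\mathcal D)=\min_i|Z_i|$ and $\operatorname{sdepth}(M)=\max\{\operatorname{sdepth}(\mathcal D):\mathcal D \text{ a Stanley decomposition of } M\}$. Depth is with respect to the graded maximal ideal $(x_1,\ldots,x_n)$. *)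

theory Defs
  imports
    "HOL-Library.Poly_Mapping"
    "HOL-Library.Extended_Nat"
    "HOL-Algebra.Module"
    "HOL-Algebra.QuotRing"
    "HOL-Algebra.Ideal_Product"
begin

section \<open>Polynomial rings\<close>

text \<open>
  A polynomial over \<open>'k\<close> in variables \<open>x\<^sub>j\<close> (\<open>j\<close> a natural number) is a finitely supported
  map from exponent vectors to coefficients; the class operations on this type are the polynomial
  operations. The polynomial ring in the variables with index in \<open>V\<close> is the subring of polynomials
  all of whose monomials involve only variables from \<open>V\<close>.
\<close>

type_synonym 'k mpoly = "(nat \<Rightarrow>\<^sub>0 nat) \<Rightarrow>\<^sub>0 'k"

definition Var :: "nat \<Rightarrow> 'k::field mpoly" where
  "Var j = Poly_Mapping.single (Poly_Mapping.single j 1) 1"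

definition mpoly_ring :: "nat set \<Rightarrow> ('k::field mpoly) ring" where
  "mpoly_ring V =
    \<lparr>carrier = {p. \<forall>m \<in> Poly_Mapping.keys p. Poly_Mapping.keys m \<subseteq> V},
     mult = (*), one = 1, zero = 0, add = (+)\<rparr>"

abbreviation polynomial_ring :: "nat \<Rightarrow> ('k::field mpoly) ring" where
  "polynomial_ring n \<equiv> mpoly_ring {1..n}"

definition max_ideal :: "nat \<Rightarrow> ('k::field mpoly) set" where
  "max_ideal n = Idl\<^bsub>polynomial_ring n\<^esub> (Var ` {1..n})"

lemma mpoly_ring_cring: "cring (mpoly_ring V :: ('k::field mpoly) ring)"
proof -
  define C :: "'k mpoly set" where
    "C = {p. \<forall>m \<in> Poly_Mapping.keys p. Poly_Mapping.keys m \<subseteq> V}"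
  note sel = mpoly_ring_def C_def[symmetric] partial_object.simps monoid.simps ring.simps
  have m: "p * q \<in> C" if p: "p \<in> C" and q: "q \<in> C" for p q
  proof -
    have "Poly_Mapping.keys c \<subseteq> V" if c: "c \<in> Poly_Mapping.keys (p * q)" for c
    proof -
      obtain k l where "c = k + l" "k \<in> Poly_Mapping.keys p" "l \<in> Poly_Mapping.keys q"
        using keys_mult[of p q] c by blast
      then show ?thesis
        using p q Poly_Mapping.keys_add[of k l] unfolding C_def by blast
    qed
    then show ?thesis unfolding C_def by blast
  qed
  have a: "p + q \<in> C" if "p \<in> C" "q \<in> C" for p q
    using that Poly_Mapping.keys_add[of p q] unfolding C_def by blast
  have z: "0 \<in> C" "1 \<in> C"
    by (simp_all add: C_def)
  have "abelian_group (mpoly_ring V :: ('k mpoly) ring)"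
  proof (rule abelian_groupI, unfold sel)
    fix x assume "x \<in> C"
    then have "- x \<in> C" by (simp add: C_def)
    then show "\<exists>y \<in> C. y + x = 0" by (intro bexI[of _ "- x"]) simp_all
  qed (simp_all add: a z ac_simps)
  moreover have "Group.comm_monoid (mpoly_ring V :: ('k mpoly) ring)"
    by (rule comm_monoidI, unfold sel) (simp_all add: m z ac_simps)
  ultimately show ?thesis
    by (rule cringI) (simp only: sel distrib_right)
qed


section \<open>Depth\<close>

text \<open>
  \<open>multiples M fs\<close> is the submodule \<open>(f\<^sub>1, \<dots>, f\<^sub>r)M\<close> for \<open>fs = [f\<^sub>1, \<dots>, f\<^sub>r]\<close>.
\<close>

definition multiples :: "('a, 'm) module \<Rightarrow> 'a list \<Rightarrow> 'm set" where
  "multiples M fs =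
    {\<Oplus>\<^bsub>M\<^esub> i \<in> {..<length fs}. (fs ! i) \<odot>\<^bsub>M\<^esub> y i | y. y \<in> {..<length fs} \<rightarrow> carrier M}"

definition regular_sequence :: "('a, 'm) module \<Rightarrow> 'a list \<Rightarrow> bool" where
  "regular_sequence M fs \<longleftrightarrow>
    (\<forall>i < length fs. \<forall>x \<in> carrier M.
       (fs ! i) \<odot>\<^bsub>M\<^esub> x \<in> multiples M (take i fs) \<longrightarrow> x \<in> multiples M (take i fs))
    \<and> multiples M fs \<noteq> carrier M"

text \<open>
  The depth of \<open>M\<close> with respect to an ideal \<open>m\<close> is the maximal length of a regular sequence
  contained in \<open>m\<close>. The supremum is intended for \<open>m M \<noteq> M\<close> (in particular, the zero module,
  usually given depth \<open>\<infinity>\<close>, gets \<open>0\<close> here).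
\<close>

definition depth :: "'a set \<Rightarrow> ('a, 'm) module \<Rightarrow> enat" where
  "depth m M = Sup {enat (length fs) | fs. set fs \<subseteq> m \<and> regular_sequence M fs}"


section \<open>Stanley depth\<close>

text \<open>
  A grading by \<open>\<int>\<^sup>n\<close> of a module \<open>M\<close> over \<open>polynomial_ring n\<close> is given by its family of homogeneous
  components \<open>Mg :: (nat \<Rightarrow> int) \<Rightarrow> 'm set\<close>, indexed by \<open>{1..n} \<rightarrow>\<^sub>E UNIV\<close>.
\<close>

definition homogeneous_elem :: "nat \<Rightarrow> ((nat \<Rightarrow> int) \<Rightarrow> 'm set) \<Rightarrow> 'm \<Rightarrow> bool" where
  "homogeneous_elem n Mg w \<longleftrightarrow> (\<exists>g \<in> {1..n} \<rightarrow>\<^sub>E UNIV. w \<in> Mg g)"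

definition stanley_space :: "('k::field mpoly, 'm) module \<Rightarrow> 'm \<Rightarrow> nat set \<Rightarrow> 'm set" where
  "stanley_space M w Z = {u \<odot>\<^bsub>M\<^esub> w | u. u \<in> carrier (mpoly_ring Z)}"

text \<open>
  A Stanley decomposition consists of homogeneous \<open>w\<^sub>i\<close> and sets \<open>Z\<^sub>i\<close> of variables, \<open>i < r\<close>, such
  that each \<open>w\<^sub>i K[Z\<^sub>i]\<close> is free over \<open>K[Z\<^sub>i]\<close> with basis \<open>w\<^sub>i\<close> and \<open>M\<close> is their internal direct
  sum. As the \<open>w\<^sub>i\<close> are homogeneous, the summands are graded subspaces, so that the decomposition
  is one of graded vector spaces.
\<close>

definition stanley_decomposition ::
  "nat \<Rightarrow> ('k::field mpoly, 'm) module \<Rightarrow> ((nat \<Rightarrow> int) \<Rightarrow> 'm set)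
    \<Rightarrow> nat \<Rightarrow> (nat \<Rightarrow> 'm) \<Rightarrow> (nat \<Rightarrow> nat set) \<Rightarrow> bool" where
  "stanley_decomposition n M Mg r w Z \<longleftrightarrow>
    (\<forall>i < r. w i \<in> carrier M \<and> homogeneous_elem n Mg (w i) \<and> Z i \<subseteq> {1..n} \<and>
       (\<forall>u \<in> carrier (mpoly_ring (Z i)). u \<odot>\<^bsub>M\<^esub> w i = \<zero>\<^bsub>M\<^esub> \<longrightarrow> u = 0))
    \<and> (\<forall>x \<in> carrier M. \<exists>!y. y \<in> (\<Pi>\<^sub>E i \<in> {..<r}. stanley_space M (w i) (Z i))
         \<and> x = (\<Oplus>\<^bsub>M\<^esub> i \<in> {..<r}. y i))"

definition sdepth ::
  "nat \<Rightarrow> ('k::field mpoly, 'm) module \<Rightarrow> ((nat \<Rightarrow> int) \<Rightarrow> 'm set) \<Rightarrow> enat" where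
  "sdepth n M Mg =
    Sup {(INF i \<in> {..<r}. enat (card (Z i))) | r w Z. stanley_decomposition n M Mg r w Z}"


section \<open>Quotients of the polynomial ring\<close>

definition quotient_module :: "'a ring \<Rightarrow> 'a set \<Rightarrow> ('a, 'a set) module" where
  "quotient_module R J =
    \<lparr>carrier = carrier (R Quot J), mult = mult (R Quot J), one = one (R Quot J),
     zero = zero (R Quot J), add = add (R Quot J),
     smult = (\<lambda>a A. (J +>\<^bsub>R\<^esub> a) \<otimes>\<^bsub>R Quot J\<^esub> A)\<rparr>"

lemma quotient_module_is_module:
  assumes "cring R" "ideal J R"
  shows "module R (quotient_module R J)"
proof -
  interpret R: cring R by fact
  interpret J: ideal J R by fact
  interpret Q: cring "R Quot J" by (rule J.quotient_is_cring) fact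
  have h: "(+>\<^bsub>R\<^esub>) J \<in> ring_hom R (R Quot J)" by (rule J.rcos_ring_hom)
  note h_closed = ring_hom_closed[OF h] and h_mult = ring_hom_mult[OF h]
    and h_add = ring_hom_add[OF h] and h_one = ring_hom_one[OF h]
  note sel = quotient_module_def partial_object.simps monoid.simps ring.simps module.simps
  have "abelian_group (quotient_module R J)"
  proof (rule abelian_groupI, unfold sel)
    fix A assume "A \<in> carrier (R Quot J)"
    then show "\<exists>B \<in> carrier (R Quot J). B \<oplus>\<^bsub>R Quot J\<^esub> A = \<zero>\<^bsub>R Quot J\<^esub>"
      using Q.a_inv_closed Q.l_neg by blast
  qed (fact Q.a_closed Q.zero_closed Q.a_assoc Q.a_comm Q.l_zero)+
  with assms(1) show ?thesis
    by (rule moduleI, unfold sel)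
      (simp_all only: h_closed h_mult h_add h_one Q.m_closed Q.l_distr Q.r_distr Q.m_assoc Q.l_one)
qed

text \<open>
  The components of \<open>S/J\<close> for \<open>J\<close> generated by monomials: the images of the components of \<open>S\<close>,
  where a polynomial is homogeneous of degree \<open>g\<close> if it is a scalar multiple of \<open>x\<^sup>g\<close> (so it is
  zero if \<open>g\<close> has a negative entry).
\<close>

definition quotient_grading ::
  "nat \<Rightarrow> ('k::field mpoly) set \<Rightarrow> (nat \<Rightarrow> int) \<Rightarrow> ('k mpoly) set set" where
  "quotient_grading n J g =
    (\<lambda>p. J +>\<^bsub>polynomial_ring n\<^esub> p) ` {p \<in> carrier (polynomial_ring n).
       \<forall>m \<in> Poly_Mapping.keys p. \<forall>i \<in> {1..n}. int (Poly_Mapping.lookup m i) = g i}"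

abbreviation depth_quotient :: "nat \<Rightarrow> ('k::field mpoly) set \<Rightarrow> enat" where
  "depth_quotient n J \<equiv> depth (max_ideal n) (quotient_module (polynomial_ring n) J)"

abbreviation sdepth_quotient :: "nat \<Rightarrow> ('k::field mpoly) set \<Rightarrow> enat" where
  "sdepth_quotient n J \<equiv>
    sdepth n (quotient_module (polynomial_ring n) J) (quotient_grading n J)"

definition interval_ideal ::
  "nat \<Rightarrow> nat \<Rightarrow> (nat \<Rightarrow> nat) \<Rightarrow> (nat \<Rightarrow> nat) \<Rightarrow> ('k::field mpoly) set" where
  "interval_ideal n s a b =
    Idl\<^bsub>polynomial_ring n\<^esub> ((\<lambda>i. \<Prod>j \<in> {a i..b i}. Var j) ` {1..s})"

abbreviation ideal_power :: "nat \<Rightarrow> ('k::field mpoly) set \<Rightarrow> nat \<Rightarrow> ('k mpoly) set" where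
  "ideal_power n I t \<equiv> I [^]\<^bsub>ideals_set (polynomial_ring n)\<^esub> t"

end

theory Submission
  imports Defs "HOL-Library.Multiset"
begin

text \<open>
  Write \<open>u\<^sub>1, \<dots>, u\<^sub>s\<close> for the interval monomials and \<open>J = I\<^sup>t\<close>. Since \<open>a\<^bsub>k+2\<^esub> > b\<^sub>k + 1\<close>, only
  consecutive intervals can meet, and each interval \<open>k\<close> contains a variable \<open>x\<^bsub>c k\<^esub>\<close> that lies in
  no other interval, its private variable. All four inequalities come from elementary facts on the
  exponent vectors of \<open>J\<close>.

  \<^bold>\<open>Upper bounds.\<close> Let \<open>m\<close> be the product of the \<open>t\<close>-th powers of all non-private variables with the
  power \<open>t - 1\<close> of \<open>x\<^bsub>c 1\<^esub>\<close>. It is not in \<open>J\<close>, but its multiples by the \<open>s\<close> private variables are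
  (\<open>power_mons_socle\<close>). In a Stanley decomposition, the summand that contains \<open>m\<close> is free over
  \<open>K[Z]\<close>, so \<open>Z\<close> contains no private variable (\<open>sdepth_le_of_socle\<close>). For the depth, let
  \<open>f\<^sub>1, \<dots>, f\<^sub>r\<close> be a regular sequence in the maximal ideal. Multiplication by a monomial in the
  \<open>f\<^sub>i\<close> shifts the filtration of \<open>S/J\<close> by weighted powers of \<open>(f\<^sub>1, \<dots>, f\<^sub>r)\<close> by exactly the weight
  of that monomial. With weights \<open>1, N, N\<^sup>2, \<dots>\<close> the monomials with exponents below \<open>N\<close> have distinct
  weights, so their products with \<open>m\<close> are linearly independent in \<open>S/J\<close>
  (\<open>digit_monomials_independent\<close>). These \<open>N\<^sup>r\<close> products depend only on the non-private part of the
  \<open>f\<close>-monomials, which lives in a space of dimension \<open>O(N\<^bsup>n-s\<^esup>)\<close>; hence \<open>r \<le> n - s\<close>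
  (\<open>depth_le_of_socle\<close>).

  \<^bold>\<open>Stanley depth, lower bound.\<close> As \<open>u\<^sub>s\<close> meets only \<open>u\<^bsub>s-1\<^esub>\<close>, one has \<open>I\<^sup>t : u\<^sub>s = I\<^bsup>t-1\<^esup>\<close>
  (\<open>power_mons_colon_last\<close>). The monomials outside \<open>I\<^sup>t\<close> are therefore \<open>u\<^sub>s\<close> times those outside
  \<open>I\<^bsup>t-1\<^esup>\<close>, together with those outside \<open>(u\<^sub>1, \<dots>, u\<^bsub>s-1\<^esub>)\<^sup>t\<close> that \<open>u\<^sub>s\<close> does not divide; removing the
  multiples of one monomial costs one dimension. Induction on \<open>s\<close> and \<open>t\<close> yields a decomposition
  with all dimensions at least \<open>n - s\<close> (\<open>standard_cell_partition\<close>).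

  \<^bold>\<open>Depth, lower bound.\<close> For a non-private variable \<open>x\<^sub>j\<close>, let \<open>\<kappa> j\<close> be the first interval that
  contains \<open>j\<close> (or \<open>1\<close>). If \<open>s \<ge> 1\<close>, the \<open>n - s\<close> differences \<open>x\<^sub>j - x\<^bsub>c (\<kappa> j)\<^esub>\<close> form a regular sequence on
  \<open>S/J\<close> (\<open>differences_weakly_regular\<close>): dividing by one of them identifies two variables, which keeps
  the shape of the generators, and for generators of this shape no monomial \<open>w \<notin> J\<close> satisfies both
  \<open>x w \<in> J\<close> and \<open>y w \<in> J\<close> when \<open>\<kappa> x = \<kappa> y\<close> (\<open>chain_no_socle\<close>), so that \<open>x - y\<close> is a nonzerodivisor
  (\<open>difference_nonzerodivisor\<close>). For \<open>s = 0\<close> the sequence \<open>x\<^sub>1, x\<^sub>2 - x\<^sub>1, \<dots>, x\<^sub>n - x\<^sub>1\<close> serves the same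
  purpose (\<open>depth_zero_ideal_ge\<close>).
\<close>

section \<open>Exponent vectors\<close>

type_synonym expo = "nat \<Rightarrow>\<^sub>0 nat"

abbreviation expt :: "expo \<Rightarrow> nat \<Rightarrow> nat" where
  "expt \<equiv> Poly_Mapping.lookup"

abbreviation supp :: "expo \<Rightarrow> nat set" where
  "supp \<equiv> Poly_Mapping.keys"

definition unit_exp :: "nat \<Rightarrow> expo" where
  "unit_exp z = Poly_Mapping.single z 1"

text \<open>
  Divisibility of monomials. The order \<open>\<le>\<close> on this type is a lexicographic one and does not express it.
\<close>

definition exp_dvd :: "expo \<Rightarrow> expo \<Rightarrow> bool" where
  "exp_dvd u m \<longleftrightarrow> (\<forall>z. expt u z \<le> expt m z)"

lemma expt_unit: "expt (unit_exp z) w = (if w = z then 1 else 0)"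
  by (simp add: unit_exp_def lookup_single when_def)

lemma expt_minus: "expt (m - u) z = expt m z - expt u z"
  by (rule lookup_minus)

lemma exp_dvd_split: "exp_dvd u m \<Longrightarrow> u + (m - u) = m"
  by (rule poly_mapping_eqI) (simp add: lookup_add expt_minus exp_dvd_def)

lemma exp_dvd_iff: "exp_dvd u m \<longleftrightarrow> (\<exists>v. m = u + v)"
proof
  show "exp_dvd u m \<Longrightarrow> \<exists>v. m = u + v"
    by (metis exp_dvd_split)
qed (auto simp: exp_dvd_def lookup_add)

lemma expt_sum_mset: "expt (\<Sum>\<^sub># X) z = (\<Sum>u\<in>#X. expt u z)"
  by (induction X) (simp_all add: lookup_add)

lemma supp_plus: "supp (m + m') = supp m \<union> supp m'"
  by (auto simp: in_keys_iff lookup_add)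

section \<open>Powers of monomial ideals\<close>

text \<open>
  The exponent vectors of the monomials in \<open>I\<^sup>t\<close>, where \<open>I\<close> is generated by the monomials with
  exponent vectors in \<open>E\<close>. Multisets of generators make cancellation of a common factor immediate.
\<close>

definition power_mons :: "expo set \<Rightarrow> nat \<Rightarrow> expo set" where
  "power_mons E t = {\<Sum>\<^sub># X + v | X v. set_mset X \<subseteq> E \<and> size X = t}"

lemma power_mons_0 [simp]: "power_mons E 0 = UNIV"
  by (auto simp: power_mons_def)

lemma power_mons_empty: "power_mons {} (Suc t) = {}"
  by (auto simp: power_mons_def)

lemma power_mons_upset: "m \<in> power_mons E t \<Longrightarrow> m + v \<in> power_mons E t"
  unfolding power_mons_def by (force simp: add.assoc)

lemma power_mons_mono: "E \<subseteq> E' \<Longrightarrow> power_mons E t \<subseteq> power_mons E' t"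
  unfolding power_mons_def by blast

lemma power_mons_Suc: "power_mons E (Suc t) = {u + m | u m. u \<in> E \<and> m \<in> power_mons E t}"
proof (intro equalityI subsetI)
  fix w assume "w \<in> power_mons E (Suc t)"
  then obtain X v where X: "w = \<Sum>\<^sub># X + v" "set_mset X \<subseteq> E" "size X = Suc t"
    unfolding power_mons_def by blast
  then obtain u Y where Y: "X = add_mset u Y"
    by (metis size_eq_Suc_imp_eq_union)
  have "w = u + (\<Sum>\<^sub># Y + v)" "u \<in> E" "\<Sum>\<^sub># Y + v \<in> power_mons E t"
    using X unfolding Y power_mons_def by (auto simp: add.assoc)
  then show "w \<in> {u + m | u m. u \<in> E \<and> m \<in> power_mons E t}"
    by blast
next
  fix w assume "w \<in> {u + m | u m. u \<in> E \<and> m \<in> power_mons E t}"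
  then obtain u X v where "w = u + (\<Sum>\<^sub># X + v)" "u \<in> E" "set_mset X \<subseteq> E" "size X = t"
    unfolding power_mons_def by blast
  then have "w = \<Sum>\<^sub># (add_mset u X) + v" "set_mset (add_mset u X) \<subseteq> E" "size (add_mset u X) = Suc t"
    by (auto simp: add.assoc)
  then show "w \<in> power_mons E (Suc t)"
    unfolding power_mons_def by blast
qed

lemma power_mons_dvd:
  assumes "set_mset X \<subseteq> E" "size X = t" "exp_dvd (\<Sum>\<^sub># X) m"
  shows "m \<in> power_mons E t"
  using assms unfolding power_mons_def exp_dvd_iff by blast

lemma power_mons_insert:
  assumes "m \<in> power_mons (insert u E) t" "\<not> exp_dvd u m"
  shows "m \<in> power_mons E t"
proof -
  obtain X v where X: "m = \<Sum>\<^sub># X + v" "set_mset X \<subseteq> insert u E" "size X = t"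
    using assms(1) unfolding power_mons_def by blast
  have "u \<notin># X"
  proof
    assume "u \<in># X"
    then obtain Y where "X = add_mset u Y"
      by (metis insert_DiffM)
    then show False
      using assms(2) X(1) by (auto simp: exp_dvd_iff add.assoc)
  qed
  then show ?thesis
    using X unfolding power_mons_def by blast
qed

section \<open>Chains of monomials\<close>

text \<open>
  The shape of a list of monomials \<open>e 1, e 2, \<dots>\<close> in which only consecutive ones share variables:
  the variable \<open>z\<close> divides at most the monomials \<open>\<kappa> z\<close> and \<open>\<kappa> z + 1\<close>, and the second with an
  exponent that does not exceed the first. Exponents above \<open>1\<close> are admitted so that the shape
  survives the identification of variables with the same \<open>\<kappa>\<close>.
\<close>

definition chain :: "(nat \<Rightarrow> nat) \<Rightarrow> (nat \<Rightarrow> expo) \<Rightarrow> bool" where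
  "chain \<kappa> e \<longleftrightarrow> (\<forall>z. (\<forall>l. l \<noteq> \<kappa> z \<longrightarrow> l \<noteq> Suc (\<kappa> z) \<longrightarrow> expt (e l) z = 0) \<and>
     expt (e (Suc (\<kappa> z))) z \<le> expt (e (\<kappa> z)) z)"

lemma chain_zero: "chain \<kappa> e \<Longrightarrow> l \<noteq> \<kappa> z \<Longrightarrow> l \<noteq> Suc (\<kappa> z) \<Longrightarrow> expt (e l) z = 0"
  unfolding chain_def by blast

lemma chain_le: "chain \<kappa> e \<Longrightarrow> expt (e (Suc (\<kappa> z))) z \<le> expt (e (\<kappa> z)) z"
  unfolding chain_def by blast

lemma atLeastAtMost_Suc_image: "e ` {1..Suc s} = insert (e (Suc s)) (e ` {1..s})"
  by (simp add: atLeastAtMostSuc_conv)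

lemma expt_sum_mset_zero:
  assumes "\<And>u. u \<in># X \<Longrightarrow> expt u z = 0"
  shows "expt (\<Sum>\<^sub># X) z = 0"
  using assms unfolding expt_sum_mset by simp

lemma expt_le_expt_sum_mset:
  assumes "u \<in># X"
  shows "expt u z \<le> expt (\<Sum>\<^sub># X) z"
proof -
  obtain Y where "X = add_mset u Y"
    using assms by (metis insert_DiffM)
  then show ?thesis
    by (simp add: lookup_add)
qed

text \<open>
  Why \<open>I\<^sup>t : u = I\<^bsup>t-1\<^esup>\<close> for the last generator \<open>u\<close>: in a factorization \<open>u w = v\<^sub>1 \<cdots> v\<^sub>t v\<close>
  one generator can be dropped to obtain \<open>w \<in> I\<^bsup>t-1\<^esup>\<close>. If \<open>u\<close> occurs, it cancels. Otherwise drop the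
  preceding generator if it occurs: at a variable that it shares with \<open>u\<close>, it has at least the
  exponent of \<open>u\<close>. If neither occurs, the factorization has no variable of \<open>u\<close>, so \<open>u\<close> divides
  the cofactor \<open>v\<close> and any generator can be dropped.
\<close>

lemma power_mons_colon_last:
  assumes ch: "chain \<kappa> e"
  shows "e (Suc s) + w \<in> power_mons (e ` {1..Suc s}) (Suc t) \<longleftrightarrow> w \<in> power_mons (e ` {1..Suc s}) t"
proof
  assume "w \<in> power_mons (e ` {1..Suc s}) t"
  then show "e (Suc s) + w \<in> power_mons (e ` {1..Suc s}) (Suc t)"
    unfolding power_mons_Suc by fastforce
next
  let ?E = "e ` {1..Suc s}" and ?u = "e (Suc s)"
  assume "?u + w \<in> power_mons ?E (Suc t)"
  then obtain X v where X: "?u + w = \<Sum>\<^sub># X + v" "set_mset X \<subseteq> ?E" "size X = Suc t"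
    unfolding power_mons_def by blast
  have eq: "expt ?u z + expt w z = expt (\<Sum>\<^sub># X) z + expt v z" for z
    using X(1) by (metis lookup_add)
  consider (last) "?u \<in># X" | (prev) "?u \<notin># X" "e s \<in># X" | (far) "?u \<notin># X" "e s \<notin># X"
    by blast
  then show "w \<in> power_mons ?E t"
  proof cases
    case last
    then obtain Y where Y: "X = add_mset ?u Y"
      by (metis insert_DiffM)
    then have "w = \<Sum>\<^sub># Y + v"
      using X(1) by (simp add: add.assoc)
    then show ?thesis
      using X Y unfolding power_mons_def by auto
  next
    case prev
    then obtain Y where Y: "X = add_mset (e s) Y"
      by (metis insert_DiffM)
    have "exp_dvd (\<Sum>\<^sub># Y) w"
      unfolding exp_dvd_def
    proof
      fix z
      have bal: "expt ?u z + expt w z = expt (e s) z + expt (\<Sum>\<^sub># Y) z + expt v z"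
        using eq[of z] by (simp add: Y lookup_add)
      consider "expt ?u z \<le> expt (e s) z" | "expt ?u z > expt (e s) z"
        by linarith
      then show "expt (\<Sum>\<^sub># Y) z \<le> expt w z"
      proof cases
        case 1
        then show ?thesis
          using bal by linarith
      next
        case 2
        then have k: "\<kappa> z = Suc s"
          using chain_zero[OF ch, of "Suc s" z] chain_le[OF ch, of z] by fastforce
        have "expt u z = 0" if "u \<in># Y" for u
        proof -
          have "u \<in> e ` {1..s}"
            using that X(2)[unfolded atLeastAtMost_Suc_image] prev(1) Y by auto
          then show ?thesis
            using chain_zero[OF ch, of _ z] k by fastforce
        qed
        then show ?thesis
          using expt_sum_mset_zero by simp
      qed
    qed
    then show ?thesis
      using power_mons_dvd[of Y] X Y by simp
  next
    case far
    obtain u Y where Y: "X = add_mset u Y"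
      using X(3) by (metis size_eq_Suc_imp_eq_union)
    have "exp_dvd (\<Sum>\<^sub># X) w"
      unfolding exp_dvd_def
    proof
      fix z
      show "expt (\<Sum>\<^sub># X) z \<le> expt w z"
      proof (cases "expt ?u z = 0")
        case True
        then show ?thesis using eq[of z] by simp
      next
        case False
        then have k: "\<kappa> z = Suc s \<or> \<kappa> z = s"
          using chain_zero[OF ch, of "Suc s" z] by fastforce
        have "expt u z = 0" if uX: "u \<in># X" for u
        proof -
          obtain l where "u = e l" "l \<in> {1..s}"
            using uX X(2)[unfolded atLeastAtMost_Suc_image] far by auto
          moreover have "l \<noteq> s"
            using far uX calculation by blast
          ultimately show ?thesis
            using chain_zero[OF ch, of l z] k by fastforce
        qed
        then show ?thesis
          using expt_sum_mset_zero by simp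
      qed
    qed
    then have "exp_dvd (\<Sum>\<^sub># Y) w"
      unfolding Y exp_dvd_def by (auto simp: lookup_add intro: add_leD2)
    then show ?thesis
      using power_mons_dvd[of Y] X Y by simp
  qed
qed

text \<open>
  The last generator does not divide \<open>w\<close>, but only one factor \<open>x\<close> is missing. So \<open>w\<close> has a smaller
  exponent at \<open>x\<close> than the generator \<open>\<kappa> x\<close>, and a product of earlier generators that divides
  \<open>y w\<close> cannot use that generator. As \<open>\<kappa> y = \<kappa> x\<close>, no other earlier generator contains \<open>y\<close>, and
  the product divides \<open>w\<close>.
\<close>

lemma chain_drop_variable:
  assumes ch: "chain \<kappa> e" and \<kappa>: "\<kappa> x = \<kappa> y" and "x \<noteq> y"
    and wx: "exp_dvd (e (Suc s)) (w + unit_exp x)" "\<not> exp_dvd (e (Suc s)) w"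
    and wy: "w + unit_exp y \<in> power_mons (e ` {1..s}) t"
  shows "w \<in> power_mons (e ` {1..s}) t"
proof -
  let ?u = "e (Suc s)"
  have le: "expt ?u z \<le> expt w z + (if z = x then 1 else 0)" for z
    using wx(1) by (simp add: exp_dvd_def lookup_add expt_unit)
  then obtain z where z: "expt ?u z > expt w z"
    using wx(2) unfolding exp_dvd_def by (meson not_le)
  then have "z = x"
    using le[of z] by (simp split: if_splits)
  then have ux: "expt ?u x > expt w x"
    using z by simp
  obtain X v where X: "w + unit_exp y = \<Sum>\<^sub># X + v" "set_mset X \<subseteq> e ` {1..s}" "size X = t"
    using wy unfolding power_mons_def by blast
  have eq: "expt w z + (if z = y then 1 else 0) = expt (\<Sum>\<^sub># X) z + expt v z" for z
    using arg_cong[OF X(1), of "\<lambda>m. expt m z"] by (simp add: lookup_add expt_unit)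
  have "expt u y = 0" if uX: "u \<in># X" for u
  proof (rule ccontr)
    assume u: "expt u y \<noteq> 0"
    obtain l where l: "u = e l" "l \<in> {1..s}"
      using uX X(2) by auto
    have "l = \<kappa> x \<or> l = Suc (\<kappa> x)" "Suc s = \<kappa> x \<or> Suc s = Suc (\<kappa> x)"
      using chain_zero[OF ch, of l y] chain_zero[OF ch, of "Suc s" x] u ux l \<kappa> by auto
    then have "l = \<kappa> x" "s = \<kappa> x"
      using l(2) by auto
    then have "expt ?u x \<le> expt u x"
      using chain_le[OF ch, of x] l(1) by simp
    also have "\<dots> \<le> expt (\<Sum>\<^sub># X) x"
      by (rule expt_le_expt_sum_mset) fact
    finally show False
      using ux eq[of x] \<open>x \<noteq> y\<close> by simp
  qed
  then have "expt (\<Sum>\<^sub># X) y = 0"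
    by (rule expt_sum_mset_zero)
  then have "exp_dvd (\<Sum>\<^sub># X) w"
    unfolding exp_dvd_def
  proof (intro allI)
    fix z
    show "expt (\<Sum>\<^sub># X) z \<le> expt w z"
      using \<open>expt (\<Sum>\<^sub># X) y = 0\<close> eq[of z] by (cases "z = y") simp_all
  qed
  then show ?thesis
    using power_mons_dvd X by simp
qed

text \<open>
  No associated prime of \<open>I\<^sup>t\<close> contains two variables with the same \<open>\<kappa>\<close>. Induction on \<open>s + t\<close>: if
  the last generator divides \<open>w\<close>, it is cancelled by \<open>power_mons_colon_last\<close>; if it divides neither
  \<open>x w\<close> nor \<open>y w\<close>, it can be discarded; if it divides exactly one of them,
  \<open>chain_drop_variable\<close> applies.
\<close>

lemma chain_no_socle:
  assumes ch: "chain \<kappa> e" and \<kappa>: "\<kappa> x = \<kappa> y" and xy: "x \<noteq> y"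
  shows "w + unit_exp x \<in> power_mons (e ` {1..s}) t \<Longrightarrow>
    w + unit_exp y \<in> power_mons (e ` {1..s}) t \<Longrightarrow> w \<in> power_mons (e ` {1..s}) t"
proof (induction "s + t" arbitrary: s t w)
  case 0
  then show ?case by simp
next
  case (Suc N)
  show ?case
  proof (cases t)
    case 0
    then show ?thesis by simp
  next
    case t: (Suc t')
    show ?thesis
    proof (cases s)
      case 0
      then show ?thesis
        using Suc.prems by (simp add: t power_mons_empty)
    next
      case s: (Suc s')
      let ?u = "e (Suc s')" and ?E = "e ` {1..Suc s'}" and ?E' = "e ` {1..s'}"
      have sub: "power_mons ?E' t \<subseteq> power_mons ?E t"
        by (rule power_mons_mono) auto
      have ndvd: "m \<in> power_mons ?E' t" if "m \<in> power_mons ?E t" "\<not> exp_dvd ?u m" for m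
        using power_mons_insert that unfolding atLeastAtMost_Suc_image by blast
      show ?thesis
      proof (cases "exp_dvd ?u w")
        case True
        then obtain w' where w': "w = ?u + w'"
          by (auto simp: exp_dvd_iff)
        have "w' + unit_exp x \<in> power_mons ?E t'" "w' + unit_exp y \<in> power_mons ?E t'"
          using Suc.prems power_mons_colon_last[OF ch, of s' _ t']
          unfolding s t w' by (auto simp: add.assoc)
        then have "w' \<in> power_mons ?E t'"
          using Suc.hyps(1)[of "Suc s'" t'] Suc.hyps(2) s t by simp
        then show ?thesis
          using power_mons_colon_last[OF ch, of s' _ t'] unfolding s t w' by simp
      next
        case False
        consider (none) "\<not> exp_dvd ?u (w + unit_exp x)" "\<not> exp_dvd ?u (w + unit_exp y)"
          | (x) "exp_dvd ?u (w + unit_exp x)" "\<not> exp_dvd ?u (w + unit_exp y)"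
          | (y) "\<not> exp_dvd ?u (w + unit_exp x)" "exp_dvd ?u (w + unit_exp y)"
          | (both) "exp_dvd ?u (w + unit_exp x)" "exp_dvd ?u (w + unit_exp y)"
          by blast
        then have "w \<in> power_mons ?E' t"
        proof cases
          case none
          then show ?thesis
            using Suc.hyps(1)[of s' t] Suc.hyps(2) ndvd Suc.prems by (simp add: s)
        next
          case x
          then show ?thesis
            using chain_drop_variable[OF ch \<kappa> xy _ False] ndvd Suc.prems by (simp add: s)
        next
          case y
          then show ?thesis
            using chain_drop_variable[OF ch \<kappa>[symmetric] xy[symmetric] _ False] ndvd Suc.prems
            by (simp add: s)
        next
          case both
          have "exp_dvd ?u w"
            unfolding exp_dvd_def
          proof
            fix z
            show "expt ?u z \<le> expt w z"
              using both xy unfolding exp_dvd_def lookup_add expt_unit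
              by (cases "z = x") (auto dest: spec[of _ z])
          qed
          then show ?thesis
            using False by simp
        qed
        then show ?thesis
          using sub s by blast
      qed
    qed
  qed
qed

section \<open>Partitions into Stanley cells\<close>

text \<open>
  The monomials of \<open>x\<^sup>m K[Z]\<close>.
\<close>

definition cell :: "expo \<Rightarrow> nat set \<Rightarrow> expo set" where
  "cell m Z = {m + q | q. supp q \<subseteq> Z}"

inductive cell_partition :: "nat set \<Rightarrow> nat \<Rightarrow> expo set \<Rightarrow> bool" for V d where
  empty: "cell_partition V d {}"
| insert: "cell_partition V d A \<Longrightarrow> Z \<subseteq> V \<Longrightarrow> d \<le> card Z \<Longrightarrow> cell m Z \<inter> A = {} \<Longrightarrow>
    cell_partition V d (cell m Z \<union> A)"

lemma cell_partition_cell: "Z \<subseteq> V \<Longrightarrow> d \<le> card Z \<Longrightarrow> cell_partition V d (cell m Z)"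
  using cell_partition.insert[OF cell_partition.empty, of Z V d m] by simp

lemma cell_partition_Un:
  assumes "cell_partition V d A" "cell_partition V d B" "A \<inter> B = {}"
  shows "cell_partition V d (A \<union> B)"
  using assms
proof induction
  case empty
  then show ?case by simp
next
  case (insert A Z m)
  then have "cell_partition V d (A \<union> B)" by blast
  then have "cell_partition V d (cell m Z \<union> (A \<union> B))"
    using insert by (intro cell_partition.insert) blast+
  then show ?case by (simp add: Un_assoc)
qed

lemma cell_translate: "(+) u ` cell m Z = cell (u + m) Z"
  unfolding cell_def by (auto simp: add.assoc image_iff)

lemma cell_partition_translate:
  assumes "cell_partition V d A"
  shows "cell_partition V d ((+) u ` A)"
  using assms
proof induction
  case empty
  then show ?case by (simp add: cell_partition.empty)
next
  case (insert A Z m)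
  have "cell (u + m) Z \<inter> (+) u ` A = {}"
    using insert unfolding cell_translate[symmetric] by auto
  then show ?case
    using insert by (simp add: image_Un cell_translate cell_partition.insert)
qed

lemma cell_partition_mono: "cell_partition V d A \<Longrightarrow> d' \<le> d \<Longrightarrow> cell_partition V d' A"
  by (induction rule: cell_partition.induct) (auto intro: cell_partition.intros)

lemma expo_induct [case_names zero add_unit]:
  assumes "P 0" "\<And>v z. P v \<Longrightarrow> P (v + unit_exp z)"
  shows "P v"
proof (induction "\<Sum>z\<in>supp v. expt v z" arbitrary: v rule: less_induct)
  case less
  show ?case
  proof (cases "v = 0")
    case False
    then obtain z where z: "z \<in> supp v"
      by (metis keys_eq_empty ex_in_conv)
    define v' where "v' = v - unit_exp z"
    have v: "v = v' + unit_exp z"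
      using z unfolding v'_def
      by (intro poly_mapping_eqI) (auto simp: lookup_add expt_minus expt_unit in_keys_iff)
    have "(\<Sum>y\<in>supp v'. expt v' y) \<le> (\<Sum>y\<in>supp v. expt v' y)"
      by (rule sum_mono2) (auto simp: v supp_plus)
    also have "\<dots> < (\<Sum>y\<in>supp v. expt v y)"
      by (rule sum_strict_mono_ex1) (use z in \<open>auto simp: v lookup_add expt_unit\<close>)
    finally have "P v'" by (rule less)
    then show ?thesis unfolding v by (rule assms(2))
  qed (simp add: assms(1))
qed

lemma supp_unit: "supp (unit_exp z) = {z}"
  by (simp add: unit_exp_def)

text \<open>
  Passing from \<open>v\<close> to \<open>z v\<close> returns to the complement exactly those multiples of \<open>v\<close> that contain no
  further factor \<open>z\<close>, and these form a cell with one variable less.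
\<close>

lemma cell_remove_subcell:
  assumes "Z \<subseteq> V" "finite Z" "supp v \<subseteq> Z"
  shows "cell_partition V (card Z - 1) (cell m Z - cell (m + v) Z)"
  using assms(3)
proof (induction v rule: expo_induct)
  case zero
  then show ?case by (simp add: cell_partition.empty)
next
  case (add_unit v z)
  then have z: "z \<in> Z" and v: "supp v \<subseteq> Z"
    by (auto simp: supp_plus supp_unit)
  have split: "cell m Z - cell (m + (v + unit_exp z)) Z
      = (cell m Z - cell (m + v) Z) \<union> cell (m + v) (Z - {z})" (is "?L = ?A \<union> ?B")
  proof (intro equalityI subsetI)
    fix w assume w: "w \<in> ?L"
    show "w \<in> ?A \<union> ?B"
    proof (cases "w \<in> cell (m + v) Z")
      case True
      then obtain q where q: "w = m + v + q" "supp q \<subseteq> Z"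
        unfolding cell_def by blast
      have "z \<notin> supp q"
      proof
        assume zq: "z \<in> supp q"
        define q' where "q' = q - unit_exp z"
        have q': "q = unit_exp z + q'"
          using zq unfolding q'_def
          by (intro poly_mapping_eqI) (auto simp: lookup_add expt_minus expt_unit in_keys_iff)
        then have "supp q' \<subseteq> Z"
          using q(2) by (auto simp: supp_plus)
        then show False
          using w q q' unfolding cell_def by (auto simp: add.assoc)
      qed
      then show ?thesis
        using q unfolding cell_def by blast
    qed (use w in blast)
  next
    fix w assume "w \<in> ?A \<union> ?B"
    then show "w \<in> ?L"
    proof
      assume "w \<in> ?A"
      moreover have "cell (m + (v + unit_exp z)) Z \<subseteq> cell (m + v) Z"
      proof
        fix x assume "x \<in> cell (m + (v + unit_exp z)) Z"
        then obtain q where "x = (m + v) + (unit_exp z + q)" "supp q \<subseteq> Z"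
          unfolding cell_def by (auto simp: add.assoc)
        moreover from this have "supp (unit_exp z + q) \<subseteq> Z"
          using z by (simp add: supp_plus supp_unit)
        ultimately show "x \<in> cell (m + v) Z"
          unfolding cell_def by blast
      qed
      ultimately show ?thesis by blast
    next
      assume "w \<in> ?B"
      then obtain q where q: "w = m + (v + q)" "supp q \<subseteq> Z - {z}"
        unfolding cell_def by (auto simp: add.assoc)
      have "w \<notin> cell (m + (v + unit_exp z)) Z"
      proof
        assume "w \<in> cell (m + (v + unit_exp z)) Z"
        then obtain q' where "m + (v + q) = m + (v + (unit_exp z + q'))"
          unfolding q(1) cell_def by (auto simp: add.assoc)
        then have "q = unit_exp z + q'" by simp
        then show False
          using q(2) by (auto simp: supp_plus supp_unit)
      qed
      moreover have "supp (v + q) \<subseteq> Z"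
        using q(2) v by (auto simp: supp_plus)
      ultimately show ?thesis
        using q(1) unfolding cell_def by blast
    qed
  qed
  have "cell_partition V (card Z - 1) ?B"
    by (rule cell_partition_cell) (use z assms in \<open>auto simp: card_Diff_singleton\<close>)
  moreover have "?B \<subseteq> cell (m + v) Z"
    unfolding cell_def by blast
  ultimately show ?case
    unfolding split using add_unit.IH[OF v] by (intro cell_partition_Un) auto
qed

text \<open>
  The monomials of a cell that \<open>u\<close> divides form either the empty set or a subcell with the same
  variables, so \<open>cell_remove_subcell\<close> treats each cell separately.
\<close>

lemma cell_partition_remove_multiples:
  assumes "cell_partition V d A" "finite V"
  shows "cell_partition V (d - 1) (A - {m. exp_dvd u m})"
  using assms(1)
proof induction
  case empty
  then show ?case by (simp add: cell_partition.empty)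
next
  case (insert A Z m)
  have fin: "finite Z"
    using insert assms(2) finite_subset by blast
  have "cell_partition V (d - 1) (cell m Z - {w. exp_dvd u w})"
  proof (cases "\<exists>y. y \<notin> Z \<and> expt m y < expt u y")
    case True
    then obtain y where y: "y \<notin> Z" "expt m y < expt u y"
      by blast
    have "\<not> exp_dvd u w" if "w \<in> cell m Z" for w
    proof -
      have "expt w y = expt m y"
        using that y(1) unfolding cell_def by (auto simp: lookup_add in_keys_iff)
      then show ?thesis
        using y(2) unfolding exp_dvd_def by (metis not_le)
    qed
    then have "cell m Z - {w. exp_dvd u w} = cell m Z"
      by blast
    then show ?thesis
      using insert by (simp add: cell_partition_cell)
  next
    case False
    define v where "v = u - m"
    have v: "supp v \<subseteq> Z"
      using False by (auto simp: v_def in_keys_iff expt_minus)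
    have dvd: "exp_dvd u (m + q) \<longleftrightarrow> exp_dvd v q" for q
      by (simp add: exp_dvd_def v_def lookup_add expt_minus le_diff_conv add.commute)
    have "{w \<in> cell m Z. exp_dvd u w} = cell (m + v) Z"
    proof (intro equalityI subsetI)
      fix w assume "w \<in> {w \<in> cell m Z. exp_dvd u w}"
      then obtain q where q: "w = m + q" "supp q \<subseteq> Z" "exp_dvd v q"
        unfolding cell_def by (auto simp: dvd)
      then obtain q' where "q = v + q'"
        unfolding exp_dvd_iff by blast
      then show "w \<in> cell (m + v) Z"
        using q unfolding cell_def by (auto simp: supp_plus add.assoc)
    next
      fix w assume "w \<in> cell (m + v) Z"
      then obtain q where q: "w = m + (v + q)" "supp q \<subseteq> Z"
        unfolding cell_def by (auto simp: add.assoc)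
      moreover have "exp_dvd u w"
        unfolding q(1) dvd by (auto simp: exp_dvd_iff)
      moreover have "supp (v + q) \<subseteq> Z"
        using q(2) v by (simp add: supp_plus)
      ultimately show "w \<in> {w \<in> cell m Z. exp_dvd u w}"
        unfolding cell_def by blast
    qed
    then have "cell m Z - {w. exp_dvd u w} = cell m Z - cell (m + v) Z"
      by blast
    then show ?thesis
      using cell_partition_mono[OF cell_remove_subcell[OF insert.hyps(2) fin v]] insert.hyps(3)
      by (simp add: diff_le_mono)
  qed
  then have "cell_partition V (d - 1) ((cell m Z - {w. exp_dvd u w}) \<union> (A - {w. exp_dvd u w}))"
    using insert by (intro cell_partition_Un) auto
  then show ?case
    by (simp add: Un_Diff)
qed

text \<open>
  The monomials outside \<open>I\<^sup>t\<close> split according to divisibility by the last generator \<open>u\<close>. The multiples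
  of \<open>u\<close> are a translate of the monomials outside \<open>I\<^bsup>t-1\<^esup>\<close>; the others are the
  monomials outside the power of the ideal without \<open>u\<close> that \<open>u\<close> does not divide, and this last
  condition costs one dimension.
\<close>

theorem standard_cell_partition:
  assumes ch: "chain \<kappa> e" and V: "finite V" "\<And>l. l \<in> {1..s} \<Longrightarrow> supp (e l) \<subseteq> V"
  shows "cell_partition V (card V - s) {m. supp m \<subseteq> V \<and> m \<notin> power_mons (e ` {1..s}) t}"
  using V(2)
proof (induction s arbitrary: t)
  case 0
  show ?case
  proof (cases t)
    case 0
    then show ?thesis by (simp add: cell_partition.empty)
  next
    case (Suc t')
    have "{m. supp m \<subseteq> V \<and> m \<notin> power_mons (e ` {1..0}) t} = cell 0 V"
      by (auto simp: Suc power_mons_empty cell_def)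
    then show ?thesis
      by (simp add: cell_partition_cell)
  qed
next
  case (Suc s)
  note IHs = Suc.IH and prems = Suc.prems
  let ?u = "e (Suc s)" and ?E = "e ` {1..Suc s}" and ?E' = "e ` {1..s}"
  show ?case
  proof (induction t)
    case 0
    then show ?case by (simp add: cell_partition.empty)
  next
    case (Suc t)
    let ?L = "{m. supp m \<subseteq> V \<and> m \<notin> power_mons ?E (Suc t)}"
    let ?A = "(+) ?u ` {m. supp m \<subseteq> V \<and> m \<notin> power_mons ?E t}"
    let ?B = "{m. supp m \<subseteq> V \<and> m \<notin> power_mons ?E' (Suc t)} - {m. exp_dvd ?u m}"
    have u: "supp ?u \<subseteq> V"
      using prems by simp
    have A: "?A = {m \<in> ?L. exp_dvd ?u m}"
    proof (intro equalityI subsetI)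
      fix w assume "w \<in> ?A"
      then show "w \<in> {m \<in> ?L. exp_dvd ?u m}"
        using u power_mons_colon_last[OF ch] by (auto simp: supp_plus exp_dvd_iff)
    next
      fix w assume w: "w \<in> {m \<in> ?L. exp_dvd ?u m}"
      then obtain m where m: "w = ?u + m"
        by (auto simp: exp_dvd_iff)
      then have "supp m \<subseteq> V" "m \<notin> power_mons ?E t"
        using w power_mons_colon_last[OF ch] by (auto simp: supp_plus)
      then show "w \<in> ?A"
        using m by blast
    qed
    have sub: "power_mons ?E' (Suc t) \<subseteq> power_mons ?E (Suc t)"
      by (rule power_mons_mono) auto
    have B: "?B = {m \<in> ?L. \<not> exp_dvd ?u m}"
      using sub power_mons_insert[of _ ?u ?E' "Suc t"] unfolding atLeastAtMost_Suc_image by blast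
    have "cell_partition V (card V - Suc s) ?A"
      by (rule cell_partition_translate) (fact Suc)
    moreover have "cell_partition V (card V - Suc s) ?B"
      using cell_partition_remove_multiples[OF IHs[of "Suc t"] V(1), of ?u] prems by simp
    ultimately have "cell_partition V (card V - Suc s) (?A \<union> ?B)"
      by (rule cell_partition_Un) (use A B in blast)
    moreover have "?A \<union> ?B = ?L"
      unfolding A B by blast
    ultimately show ?case by simp
  qed
qed

lemma cell_partition_indexed:
  assumes "cell_partition V d A"
  shows "\<exists>(r::nat) m Z. (\<forall>i<r. Z i \<subseteq> V \<and> d \<le> card (Z i)) \<and> A = (\<Union>i<r. cell (m i) (Z i)) \<and>
    (\<forall>i<r. \<forall>j<r. i \<noteq> j \<longrightarrow> cell (m i) (Z i) \<inter> cell (m j) (Z j) = {})"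
  using assms
proof induction
  case empty
  then show ?case by (intro exI[of _ 0]) simp
next
  case (insert A Z0 m0)
  then obtain r :: nat and m Z where *: "\<forall>i<r. Z i \<subseteq> V \<and> d \<le> card (Z i)" "A = (\<Union>i<r. cell (m i) (Z i))"
    "\<forall>i<r. \<forall>j<r. i \<noteq> j \<longrightarrow> cell (m i) (Z i) \<inter> cell (m j) (Z j) = {}"
    by blast
  have disj: "cell m0 Z0 \<inter> cell (m i) (Z i) = {}" if "i < r" for i
    using insert.hyps(4) that unfolding *(2) by blast
  have un: "(\<Union>i<Suc r. cell ((m(r := m0)) i) ((Z(r := Z0)) i)) = cell m0 Z0 \<union> A"
    unfolding *(2) lessThan_Suc by auto
  let ?m = "m(r := m0)" and ?Z = "Z(r := Z0)"
  have "\<forall>i<Suc r. ?Z i \<subseteq> V \<and> d \<le> card (?Z i)"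
    using *(1) insert.hyps(2,3) by (simp add: less_Suc_eq)
  moreover have "cell (?m i) (?Z i) \<inter> cell (?m j) (?Z j) = {}" if ij: "i < Suc r" "j < Suc r" "i \<noteq> j" for i j
  proof -
    consider "i < r" "j < r" | "i = r" "j < r" | "i < r" "j = r"
      using ij by (auto simp: less_Suc_eq)
    then show ?thesis
      using ij *(3) disj by cases (simp_all add: Int_commute)
  qed
  ultimately have "(\<forall>i<Suc r. ?Z i \<subseteq> V \<and> d \<le> card (?Z i)) \<and>
    cell m0 Z0 \<union> A = (\<Union>i<Suc r. cell (?m i) (?Z i)) \<and>
    (\<forall>i<Suc r. \<forall>j<Suc r. i \<noteq> j \<longrightarrow> cell (?m i) (?Z i) \<inter> cell (?m j) (?Z j) = {})"
    unfolding un by (intro conjI allI impI) metis+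
  then show ?case
    by (intro exI[of _ "Suc r"] exI[of _ ?m] exI[of _ ?Z])
qed

section \<open>A monomial annihilated by the private variables\<close>

lemma expo_with_values:
  assumes "finite V"
  obtains m :: expo where "\<And>z. expt m z = (if z \<in> V then f z else 0)"
proof -
  have "expt (\<Sum>z\<in>V. Poly_Mapping.single z (f z)) y = (if y \<in> V then f y else 0)" for y
    using assms by (simp add: lookup_sum lookup_single when_def)
  then show thesis by (rule that)
qed

text \<open>
  The monomial is \<open>x\<^bsub>c 1\<^esub>\<^sup>t\<close> times the power \<open>t + 1\<close> of all non-private variables (for \<open>s = 0\<close>
  the first factor is absent). A product of
  \<open>t + 1\<close> generators has total degree \<open>t + 1\<close> in the private variables, which is too much by one;
  after multiplication by \<open>x\<^bsub>c k\<^esub>\<close> the product \<open>u\<^sub>1\<^sup>t u\<^sub>k\<close> divides it.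
\<close>

lemma power_mons_socle:
  fixes e :: "nat \<Rightarrow> expo" and c :: "nat \<Rightarrow> nat" and s :: nat
  assumes V: "finite V" "\<And>l. l \<in> {1..s} \<Longrightarrow> supp (e l) \<subseteq> V"
    and sqfree: "\<And>l z. expt (e l) z \<le> 1"
    and c: "c ` {1..s} \<subseteq> V"
    and priv: "\<And>k l. k \<in> {1..s} \<Longrightarrow> l \<in> {1..s} \<Longrightarrow> expt (e l) (c k) = (if l = k then 1 else 0)"
  obtains m where "supp m \<subseteq> V" "m \<notin> power_mons (e ` {1..s}) (Suc t)"
    "\<And>k. k \<in> {1..s} \<Longrightarrow> m + unit_exp (c k) \<in> power_mons (e ` {1..s}) (Suc t)"
proof -
  let ?P = "c ` {1..s}"
  define g where "g z = (if z \<in> ?P then (if z = c 1 then t else 0) else Suc t)" for z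
  obtain m :: expo where "\<And>z. expt m z = (if z \<in> V then g z else 0)"
    using expo_with_values[OF V(1), of g] by blast
  note m = this[unfolded g_def]
  have inj: "c k = c l \<longleftrightarrow> k = l" if "k \<in> {1..s}" "l \<in> {1..s}" for k l
    using priv[OF that] priv[OF that(2) that(2)] by (auto split: if_splits)
  have cV: "c k \<in> V" if "k \<in> {1..s}" for k
    using c that by blast
  have "supp m \<subseteq> V"
    by (auto simp: in_keys_iff m split: if_splits)
  moreover have "m \<notin> power_mons (e ` {1..s}) (Suc t)"
  proof
    assume "m \<in> power_mons (e ` {1..s}) (Suc t)"
    then obtain X v where X: "m = \<Sum>\<^sub># X + v" "set_mset X \<subseteq> e ` {1..s}" "size X = Suc t"
      unfolding power_mons_def by blast
    have s: "1 \<in> {1..s}"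
      using X(2,3) by (cases X) auto
    have "(\<Sum>k\<in>{1..s}. expt (\<Sum>\<^sub># Y) (c k)) = size Y" if "set_mset Y \<subseteq> e ` {1..s}" for Y
      using that
    proof (induction Y)
      case (add u Y)
      then obtain l where l: "u = e l" "l \<in> {1..s}" by auto
      have "(\<Sum>k\<in>{1..s}. expt u (c k)) = (\<Sum>k\<in>{1..s}. if l = k then 1 else 0)"
        unfolding l(1) by (rule sum.cong) (use priv l in auto)
      also have "\<dots> = 1"
        using l(2) by simp
      finally show ?case
        using add by (simp add: lookup_add sum.distrib)
    qed simp
    then have "Suc t = (\<Sum>k\<in>{1..s}. expt (\<Sum>\<^sub># X) (c k))"
      using X by simp
    also have "\<dots> \<le> (\<Sum>k\<in>{1..s}. expt m (c k))"
      by (rule sum_mono) (simp add: X(1) lookup_add)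
    also have "\<dots> = (\<Sum>k\<in>{1..s}. if k = 1 then t else 0)"
      by (rule sum.cong) (use cV cV[OF s] inj s in \<open>auto simp: m\<close>)
    also have "\<dots> = t"
      using s by simp
    finally show False by simp
  qed
  moreover have "m + unit_exp (c k) \<in> power_mons (e ` {1..s}) (Suc t)" if k: "k \<in> {1..s}" for k
  proof (rule power_mons_dvd[of "add_mset (e k) (replicate_mset t (e 1))"])
    have s: "1 \<in> {1..s}"
      using k by simp
    have rep: "expt (\<Sum>\<^sub># (replicate_mset i u)) z = i * expt u z" for i u z
      by (induction i) (simp_all add: lookup_add)
    show "exp_dvd (\<Sum>\<^sub># (add_mset (e k) (replicate_mset t (e 1)))) (m + unit_exp (c k))"
      unfolding exp_dvd_def
    proof
      fix z
      have "expt (e k) z + t * expt (e 1) z \<le> expt m z + (if z = c k then 1 else 0)"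
      proof (cases "z \<in> V")
        case True
        show ?thesis
        proof (cases "z \<in> ?P")
          case True
          then obtain l where l: "z = c l" "l \<in> {1..s}" by blast
          then have "z \<in> V"
            using c by blast
          then show ?thesis
            using True l s k inj priv by (auto simp: m)
        next
          case False
          have "expt (e k) z + t * expt (e 1) z \<le> 1 + t * 1"
            by (intro add_mono mult_le_mono sqfree order.refl)
          then show ?thesis
            using \<open>z \<in> V\<close> False by (simp add: m)
        qed
      next
        case False
        then have "expt (e k) z = 0" "expt (e 1) z = 0"
          using V(2) k s by (meson in_keys_iff subsetD)+
        then show ?thesis by simp
      qed
      then show "expt (\<Sum>\<^sub># (add_mset (e k) (replicate_mset t (e 1)))) z \<le> expt (m + unit_exp (c k)) z"
        by (simp add: lookup_add rep expt_unit del: sum_mset_replicate_mset)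
    qed
  qed (use k in auto)
  ultimately show thesis by (rule that)
qed

section \<open>Weighted powers of a regular sequence\<close>

text \<open>
  For pairs \<open>(f\<^sub>i, w\<^sub>i)\<close> with \<open>w\<^sub>i \<ge> 1\<close>, this is \<open>F\<^sub>m U\<close>, where \<open>F\<^sub>m\<close> is generated by the monomials in
  the \<open>f\<^sub>i\<close> of weight at least \<open>m\<close>. The recursion separates the monomials divisible by the first
  element from the others. The index \<open>m - (w - 1)\<close> is \<open>(m + 1) - w\<close>, written so that it decreases
  also for \<open>w = 0\<close>.
\<close>

fun wpower :: "'a::comm_ring_1 set \<Rightarrow> ('a \<times> nat) list \<Rightarrow> nat \<Rightarrow> 'a set" where
  "wpower U [] 0 = U"
| "wpower U [] (Suc m) = {0}"
| "wpower U (fw # fs) 0 = U"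
| "wpower U (fw # fs) (Suc m) =
    {fst fw * x + y | x y. x \<in> wpower U (fw # fs) (m - (snd fw - 1)) \<and> y \<in> wpower U fs (Suc m)}"

lemma wpower_0 [simp]: "wpower U fs 0 = U"
  by (cases fs) simp_all

fun digit_weights :: "nat \<Rightarrow> nat \<Rightarrow> 'a list \<Rightarrow> ('a \<times> nat) list" where
  "digit_weights N W [] = []"
| "digit_weights N W (f # fs) = (f, W) # digit_weights N (W * N) fs"

text \<open>
  The monomial whose exponents are the digits of \<open>j\<close> in base \<open>N\<close>; for the weights \<open>1, N, N\<^sup>2, \<dots>\<close>
  its weight is \<open>j\<close>.
\<close>

fun digit_monomial :: "nat \<Rightarrow> 'a::comm_ring_1 list \<Rightarrow> nat \<Rightarrow> 'a" where
  "digit_monomial N [] j = 1"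
| "digit_monomial N (f # fs) j = f ^ (j mod N) * digit_monomial N fs (j div N)"

lemma map_fst_digit_weights: "map fst (digit_weights N W fs) = fs"
  by (induction fs arbitrary: W) simp_all

text \<open>
  A subring is carried along explicitly, because the polynomials in \<open>x\<^sub>1, \<dots>, x\<^sub>n\<close> form only a subset of
  their type. Modules \<open>C/J\<close> are handled through ideals of \<open>C\<close> that contain \<open>J\<close>.
\<close>

locale comm_subring =
  fixes C :: "'a::comm_ring_1 set"
  assumes zero_closed: "0 \<in> C" and one_closed: "1 \<in> C"
    and add_closed: "x \<in> C \<Longrightarrow> y \<in> C \<Longrightarrow> x + y \<in> C"
    and mult_closed: "x \<in> C \<Longrightarrow> y \<in> C \<Longrightarrow> x * y \<in> C"
    and uminus_closed: "x \<in> C \<Longrightarrow> - x \<in> C"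
begin

lemma minus_closed: "x \<in> C \<Longrightarrow> y \<in> C \<Longrightarrow> x - y \<in> C"
  using add_closed[OF _ uminus_closed, of x y] by simp

lemma sum_closed: "(\<And>i. i \<in> A \<Longrightarrow> g i \<in> C) \<Longrightarrow> sum g A \<in> C"
  by (induction A rule: infinite_finite_induct) (auto intro: zero_closed add_closed)

lemma power_closed: "x \<in> C \<Longrightarrow> x ^ i \<in> C"
  by (induction i) (auto intro: one_closed mult_closed)

definition subideal :: "'a set \<Rightarrow> bool" where
  "subideal N \<longleftrightarrow> N \<subseteq> C \<and> 0 \<in> N \<and> (\<forall>x\<in>N. \<forall>y\<in>N. x + y \<in> N) \<and> (\<forall>a\<in>C. \<forall>x\<in>N. a * x \<in> N)"

lemma subideal_sub: "subideal N \<Longrightarrow> x \<in> N \<Longrightarrow> x \<in> C"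
  and subideal_zero: "subideal N \<Longrightarrow> 0 \<in> N"
  and subideal_add: "subideal N \<Longrightarrow> x \<in> N \<Longrightarrow> y \<in> N \<Longrightarrow> x + y \<in> N"
  and subideal_mult: "subideal N \<Longrightarrow> a \<in> C \<Longrightarrow> x \<in> N \<Longrightarrow> a * x \<in> N"
  unfolding subideal_def by blast+

lemma subideal_uminus: "subideal N \<Longrightarrow> x \<in> N \<Longrightarrow> - x \<in> N"
  using subideal_mult[OF _ uminus_closed[OF one_closed], of N x] by simp

lemma subideal_minus: "subideal N \<Longrightarrow> x \<in> N \<Longrightarrow> y \<in> N \<Longrightarrow> x - y \<in> N"
  using subideal_add[OF _ _ subideal_uminus, of N x y] by simp

lemma subideal_sum: "subideal N \<Longrightarrow> (\<And>i. i \<in> A \<Longrightarrow> g i \<in> N) \<Longrightarrow> sum g A \<in> N"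
  by (induction A rule: infinite_finite_induct) (auto intro: subideal_zero subideal_add)

lemma subideal_C: "subideal C"
  unfolding subideal_def using zero_closed add_closed mult_closed by blast

definition adjoin :: "'a set \<Rightarrow> 'a \<Rightarrow> 'a set" where
  "adjoin N f = {x + f * y | x y. x \<in> N \<and> y \<in> C}"

lemma adjoin_iff: "u \<in> adjoin N f \<longleftrightarrow> (\<exists>x\<in>N. \<exists>y\<in>C. u = x + f * y)"
  unfolding adjoin_def by blast

lemma subideal_add_mult:
  assumes N: "subideal N" and M: "subideal M" and f: "f \<in> C"
  shows "subideal {f * x + y | x y. x \<in> N \<and> y \<in> M}" (is "subideal ?S")
  unfolding subideal_def
proof (intro conjI ballI)
  show "?S \<subseteq> C"
    using subideal_sub[OF N] subideal_sub[OF M] f by (auto intro: add_closed mult_closed)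
  show "0 \<in> ?S"
    using subideal_zero[OF N] subideal_zero[OF M]
    by (intro CollectI exI[of _ 0]) simp
next
  fix u v assume "u \<in> ?S" "v \<in> ?S"
  then obtain x y x' y' where "u = f * x + y" "v = f * x' + y'" "x \<in> N" "x' \<in> N" "y \<in> M" "y' \<in> M"
    by blast
  moreover from this have "u + v = f * (x + x') + (y + y')"
    by (simp add: algebra_simps)
  ultimately show "u + v \<in> ?S"
    using subideal_add[OF N] subideal_add[OF M] by blast
next
  fix a u assume "a \<in> C" "u \<in> ?S"
  moreover from this obtain x y where "u = f * x + y" "x \<in> N" "y \<in> M"
    by blast
  moreover from this have "a * u = f * (a * x) + a * y"
    by (simp add: algebra_simps)
  ultimately show "a * u \<in> ?S"
    using subideal_mult[OF N] subideal_mult[OF M] by blast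
qed

lemma adjoin_alt: "adjoin N f = {f * x + y | x y. x \<in> C \<and> y \<in> N}"
  unfolding adjoin_def by (auto simp: add.commute)

lemma subideal_adjoin: "subideal N \<Longrightarrow> f \<in> C \<Longrightarrow> subideal (adjoin N f)"
  unfolding adjoin_alt by (rule subideal_add_mult[OF subideal_C])

lemma subideal_singleton_zero: "subideal {0}"
  unfolding subideal_def using zero_closed by auto

fun weakly_regular :: "'a set \<Rightarrow> 'a list \<Rightarrow> bool" where
  "weakly_regular N [] \<longleftrightarrow> True"
| "weakly_regular N (f # fs) \<longleftrightarrow>
    (\<forall>x\<in>C. f * x \<in> N \<longrightarrow> x \<in> N) \<and> weakly_regular (adjoin N f) fs"

lemma subideal_wpower:
  "subideal U \<Longrightarrow> fst ` set fs \<subseteq> C \<Longrightarrow> subideal (wpower U fs m)"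
proof (induction U fs m rule: wpower.induct)
  case (4 U fw fs m)
  then show ?case
    unfolding wpower.simps by (intro subideal_add_mult) auto
qed (simp_all add: subideal_singleton_zero)

lemma wpower_sub: "subideal U \<Longrightarrow> fst ` set fs \<subseteq> C \<Longrightarrow> x \<in> wpower U fs m \<Longrightarrow> x \<in> U"
proof (induction U fs m arbitrary: x rule: wpower.induct)
  case (4 U fw fs m)
  then obtain y z where "x = fst fw * y + z" "y \<in> wpower U (fw # fs) (m - (snd fw - 1))"
    "z \<in> wpower U fs (Suc m)"
    by auto
  then show ?case
    using 4 by (auto intro!: subideal_add subideal_mult)
qed (auto intro: subideal_zero)

lemma wpower_antimono:
  "subideal U \<Longrightarrow> fst ` set fs \<subseteq> C \<Longrightarrow> m \<le> m' \<Longrightarrow> wpower U fs m' \<subseteq> wpower U fs m"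
proof (induction U fs m' arbitrary: m rule: wpower.induct)
  case (4 U fw fs m' m)
  show ?case
  proof (cases m)
    case 0
    then show ?thesis
      using wpower_sub[OF "4.prems"(1,2), of _ "Suc m'"] by auto
  next
    case (Suc m0)
    have "wpower U (fw # fs) (m' - (snd fw - 1)) \<subseteq> wpower U (fw # fs) (m0 - (snd fw - 1))"
      using 4 Suc by (intro "4.IH"(1)) auto
    moreover have "wpower U fs (Suc m') \<subseteq> wpower U fs (Suc m0)"
      using 4 Suc by (intro "4.IH"(2)) auto
    ultimately show ?thesis
      unfolding Suc wpower.simps by blast
  qed
next
  case (2 U m' m)
  then show ?case
    by (cases m) (auto intro: subideal_zero)
qed auto

lemma wpower_tail:
  assumes "subideal U" "fst ` set (fw # fs) \<subseteq> C"
  shows "wpower U fs m \<subseteq> wpower U (fw # fs) m"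
proof (cases m)
  case (Suc m')
  show ?thesis
  proof
    fix y assume "y \<in> wpower U fs m"
    moreover have "0 \<in> wpower U (fw # fs) (m' - (snd fw - 1))"
      using subideal_wpower[OF assms] by (rule subideal_zero)
    moreover have "y = fst fw * 0 + y"
      by simp
    ultimately show "y \<in> wpower U (fw # fs) m"
      unfolding Suc wpower.simps by blast
  qed
qed simp

lemma wpower_head:
  assumes "subideal U" "fst ` set fs \<subseteq> C" "w \<ge> 1" "x \<in> wpower U ((f, w) # fs) m"
  shows "f * x \<in> wpower U ((f, w) # fs) (m + w)"
proof -
  obtain w' where w: "w = Suc w'"
    using assms(3) by (cases w) auto
  have "0 \<in> wpower U fs (Suc (m + w'))"
    using subideal_wpower[OF assms(1,2)] by (rule subideal_zero)
  moreover have "f * x = f * x + 0"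
    by simp
  ultimately have "f * x \<in> {f * x + y | x y. x \<in> wpower U ((f, w) # fs) m \<and> y \<in> wpower U fs (Suc (m + w'))}"
    using assms(4) by blast
  then show ?thesis
    by (simp add: w)
qed

lemma wpower_adjoin:
  assumes "subideal N" "f \<in> C"
  shows "fst ` set fs \<subseteq> C \<Longrightarrow> u \<in> wpower (adjoin N f) fs m \<Longrightarrow>
    \<exists>x\<in>wpower N fs m. \<exists>y\<in>wpower C fs m. u = x + f * y"
proof (induction "adjoin N f" fs m arbitrary: u rule: wpower.induct)
  case (4 fw fs m)
  then obtain a b where ab: "u = fst fw * a + b" "a \<in> wpower (adjoin N f) (fw # fs) (m - (snd fw - 1))"
    "b \<in> wpower (adjoin N f) fs (Suc m)"
    by auto
  have fs': "fst ` set fs \<subseteq> C"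
    using 4 by auto
  obtain a1 a2 where a: "a1 \<in> wpower N (fw # fs) (m - (snd fw - 1))"
    "a2 \<in> wpower C (fw # fs) (m - (snd fw - 1))" "a = a1 + f * a2"
    using 4 ab(2) by blast
  obtain b1 b2 where b: "b1 \<in> wpower N fs (Suc m)" "b2 \<in> wpower C fs (Suc m)" "b = b1 + f * b2"
    using 4 ab(3) fs' by blast
  have "u = (fst fw * a1 + b1) + f * (fst fw * a2 + b2)"
    unfolding ab(1) a(3) b(3) by (simp add: algebra_simps)
  moreover have "fst fw * a1 + b1 \<in> wpower N (fw # fs) (Suc m)"
    "fst fw * a2 + b2 \<in> wpower C (fw # fs) (Suc m)"
    using a b by auto
  ultimately show ?case by blast
next
  case (2 m)
  then show ?case by auto
qed (auto simp: adjoin_iff)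

text \<open>
  If \<open>f\<^sub>1, \<dots>, f\<^sub>r\<close> is regular on \<open>C/N\<close>, then \<open>F\<^sub>m \<inter> N = F\<^sub>m N\<close>, a vanishing of \<open>Tor\<^sub>1\<close>. Write an
  element of the left side as \<open>f p + q\<close>, where \<open>q\<close> involves only the later elements. Modulo
  \<open>N + f C\<close> the induction hypothesis moves \<open>q\<close> into \<open>F\<^sub>m N + f F\<^sub>m\<close>, and after cancellation of \<open>f\<close>
  the weight has dropped.
\<close>

lemma wpower_Int:
  assumes "fst ` set fs \<subseteq> C" "subideal N" "weakly_regular N (map fst fs)"
    "u \<in> wpower C fs m" "u \<in> N"
  shows "u \<in> wpower N fs m"
  using assms
proof (induction fs arbitrary: N u m)
  case Nil
  then show ?case by (cases m) auto
next
  case (Cons fw fs)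
  define f where "f = fst fw"
  note N = \<open>subideal N\<close>
  have f: "f \<in> C" and fs: "fst ` set fs \<subseteq> C" and ffs: "fst ` set (fw # fs) \<subseteq> C"
    using Cons.prems(1) by (auto simp: f_def)
  have reg: "x \<in> N" if "x \<in> C" "f * x \<in> N" for x
    using Cons.prems(3) that by (simp add: f_def)
  show ?case
    using Cons.prems(4,5)
  proof (induction m arbitrary: u rule: less_induct)
    case (less m u)
    show ?case
    proof (cases m)
      case 0
      then show ?thesis using less by simp
    next
      case (Suc m')
      let ?k = "m' - (snd fw - 1)"
      obtain p q where pq: "u = f * p + q" "p \<in> wpower C (fw # fs) ?k" "q \<in> wpower C fs m"
        using less.prems(1) by (auto simp: Suc f_def)
      have pC: "p \<in> C"
        using wpower_sub[OF subideal_C ffs pq(2)] .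
      have "q = u + f * (- p)"
        using pq(1) by simp
      then have "q \<in> adjoin N f"
        using less.prems(2) uminus_closed[OF pC] unfolding adjoin_iff by blast
      then have "q \<in> wpower (adjoin N f) fs m"
        using Cons.IH[OF fs subideal_adjoin[OF N f] _ pq(3)] Cons.prems(3) by (simp add: f_def)
      then obtain q1 q2 where q: "q1 \<in> wpower N fs m" "q2 \<in> wpower C fs m" "q = q1 + f * q2"
        using wpower_adjoin[OF N f fs] by blast
      have "q2 \<in> wpower C (fw # fs) ?k"
        using subsetD[OF wpower_antimono[OF subideal_C ffs] subsetD[OF wpower_tail[OF subideal_C ffs] q(2)]]
        by (simp add: Suc)
      then have pq2: "p + q2 \<in> wpower C (fw # fs) ?k"
        using subideal_add[OF subideal_wpower[OF subideal_C ffs]] pq(2) by blast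
      have "f * (p + q2) = u - q1"
        unfolding pq(1) q(3) by (simp add: algebra_simps)
      moreover have "q1 \<in> N"
        using wpower_sub[OF N fs q(1)] .
      ultimately have "f * (p + q2) \<in> N"
        using less.prems(2) subideal_minus[OF N] by simp
      then have "p + q2 \<in> N"
        using reg wpower_sub[OF subideal_C ffs pq2] by blast
      then have "p + q2 \<in> wpower N (fw # fs) ?k"
        using less.IH[OF _ pq2] Suc by simp
      moreover have "u = f * (p + q2) + q1"
        unfolding pq(1) q(3) by (simp add: algebra_simps)
      ultimately show ?thesis
        using q(1) unfolding Suc wpower.simps f_def by blast
    qed
  qed
qed

definition filt :: "'a set \<Rightarrow> ('a \<times> nat) list \<Rightarrow> nat \<Rightarrow> 'a set" where
  "filt J fs m = {x + j | x j. x \<in> wpower C fs m \<and> j \<in> J}"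

lemma filt_iff: "u \<in> filt J fs m \<longleftrightarrow> (\<exists>x\<in>wpower C fs m. \<exists>j\<in>J. u = x + j)"
  unfolding filt_def by blast

lemma subideal_filt:
  assumes "subideal J" "fst ` set fs \<subseteq> C"
  shows "subideal (filt J fs m)"
  using subideal_add_mult[OF subideal_wpower[OF subideal_C assms(2)] assms(1) one_closed, of m]
  unfolding filt_def by simp

lemma filt_0: "subideal J \<Longrightarrow> u \<in> C \<Longrightarrow> u \<in> filt J fs 0"
  unfolding filt_iff using subideal_zero by force

lemma filt_antimono:
  assumes "fst ` set fs \<subseteq> C" "m \<le> m'"
  shows "filt J fs m' \<subseteq> filt J fs m"
  using wpower_antimono[OF subideal_C assms] unfolding filt_def by blast

lemma filt_J: "subideal J \<Longrightarrow> fst ` set fs \<subseteq> C \<Longrightarrow> j \<in> J \<Longrightarrow> j \<in> filt J fs m"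
  unfolding filt_iff using subideal_zero[OF subideal_wpower[OF subideal_C]] by force

lemma filt_wpower: "subideal J \<Longrightarrow> x \<in> wpower C fs m \<Longrightarrow> x \<in> filt J fs m"
  unfolding filt_iff using subideal_zero by force

text \<open>
  The first element of a regular sequence shifts the filtration strictly. The error term that avoids
  \<open>f\<close> lies in \<open>J + f C\<close>, so that \<open>wpower_Int\<close>, applied to the remaining elements, turns it into a
  multiple of \<open>f\<close> in the same step of the filtration.
\<close>

lemma filt_cancel_head:
  assumes J: "subideal J" and f: "f \<in> C" and fs: "fst ` set fs \<subseteq> C" and w: "w \<ge> 1"
    and reg: "weakly_regular J (f # map fst fs)"
    and y: "y \<in> C" "f * y \<in> filt J ((f, w) # fs) (m + w)"
  shows "y \<in> filt J ((f, w) # fs) m"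
proof -
  have ffs: "fst ` set ((f, w) # fs) \<subseteq> C"
    using f fs by simp
  obtain w' where w': "w = Suc w'"
    using w by (cases w) auto
  obtain z u j where z: "f * y = (f * z + u) + j" "z \<in> wpower C ((f, w) # fs) m"
    "u \<in> wpower C fs (m + w)" "j \<in> J"
    using y(2) unfolding filt_def by (auto simp: w')
  have zC: "z \<in> C"
    using wpower_sub[OF subideal_C ffs z(2)] .
  have "u = - j + f * (y - z)"
    using z(1) by (simp add: algebra_simps)
  then have "u \<in> adjoin J f"
    unfolding adjoin_iff using subideal_uminus[OF J z(4)] minus_closed[OF y(1) zC] by blast
  then have "u \<in> wpower (adjoin J f) fs (m + w)"
    using wpower_Int[OF fs subideal_adjoin[OF J f] _ z(3)] reg by simp
  then obtain u1 u2 where u: "u1 \<in> wpower J fs (m + w)" "u2 \<in> wpower C fs (m + w)" "u = u1 + f * u2"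
    using wpower_adjoin[OF J f fs] by blast
  have u2: "u2 \<in> wpower C ((f, w) # fs) m"
    using subsetD[OF wpower_antimono[OF subideal_C ffs] subsetD[OF wpower_tail[OF subideal_C ffs] u(2)]]
    by simp
  have zu2: "z + u2 \<in> wpower C ((f, w) # fs) m"
    using subideal_add[OF subideal_wpower[OF subideal_C ffs] z(2) u2] .
  have "f * (y - (z + u2)) = u1 + j"
    using z(1) u(3) by (simp add: algebra_simps)
  moreover have "u1 + j \<in> J"
    using subideal_add[OF J wpower_sub[OF J fs u(1)] z(4)] .
  moreover have "y - (z + u2) \<in> C"
    using minus_closed[OF y(1) wpower_sub[OF subideal_C ffs zu2]] .
  ultimately have "y - (z + u2) \<in> J"
    using reg by simp
  moreover have "y = (z + u2) + (y - (z + u2))"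
    by simp
  ultimately show ?thesis
    unfolding filt_iff using zu2 by blast
qed

text \<open>
  \<open>F\<close> raises the weight by \<open>\<nu>\<close> and not more, on every \<open>C/J\<close> on which the sequence is regular. The
  quantification over all \<open>J\<close> is what allows induction on the length of the sequence, since the tail
  of a sequence is regular only modulo its head.
\<close>

definition exact_weight :: "('a \<times> nat) list \<Rightarrow> nat \<Rightarrow> 'a \<Rightarrow> bool" where
  "exact_weight fs \<nu> F \<longleftrightarrow> F \<in> C \<and> (\<forall>k. \<forall>x\<in>wpower C fs k. F * x \<in> wpower C fs (k + \<nu>)) \<and>
    (\<forall>J y k. subideal J \<longrightarrow> weakly_regular J (map fst fs) \<longrightarrow> y \<in> C \<longrightarrow>
      F * y \<in> filt J fs (k + \<nu>) \<longrightarrow> y \<in> filt J fs k)"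

lemma exact_weight_Nil: "exact_weight [] 0 1"
  unfolding exact_weight_def using one_closed by simp

lemma exact_weight_mult_head:
  assumes F: "exact_weight ((f, w) # fs) \<nu> F" and f: "f \<in> C" and fs: "fst ` set fs \<subseteq> C" and w: "w \<ge> 1"
  shows "exact_weight ((f, w) # fs) (\<nu> + w) (f * F)"
  unfolding exact_weight_def
proof (intro conjI allI impI ballI)
  have FC: "F \<in> C"
    using F unfolding exact_weight_def by blast
  then show "f * F \<in> C"
    using f by (simp add: mult_closed)
  fix k
  show "f * F * x \<in> wpower C ((f, w) # fs) (k + (\<nu> + w))" if "x \<in> wpower C ((f, w) # fs) k" for x
  proof -
    have "f * (F * x) \<in> wpower C ((f, w) # fs) (k + \<nu> + w)"
      by (rule wpower_head[OF subideal_C fs w]) (use F that in \<open>unfold exact_weight_def, blast\<close>)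
    then show ?thesis
      by (simp add: mult.assoc add.assoc)
  qed
  fix J y
  assume J: "subideal J" and reg: "weakly_regular J (map fst ((f, w) # fs))" and y: "y \<in> C"
    and "f * F * y \<in> filt J ((f, w) # fs) (k + (\<nu> + w))"
  then have "f * (F * y) \<in> filt J ((f, w) # fs) (k + \<nu> + w)"
    by (simp add: ac_simps)
  then have "F * y \<in> filt J ((f, w) # fs) (k + \<nu>)"
    using filt_cancel_head[OF J f fs w _ mult_closed[OF FC y]] reg by simp
  then show "y \<in> filt J ((f, w) # fs) k"
    using F J reg y unfolding exact_weight_def by blast
qed

text \<open>
  An element that has exact weight \<open>\<nu>\<close> for the tail keeps it when \<open>f\<close> is put in front. If \<open>F y\<close> has
  weight \<open>k + \<nu>\<close>, the hypothesis modulo \<open>J + f C\<close> gives \<open>y = y' + f v\<close> up to \<open>J\<close> with \<open>y'\<close> of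
  weight \<open>k\<close>. Then \<open>f F v\<close> has weight \<open>k + \<nu>\<close>, and cancelling \<open>f\<close> reduces the claim to \<open>v\<close> and a
  smaller weight.
\<close>

lemma exact_weight_tail:
  assumes F: "exact_weight fs \<nu> F" and f: "f \<in> C" and fs: "fst ` set fs \<subseteq> C" and w: "w \<ge> 1"
  shows "exact_weight ((f, w) # fs) \<nu> F"
proof -
  let ?ffs = "(f, w) # fs"
  have ffs: "fst ` set ?ffs \<subseteq> C"
    using f fs by simp
  have FC: "F \<in> C" and Fp: "\<And>k x. x \<in> wpower C fs k \<Longrightarrow> F * x \<in> wpower C fs (k + \<nu>)"
    and Ff: "\<And>J y k. subideal J \<Longrightarrow> weakly_regular J (map fst fs) \<Longrightarrow> y \<in> C \<Longrightarrow>
      F * y \<in> filt J fs (k + \<nu>) \<Longrightarrow> y \<in> filt J fs k"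
    using F unfolding exact_weight_def by blast+
  note tail = subsetD[OF wpower_tail[OF subideal_C ffs]]
  have P: "F * x \<in> wpower C ?ffs (k + \<nu>)" if "x \<in> wpower C ?ffs k" for k x
    using that
  proof (induction k arbitrary: x rule: less_induct)
    case (less k)
    show ?case
    proof (cases k)
      case 0
      then have "x \<in> wpower C fs 0"
        using less.prems by simp
      from Fp[OF this] show ?thesis
        using tail 0 by blast
    next
      case (Suc k')
      obtain p q where pq: "x = f * p + q" "p \<in> wpower C ?ffs (k' - (w - 1))" "q \<in> wpower C fs (Suc k')"
        using less.prems by (auto simp: Suc)
      have "F * p \<in> wpower C ?ffs (k' - (w - 1) + \<nu>)"
        using less.IH[OF _ pq(2)] Suc by simp
      then have "F * p \<in> wpower C ?ffs (k' + \<nu> - (w - 1))"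
        by (rule subsetD[OF wpower_antimono[OF subideal_C ffs], rotated]) arith
      moreover have "F * q \<in> wpower C fs (Suc (k' + \<nu>))"
        using Fp[OF pq(3)] by simp
      moreover have "F * x = f * (F * p) + F * q"
        unfolding pq(1) by (simp add: algebra_simps)
      ultimately show ?thesis
        by (auto simp: Suc)
    qed
  qed
  have "y \<in> filt J ?ffs k" if J: "subideal J" and reg: "weakly_regular J (map fst ?ffs)"
    and "y \<in> C" "F * y \<in> filt J ?ffs (k + \<nu>)" for J y k
    using that(3,4)
  proof (induction k arbitrary: y rule: less_induct)
    case (less k)
    show ?case
    proof (cases k)
      case 0
      then show ?thesis
        using filt_0[OF J less.prems(1)] by simp
    next
      case (Suc k')
      obtain x1 x2 j where x: "F * y = (f * x1 + x2) + j" "x1 \<in> wpower C ?ffs (k' + \<nu> - (w - 1))"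
        "x2 \<in> wpower C fs (k + \<nu>)" "j \<in> J"
        using less.prems(2) unfolding filt_def by (auto simp: Suc)
      have "F * y = x2 + (j + f * x1)"
        unfolding x(1) by (simp add: algebra_simps)
      moreover have "j + f * x1 \<in> adjoin J f"
        unfolding adjoin_iff using x(4) wpower_sub[OF subideal_C ffs x(2)] by blast
      ultimately have "F * y \<in> filt (adjoin J f) fs (k + \<nu>)"
        unfolding filt_iff using x(3) by blast
      then have "y \<in> filt (adjoin J f) fs k"
        using Ff[OF subideal_adjoin[OF J f] _ less.prems(1)] reg by simp
      then obtain y' j' v where y: "y = y' + (j' + f * v)" "y' \<in> wpower C fs k" "j' \<in> J" "v \<in> C"
        unfolding filt_def adjoin_def by blast
      have y'f: "y' \<in> filt J ?ffs k"
        by (rule filt_wpower[OF J tail[OF y(2)]])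
      have "F * y' \<in> filt J ?ffs (k + \<nu>)"
        by (rule filt_wpower[OF J P[OF tail[OF y(2)]]])
      moreover have "F * j' \<in> filt J ?ffs (k + \<nu>)"
        by (rule filt_J[OF J ffs subideal_mult[OF J FC y(3)]])
      moreover have "f * (F * v) = F * y - F * y' - F * j'"
        unfolding y(1) by (simp add: algebra_simps)
      ultimately have fFv: "f * (F * v) \<in> filt J ?ffs (k + \<nu>)"
        using less.prems(2) subideal_minus[OF subideal_filt[OF J ffs]] by metis
      have "v \<in> filt J ?ffs (k' - (w - 1))"
      proof (cases "k' - (w - 1) = 0")
        case True
        then show ?thesis
          using filt_0[OF J y(4)] by simp
      next
        case False
        then have k: "k + \<nu> = (k' - (w - 1) + \<nu>) + w"
          using w Suc by linarith
        have "F * v \<in> filt J ?ffs (k' - (w - 1) + \<nu>)"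
          using filt_cancel_head[OF J f fs w _ mult_closed[OF FC y(4)]] reg fFv
          unfolding k by simp
        then show ?thesis
          using less.IH[OF _ y(4)] Suc by simp
      qed
      then obtain a b where ab: "v = a + b" "a \<in> wpower C ?ffs (k' - (w - 1))" "b \<in> J"
        unfolding filt_def by blast
      have "0 \<in> wpower C fs (Suc k')"
        using subideal_zero[OF subideal_wpower[OF subideal_C fs]] .
      moreover have "f * a = f * a + 0" by simp
      ultimately have "f * a \<in> wpower C ?ffs k"
        using ab(2) unfolding Suc wpower.simps fst_conv snd_conv by blast
      moreover have "f * v = f * a + f * b"
        by (simp add: ab(1) algebra_simps)
      ultimately have "f * v \<in> filt J ?ffs k"
        unfolding filt_iff using subideal_mult[OF J f ab(3)] by blast
      then show ?thesis
        using subideal_add[OF subideal_filt[OF J ffs] y'f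
            subideal_add[OF subideal_filt[OF J ffs] filt_J[OF J ffs y(3)]]]
        unfolding y(1) by blast
    qed
  qed
  then show ?thesis
    unfolding exact_weight_def using FC P by blast
qed

lemma exact_weight_digit_monomial:
  assumes "N \<ge> 1"
  shows "W \<ge> 1 \<Longrightarrow> set fs \<subseteq> C \<Longrightarrow> j < N ^ length fs \<Longrightarrow>
    exact_weight (digit_weights N W fs) (W * j) (digit_monomial N fs j)"
proof (induction fs arbitrary: W j)
  case Nil
  then show ?case by (simp add: exact_weight_Nil)
next
  case (Cons f fs)
  let ?ws = "digit_weights N (W * N) fs"
  have f: "f \<in> C" and fs: "fst ` set ?ws \<subseteq> C"
    using Cons.prems(2) map_fst_digit_weights[of N "W * N" fs] by (auto simp flip: set_map)
  have "j div N < N ^ length fs"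
    using Cons.prems(3) assms by (simp add: div_less_iff_less_mult mult.commute)
  then have "exact_weight ?ws (W * N * (j div N)) (digit_monomial N fs (j div N))"
    using Cons assms by (intro Cons.IH) auto
  then have base: "exact_weight ((f, W) # ?ws) (W * N * (j div N)) (digit_monomial N fs (j div N))"
    by (rule exact_weight_tail) (use f fs Cons.prems in auto)
  have "exact_weight ((f, W) # ?ws) (W * N * (j div N) + W * i) (f ^ i * digit_monomial N fs (j div N))" for i
  proof (induction i)
    case 0
    then show ?case using base by simp
  next
    case (Suc i)
    then show ?case
      using exact_weight_mult_head[OF Suc f fs Cons.prems(1)] by (simp add: ac_simps)
  qed
  moreover have "W * N * (j div N) + W * (j mod N) = W * j"
    by (metis add_mult_distrib2 mult.assoc mult_div_mod_eq)
  ultimately show ?case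
    by (metis digit_weights.simps(2) digit_monomial.simps(2))
qed

text \<open>
  If \<open>y\<close> lies in step \<open>k - 1\<close> of the filtration but not in step \<open>k\<close>, then in a linear relation between
  the multiples of \<open>y\<close> the term with the smallest \<open>j\<close> would have to lie one step deeper than its
  weight permits. Such a \<open>k\<close> exists because \<open>y\<close> leaves the filtration at some step.
\<close>

theorem digit_monomials_independent:
  assumes J: "subideal J" and fs: "set fs \<subseteq> C" and reg: "weakly_regular J fs" and N: "N \<ge> 1"
    and y: "y \<in> C" "y \<notin> filt J (digit_weights N 1 fs) m"
    and units: "\<And>j. j < N ^ length fs \<Longrightarrow> c j \<in> C" "\<And>j. j < N ^ length fs \<Longrightarrow> c j \<noteq> 0 \<Longrightarrow> \<exists>d\<in>C. d * c j = 1"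
    and dep: "(\<Sum>j<N ^ length fs. c j * (digit_monomial N fs j * y)) \<in> J"
    and j: "j < N ^ length fs"
  shows "c j = 0"
proof (rule ccontr)
  assume cj: "c j \<noteq> 0"
  let ?R = "N ^ length fs" and ?ws = "digit_weights N 1 fs"
  \<comment> \<open>the term of lowest weight\<close>
  define j0 where "j0 = (LEAST j. j < ?R \<and> c j \<noteq> 0)"
  have j0: "j0 < ?R" "c j0 \<noteq> 0"
    using LeastI[of "\<lambda>j. j < ?R \<and> c j \<noteq> 0" j] j cj unfolding j0_def by blast+
  have below: "c i = 0" if "i < j0" for i
    using not_less_Least[of i "\<lambda>j. j < ?R \<and> c j \<noteq> 0"] that j0(1) unfolding j0_def by force
  define k where "k = (LEAST m. y \<notin> filt J ?ws m)"
  have yk: "y \<notin> filt J ?ws k"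
    unfolding k_def by (rule LeastI) (fact y(2))
  then obtain k' where k': "k = Suc k'"
    using filt_0[OF J y(1)] by (cases k) auto
  have "y \<in> filt J ?ws k'"
    using not_less_Least[of k' "\<lambda>m. y \<notin> filt J ?ws m"] k' unfolding k_def by auto
  then obtain x i where x: "y = x + i" "x \<in> wpower C ?ws k'" "i \<in> J"
    unfolding filt_iff by blast
  have ws: "fst ` set ?ws \<subseteq> C"
    using fs map_fst_digit_weights[of N 1 fs] by (auto simp flip: set_map)
  let ?F = "filt J ?ws (k + j0)"
  note F = subideal_filt[OF J ws, of "k + j0"]
  have ew: "exact_weight ?ws i (digit_monomial N fs i)" if "i < ?R" for i
    using exact_weight_digit_monomial[OF N, of 1 fs i] fs that by simp
  have "c i * (digit_monomial N fs i * y) \<in> ?F" if "i < ?R" "i \<noteq> j0" for i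
  proof (cases "i < j0")
    case True
    then show ?thesis
      using below subideal_zero[OF F] by simp
  next
    case False
    let ?D = "digit_monomial N fs i"
    have D: "?D \<in> C" "?D * x \<in> wpower C ?ws (k' + i)"
      using ew[OF that(1)] x(2) unfolding exact_weight_def by blast+
    have "?D * x \<in> filt J ?ws (k' + i)"
      by (rule filt_wpower[OF J D(2)])
    moreover have "k + j0 \<le> k' + i"
      using False that(2) k' by simp
    ultimately have "?D * x \<in> ?F"
      using filt_antimono[OF ws] by blast
    moreover have "?D * i' \<in> ?F" if "i' \<in> J" for i'
      by (rule filt_J[OF J ws subideal_mult[OF J D(1) that]])
    ultimately have "?D * y \<in> ?F"
      unfolding x(1) distrib_left using x(3) by (blast intro: subideal_add[OF F])
    then show ?thesis
      using subideal_mult[OF F units(1)[OF that(1)]] by blast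
  qed
  then have rest: "(\<Sum>i\<in>{..<?R} - {j0}. c i * (digit_monomial N fs i * y)) \<in> ?F"
    by (intro subideal_sum[OF F]) auto
  have "(\<Sum>i<?R. c i * (digit_monomial N fs i * y)) = c j0 * (digit_monomial N fs j0 * y) +
    (\<Sum>i\<in>{..<?R} - {j0}. c i * (digit_monomial N fs i * y))"
    using j0(1) by (intro sum.remove) auto
  then have "c j0 * (digit_monomial N fs j0 * y) = (\<Sum>i<?R. c i * (digit_monomial N fs i * y)) -
    (\<Sum>i\<in>{..<?R} - {j0}. c i * (digit_monomial N fs i * y))"
    by simp
  then have "c j0 * (digit_monomial N fs j0 * y) \<in> ?F"
    using subideal_minus[OF F filt_J[OF J ws dep] rest] by simp
  moreover obtain d where d: "d \<in> C" "d * c j0 = 1"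
    using units(2)[OF j0] by blast
  ultimately have "d * (c j0 * (digit_monomial N fs j0 * y)) \<in> ?F"
    using subideal_mult[OF F] by blast
  then have "digit_monomial N fs j0 * y \<in> ?F"
    using d(2) by (simp flip: mult.assoc)
  then have "y \<in> filt J ?ws k"
    using ew[OF j0(1)] J reg y(1) unfolding exact_weight_def map_fst_digit_weights by blast
  then show False
    using yk by blast
qed

end

section \<open>Monomial ideals\<close>

abbreviation coef :: "'k::field mpoly \<Rightarrow> expo \<Rightarrow> 'k" where
  "coef \<equiv> Poly_Mapping.lookup"

abbreviation mons :: "'k::field mpoly \<Rightarrow> expo set" where
  "mons \<equiv> Poly_Mapping.keys"

abbreviation pmon :: "expo \<Rightarrow> 'k::field \<Rightarrow> 'k mpoly" where
  "pmon \<equiv> Poly_Mapping.single"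

definition polys :: "nat set \<Rightarrow> 'k::field mpoly set" where
  "polys V = {p. \<forall>m\<in>mons p. supp m \<subseteq> V}"

definition mon_ideal :: "nat set \<Rightarrow> expo set \<Rightarrow> 'k::field mpoly set" where
  "mon_ideal V U = {p \<in> polys V. mons p \<subseteq> U}"

definition upset :: "expo set \<Rightarrow> bool" where
  "upset U \<longleftrightarrow> (\<forall>m v. m \<in> U \<longrightarrow> m + v \<in> U)"

lemma upset_power_mons: "upset (power_mons E t)"
  unfolding upset_def using power_mons_upset by blast

lemma poly_as_sum: "p = (\<Sum>m\<in>mons p. pmon m (coef p m))"
proof (rule poly_mapping_eqI)
  fix m
  have "coef (\<Sum>m\<in>mons p. pmon m (coef p m)) m = (\<Sum>m'\<in>mons p. if m' = m then coef p m' else 0)"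
    unfolding lookup_sum by (rule sum.cong) (simp_all add: lookup_single when_def)
  also have "\<dots> = coef p m"
    by (simp add: in_keys_iff)
  finally show "coef p m = coef (\<Sum>m\<in>mons p. pmon m (coef p m)) m"
    by simp
qed

lemma mons_mult: "m \<in> mons (p * q) \<Longrightarrow> \<exists>a\<in>mons p. \<exists>b\<in>mons q. m = a + b"
  using keys_mult[of p q] by blast

lemma coef_single_mult: "coef (pmon u c * p) (u + m) = c * coef p m"
proof -
  have "pmon u c * p = (\<Sum>m'\<in>mons p. pmon (u + m') (c * coef p m'))"
    by (subst poly_as_sum[of p]) (simp add: sum_distrib_left mult_single)
  then have "coef (pmon u c * p) (u + m) = (\<Sum>m'\<in>mons p. if m' = m then c * coef p m' else 0)"
    unfolding lookup_sum by (simp add: lookup_sum lookup_single when_def)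
  then show ?thesis
    by (simp add: in_keys_iff)
qed

lemma comm_subring_polys: "comm_subring (polys V :: 'k::field mpoly set)"
proof
  show "x * y \<in> polys V" if "x \<in> polys V" "y \<in> polys V" for x y :: "'k mpoly"
    using that unfolding polys_def by (auto dest!: mons_mult simp: supp_plus) blast+
  show "x + y \<in> polys V" if "x \<in> polys V" "y \<in> polys V" for x y :: "'k mpoly"
    using that Poly_Mapping.keys_add[of x y] unfolding polys_def by blast
qed (auto simp: polys_def)

interpretation polys: comm_subring "polys V :: 'k::field mpoly set" for V
  by (rule comm_subring_polys)

lemma ring_sel:
  "carrier (mpoly_ring V) = polys V" "monoid.mult (mpoly_ring V) = (*)" "one (mpoly_ring V) = 1"
  "zero (mpoly_ring V) = 0" "add (mpoly_ring V) = (+)"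
  by (simp_all add: mpoly_ring_def polys_def)

lemma pmon_in_polys: "supp m \<subseteq> V \<Longrightarrow> pmon m c \<in> polys V"
  by (simp add: polys_def)

lemma subideal_mon_ideal:
  assumes "upset U"
  shows "polys.subideal V (mon_ideal V U)"
  unfolding polys.subideal_def
proof (intro conjI ballI)
  show "x + y \<in> mon_ideal V U" if "x \<in> mon_ideal V U" "y \<in> mon_ideal V U" for x y
    using that Poly_Mapping.keys_add[of x y] polys.add_closed[of x V y] unfolding mon_ideal_def by blast
  show "a * x \<in> mon_ideal V U" if "a \<in> polys V" "x \<in> mon_ideal V U" for a x
  proof -
    have "m \<in> U" if m: "m \<in> mons (a * x)" for m
    proof -
      obtain u v where "m = u + v" "v \<in> mons x"
        using mons_mult[OF m] by blast
      then show ?thesis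
        using \<open>x \<in> mon_ideal V U\<close> assms unfolding mon_ideal_def upset_def by (auto simp: add.commute)
    qed
    then show ?thesis
      using that polys.mult_closed[of a V x] unfolding mon_ideal_def by blast
  qed
qed (auto simp: mon_ideal_def polys.zero_closed)

text \<open>
  The bridge between the polynomial ring as a record with a carrier and the type-class operations.
\<close>

lemma ideal_iff_subideal: "ideal N (mpoly_ring V) \<longleftrightarrow> polys.subideal V N"
proof
  assume "ideal N (mpoly_ring V)"
  then interpret ideal N "mpoly_ring V" .
  show "polys.subideal V N"
    unfolding polys.subideal_def
  proof (intro conjI ballI)
    show "N \<subseteq> polys V" "0 \<in> N"
      using a_subset additive_subgroup.zero_closed[OF additive_subgroup_axioms] unfolding ring_sel .
    show "x + y \<in> N" if "x \<in> N" "y \<in> N" for x y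
      using additive_subgroup.a_closed[OF additive_subgroup_axioms that] unfolding ring_sel .
    show "a * x \<in> N" if "a \<in> polys V" "x \<in> N" for a x
      using I_l_closed[of x a] that unfolding ring_sel by blast
  qed
next
  assume N: "polys.subideal V N"
  interpret R: cring "mpoly_ring V"
    by (rule mpoly_ring_cring)
  have neg: "\<ominus>\<^bsub>mpoly_ring V\<^esub> x = - x" if "x \<in> polys V" for x
    using R.minus_equality[of "- x" x] that polys.uminus_closed[OF that] by (simp add: ring_sel)
  show "ideal N (mpoly_ring V)"
  proof (rule idealI)
    show "subgroup N (add_monoid (mpoly_ring V))"
    proof
      show "inv\<^bsub>add_monoid (mpoly_ring V)\<^esub> x \<in> N" if "x \<in> N" for x
        using neg[OF polys.subideal_sub[OF N that]] polys.subideal_uminus[OF N that]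
        by (simp add: a_inv_def)
    qed (use polys.subideal_sub[OF N] polys.subideal_zero[OF N] polys.subideal_add[OF N]
        in \<open>auto simp: ring_sel\<close>)
    show "a \<otimes>\<^bsub>mpoly_ring V\<^esub> x \<in> N" "x \<otimes>\<^bsub>mpoly_ring V\<^esub> a \<in> N" if "x \<in> N" "a \<in> carrier (mpoly_ring V)" for a x
      using polys.subideal_mult[OF N _ that(1)] that(2) by (simp_all add: ring_sel mult.commute)
  qed (rule R.ring_axioms)
qed

text \<open>
  Each monomial of a polynomial on the right is a monomial multiple of a generator.
\<close>

lemma genideal_monomials:
  fixes V :: "nat set"
  assumes "\<And>u. u \<in> E \<Longrightarrow> supp u \<subseteq> V"
  shows "Idl\<^bsub>mpoly_ring V\<^esub> ((\<lambda>u. pmon u 1) ` E) = (mon_ideal V (power_mons E 1) :: 'k::field mpoly set)"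
proof -
  interpret R: cring "mpoly_ring V :: 'k mpoly ring"
    by (rule mpoly_ring_cring)
  let ?G = "(\<lambda>u. pmon u (1::'k)) ` E"
  let ?I = "Idl\<^bsub>mpoly_ring V\<^esub> ?G"
  have pw: "power_mons E 1 = {u + m | u m. u \<in> E}"
    using power_mons_Suc[of E 0] by simp
  have G: "?G \<subseteq> carrier (mpoly_ring V)"
    using assms by (auto simp: ring_sel intro: pmon_in_polys)
  have I: "polys.subideal V ?I"
    using R.genideal_ideal[OF G] unfolding ideal_iff_subideal .
  show ?thesis
  proof (intro equalityI)
    have "u = u + 0" for u :: expo by simp
    then have "?G \<subseteq> mon_ideal V (power_mons E 1)"
      using assms unfolding mon_ideal_def pw by (fastforce intro: pmon_in_polys)
    moreover have "ideal (mon_ideal V (power_mons E 1)) (mpoly_ring V :: 'k mpoly ring)"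
      unfolding ideal_iff_subideal by (rule subideal_mon_ideal[OF upset_power_mons])
    ultimately show "?I \<subseteq> mon_ideal V (power_mons E 1)"
      by (intro R.genideal_minimal)
    show "mon_ideal V (power_mons E 1) \<subseteq> ?I"
    proof
      fix p :: "'k mpoly" assume p: "p \<in> mon_ideal V (power_mons E 1)"
      have "pmon m (coef p m) \<in> ?I" if mp: "m \<in> mons p" for m
      proof -
        obtain u v where uv: "m = u + v" "u \<in> E"
          using p mp unfolding mon_ideal_def pw by blast
        have "supp m \<subseteq> V"
          using p mp unfolding mon_ideal_def polys_def by blast
        then have "supp v \<subseteq> V"
          by (simp add: uv(1) supp_plus)
        moreover have "pmon u 1 \<in> ?I"
          using R.genideal_self[OF G] uv(2) by blast
        ultimately have "pmon v (coef p m) * pmon u 1 \<in> ?I"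
          by (intro polys.subideal_mult[OF I] pmon_in_polys)
        then show ?thesis
          by (simp add: mult_single uv(1) add.commute)
      qed
      then show "p \<in> ?I"
        by (subst poly_as_sum) (rule polys.subideal_sum[OF I])
    qed
  qed
qed

lemma mon_ideal_UNIV: "mon_ideal V UNIV = polys V"
  by (simp add: mon_ideal_def)

lemma power_of_monomial_ideal:
  fixes V :: "nat set"
  assumes E: "\<And>u. u \<in> E \<Longrightarrow> supp u \<subseteq> V"
  shows "(mon_ideal V (power_mons E 1) :: 'k::field mpoly set) [^]\<^bsub>ideals_set (mpoly_ring V)\<^esub> (t::nat)
    = mon_ideal V (power_mons E t)"
proof (induction t)
  case 0
  show ?case
    by (simp add: nat_pow_def ideals_set_def ring_sel mon_ideal_UNIV)
next
  case (Suc t)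
  let ?R = "mpoly_ring V :: 'k mpoly ring"
  let ?I = "mon_ideal V (power_mons E t) :: 'k mpoly set" and ?J = "mon_ideal V (power_mons E 1) :: 'k mpoly set"
  have pw: "power_mons E 1 = {u + m | u m. u \<in> E}"
    using power_mons_Suc[of E 0] by simp
  have "ideal_prod ?R ?I ?J = mon_ideal V (power_mons E (Suc t))"
  proof (intro equalityI subsetI)
    fix p assume "p \<in> ideal_prod ?R ?I ?J"
    then show "p \<in> mon_ideal V (power_mons E (Suc t))"
    proof induction
      case (prod i j)
      have "m \<in> power_mons E (Suc t)" if "m \<in> mons (i * j)" for m
      proof -
        obtain x y where xy: "m = x + y" "x \<in> mons i" "y \<in> mons j"
          using mons_mult \<open>m \<in> mons (i * j)\<close> by blast
        then obtain u v where "y = u + v" "u \<in> E"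
          using prod unfolding mon_ideal_def pw by blast
        moreover have "x + v \<in> power_mons E t"
          using xy(2) prod power_mons_upset unfolding mon_ideal_def by blast
        ultimately show ?thesis
          unfolding power_mons_Suc xy(1) by (auto simp: ac_simps)
      qed
      moreover have "i * j \<in> polys V"
        using prod polys.mult_closed unfolding mon_ideal_def by blast
      ultimately show ?case
        unfolding mon_ideal_def by (auto simp: ring_sel)
    next
      case (sum p q)
      then show ?case
        using polys.subideal_add[OF subideal_mon_ideal[OF upset_power_mons]] by (simp add: ring_sel)
    qed
  next
    fix p :: "'k mpoly" assume p: "p \<in> mon_ideal V (power_mons E (Suc t))"
    have zero: "0 \<in> ideal_prod ?R ?I ?J"
      using ideal_prod.prod[of 0 ?I 0 ?J ?R] by (simp add: mon_ideal_def ring_sel polys.zero_closed)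
    have sum: "(\<Sum>m\<in>A. g m) \<in> ideal_prod ?R ?I ?J" if "\<And>m. m \<in> A \<Longrightarrow> g m \<in> ideal_prod ?R ?I ?J" for A and g :: "expo \<Rightarrow> 'k mpoly"
      using that
    proof (induction A rule: infinite_finite_induct)
      case (insert x F)
      then show ?case
        using ideal_prod.sum[of "g x" ?R ?I ?J "sum g F"] by (simp add: ring_sel)
    qed (use zero in simp_all)
    have "pmon m (coef p m) \<in> ideal_prod ?R ?I ?J" if mp: "m \<in> mons p" for m
    proof -
      obtain u v where uv: "m = u + v" "u \<in> E" "v \<in> power_mons E t"
        using p mp unfolding mon_ideal_def power_mons_Suc by blast
      have "supp m \<subseteq> V"
        using p mp unfolding mon_ideal_def polys_def by blast
      then have "supp v \<subseteq> V"
        by (simp add: uv(1) supp_plus)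
      then have "pmon v (coef p m) \<in> ?I"
        using uv(3) by (simp add: mon_ideal_def pmon_in_polys)
      moreover have "pmon u 1 \<in> ?J"
        using E[OF uv(2)] uv(2) unfolding mon_ideal_def pw by (force intro: pmon_in_polys exI[of _ 0])
      ultimately have "pmon v (coef p m) * pmon u 1 \<in> ideal_prod ?R ?I ?J"
        using ideal_prod.prod[of "pmon v (coef p m)" ?I "pmon u 1" ?J ?R] by (simp add: ring_sel)
      then show ?thesis
        by (simp add: mult_single uv(1) add.commute)
    qed
    then show "p \<in> ideal_prod ?R ?I ?J"
      by (subst poly_as_sum) (rule sum)
  qed
  then show ?case
    using Suc by (simp add: nat_pow_def ideals_set_def)
qed

section \<open>The quotient module\<close>

context
  fixes V :: "nat set" and J :: "'k::field mpoly set"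
  assumes J: "polys.subideal V J"
begin

abbreviation (input) "quot \<equiv> quotient_module (mpoly_ring V) J"
abbreviation (input) "coset p \<equiv> J +>\<^bsub>mpoly_ring V\<^esub> p"

lemma coset_def': "coset p = {j + p | j. j \<in> J}"
  by (auto simp: a_r_coset_def' ring_sel)

lemma coset_eq_iff:
  assumes "p \<in> polys V" "q \<in> polys V"
  shows "coset p = coset q \<longleftrightarrow> p - q \<in> J"
proof
  assume "coset p = coset q"
  moreover have "p \<in> coset p"
    unfolding coset_def' using polys.subideal_zero[OF J] by force
  ultimately obtain j where "p = j + q" "j \<in> J"
    unfolding coset_def' by blast
  then show "p - q \<in> J" by simp
next
  assume pq: "p - q \<in> J"
  have "j + p = (j + (p - q)) + q" "j + q = (j - (p - q)) + p" for j
    by simp_all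
  then show "coset p = coset q"
    unfolding coset_def' using polys.subideal_add[OF J _ pq] polys.subideal_minus[OF J _ pq] by blast
qed

lemma quot_module: "module (mpoly_ring V) quot"
  using quotient_module_is_module[OF mpoly_ring_cring] J unfolding ideal_iff_subideal by blast

lemma carrier_quot: "carrier quot = coset ` polys V"
  by (auto simp: quotient_module_def FactRing_def A_RCOSETS_def' ring_sel)

lemma zero_quot: "\<zero>\<^bsub>quot\<^esub> = coset 0"
  using polys.subideal_zero[OF J] by (auto simp: quotient_module_def FactRing_def coset_def')

lemma coset_in_quot: "p \<in> polys V \<Longrightarrow> coset p \<in> carrier quot"
  unfolding carrier_quot by blast

lemma
  assumes "p \<in> polys V" "q \<in> polys V"
  shows add_quot: "coset p \<oplus>\<^bsub>quot\<^esub> coset q = coset (p + q)"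
    and smult_quot: "p \<odot>\<^bsub>quot\<^esub> coset q = coset (p * q)"
proof -
  interpret ideal J "mpoly_ring V"
    using J unfolding ideal_iff_subideal .
  show "coset p \<oplus>\<^bsub>quot\<^esub> coset q = coset (p + q)"
    using a_rcos_sum[of p q] assms by (simp add: quotient_module_def FactRing_def ring_sel)
  show "p \<odot>\<^bsub>quot\<^esub> coset q = coset (p * q)"
    using rcoset_mult_add[of p q] assms by (simp add: quotient_module_def FactRing_def ring_sel)
qed

lemma finsum_quot:
  assumes "\<And>i. i \<in> A \<Longrightarrow> g i \<in> polys V"
  shows "(\<Oplus>\<^bsub>quot\<^esub> i\<in>A. coset (g i)) = coset (\<Sum>i\<in>A. g i)"
  using assms
proof (induction A rule: infinite_finite_induct)
  case (infinite A)
  interpret module "mpoly_ring V" quot by (rule quot_module)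
  show ?case
    using infinite by (simp add: finsum_def finprod_def zero_quot)
next
  case empty
  interpret module "mpoly_ring V" quot by (rule quot_module)
  show ?case
    by (simp add: zero_quot)
next
  case (insert x F)
  interpret module "mpoly_ring V" quot by (rule quot_module)
  have "(\<Oplus>\<^bsub>quot\<^esub> i\<in>insert x F. coset (g i)) = coset (g x) \<oplus>\<^bsub>quot\<^esub> (\<Oplus>\<^bsub>quot\<^esub> i\<in>F. coset (g i))"
    using insert by (intro finsum_insert) (auto intro: coset_in_quot)
  then show ?case
    using insert by (simp add: add_quot polys.sum_closed)
qed

end

section \<open>Regular sequences on the quotient module\<close>

lemma (in comm_subring) mem_foldl_adjoin:
  "u \<in> foldl adjoin N fs \<longleftrightarrow>
    (\<exists>x\<in>N. \<exists>y. (\<forall>i<length fs. y i \<in> C) \<and> u = x + (\<Sum>i<length fs. fs ! i * y i))"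
proof (induction fs arbitrary: u rule: rev_induct)
  case (snoc f fs)
  show ?case
  proof
    assume "u \<in> foldl adjoin N (fs @ [f])"
    then obtain v z where v: "v \<in> foldl adjoin N fs" "z \<in> C" "u = v + f * z"
      by (auto simp: adjoin_iff)
    then obtain x y where x: "x \<in> N" "\<forall>i<length fs. y i \<in> C" "v = x + (\<Sum>i<length fs. fs ! i * y i)"
      using snoc by blast
    let ?y = "y(length fs := z)"
    have "u = x + (\<Sum>i<length (fs @ [f]). (fs @ [f]) ! i * ?y i)"
      by (simp add: v(3) x(3) nth_append add.assoc)
    moreover have "\<forall>i<length (fs @ [f]). ?y i \<in> C"
      using x(2) v(2) by (simp add: less_Suc_eq)
    ultimately show "\<exists>x\<in>N. \<exists>y. (\<forall>i<length (fs @ [f]). y i \<in> C) \<and>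
        u = x + (\<Sum>i<length (fs @ [f]). (fs @ [f]) ! i * y i)"
      using x(1) by blast
  next
    assume "\<exists>x\<in>N. \<exists>y. (\<forall>i<length (fs @ [f]). y i \<in> C) \<and>
        u = x + (\<Sum>i<length (fs @ [f]). (fs @ [f]) ! i * y i)"
    then obtain x y where x: "x \<in> N" "\<forall>i<length (fs @ [f]). y i \<in> C"
      "u = x + (\<Sum>i<length (fs @ [f]). (fs @ [f]) ! i * y i)"
      by blast
    have "x + (\<Sum>i<length fs. fs ! i * y i) \<in> foldl adjoin N fs"
      unfolding snoc
      by (rule bexI[OF _ x(1)], rule exI[of _ y]) (use x(2) in auto)
    moreover have "u = (x + (\<Sum>i<length fs. fs ! i * y i)) + f * y (length fs)"
      by (simp add: x(3) nth_append add.assoc)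
    moreover have "y (length fs) \<in> C"
      using x(2) by simp
    ultimately show "u \<in> foldl adjoin N (fs @ [f])"
      unfolding foldl_append foldl.simps adjoin_iff by blast
  qed
qed simp

lemma (in comm_subring) subideal_foldl_adjoin:
  "subideal N \<Longrightarrow> set fs \<subseteq> C \<Longrightarrow> subideal (foldl adjoin N fs)"
  by (induction fs arbitrary: N) (auto intro: subideal_adjoin)

lemma (in comm_subring) weakly_regular_iff:
  "weakly_regular N fs \<longleftrightarrow> (\<forall>i<length fs. \<forall>x\<in>C. fs ! i * x \<in> foldl adjoin N (take i fs) \<longrightarrow>
     x \<in> foldl adjoin N (take i fs))"
proof (induction fs arbitrary: N)
  case (Cons f fs)
  show ?case
    unfolding weakly_regular.simps Cons.IH by (simp add: All_less_Suc2)
qed simp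

text \<open>
  Submodules of \<open>S/J\<close> are images of ideals that contain \<open>J\<close>; here the submodule \<open>(f\<^sub>1, \<dots>, f\<^sub>r) S/J\<close> is
  the image of \<open>J + (f\<^sub>1, \<dots>, f\<^sub>r)\<close>.
\<close>

lemma multiples_quot:
  fixes J :: "'k::field mpoly set"
  assumes J: "polys.subideal V J" and fs: "set fs \<subseteq> polys V"
  shows "multiples (quotient_module (mpoly_ring V) J) fs =
    (\<lambda>p. J +>\<^bsub>mpoly_ring V\<^esub> p) ` foldl (polys.adjoin V) J fs"
proof -
  let ?M = "quotient_module (mpoly_ring V) J"
  let ?co = "\<lambda>p. J +>\<^bsub>mpoly_ring V\<^esub> p"
  have fsi: "fs ! i \<in> polys V" if "i < length fs" for i
    using fs that by auto
  have sum: "(\<Oplus>\<^bsub>?M\<^esub> i\<in>{..<length fs}. fs ! i \<odot>\<^bsub>?M\<^esub> ?co (z i)) = ?co (\<Sum>i<length fs. fs ! i * z i)"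
    if z: "\<And>i. i < length fs \<Longrightarrow> z i \<in> polys V" for z
  proof -
    interpret module "mpoly_ring V" ?M by (rule quot_module[OF J])
    have "(\<Oplus>\<^bsub>?M\<^esub> i\<in>{..<length fs}. fs ! i \<odot>\<^bsub>?M\<^esub> ?co (z i)) = (\<Oplus>\<^bsub>?M\<^esub> i\<in>{..<length fs}. ?co (fs ! i * z i))"
      using z fsi by (intro finsum_cong') (auto simp: smult_quot[OF J] intro!: coset_in_quot[OF J] polys.mult_closed)
    also have "\<dots> = ?co (\<Sum>i<length fs. fs ! i * z i)"
      using z fsi by (intro finsum_quot[OF J]) (auto intro: polys.mult_closed)
    finally show ?thesis .
  qed
  have sumc: "(\<Sum>i<length fs. fs ! i * z i) \<in> polys V" if "\<And>i. i < length fs \<Longrightarrow> z i \<in> polys V" for z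
    using that fsi by (intro polys.sum_closed polys.mult_closed) auto
  show ?thesis
  proof (intro equalityI subsetI)
    fix A assume "A \<in> multiples ?M fs"
    then obtain y where y: "y \<in> {..<length fs} \<rightarrow> carrier ?M"
      "A = (\<Oplus>\<^bsub>?M\<^esub> i\<in>{..<length fs}. fs ! i \<odot>\<^bsub>?M\<^esub> y i)"
      unfolding multiples_def by blast
    have "\<forall>i\<in>{..<length fs}. \<exists>z. z \<in> polys V \<and> y i = ?co z"
      using y(1) unfolding carrier_quot[OF J] by blast
    then obtain z where z: "\<And>i. i < length fs \<Longrightarrow> z i \<in> polys V" "\<And>i. i < length fs \<Longrightarrow> y i = ?co (z i)"
      unfolding bchoice_iff by auto
    interpret module "mpoly_ring V" ?M by (rule quot_module[OF J])
    have "A = (\<Oplus>\<^bsub>?M\<^esub> i\<in>{..<length fs}. fs ! i \<odot>\<^bsub>?M\<^esub> ?co (z i))"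
      unfolding y(2) using z fsi
      by (intro finsum_cong') (auto simp: smult_quot[OF J] intro!: coset_in_quot[OF J] polys.mult_closed)
    also have "\<dots> = ?co (\<Sum>i<length fs. fs ! i * z i)"
      by (rule sum) (rule z(1))
    finally have "A = ?co (\<Sum>i<length fs. fs ! i * z i)" .
    moreover have "(\<Sum>i<length fs. fs ! i * z i) \<in> foldl (polys.adjoin V) J fs"
      unfolding polys.mem_foldl_adjoin
      by (rule bexI[OF _ polys.subideal_zero[OF J]], rule exI[of _ z]) (simp add: z(1))
    ultimately show "A \<in> ?co ` foldl (polys.adjoin V) J fs"
      by blast
  next
    fix A assume "A \<in> ?co ` foldl (polys.adjoin V) J fs"
    then obtain x z where "x \<in> J" "\<forall>i<length fs. z i \<in> polys V"
      "A = ?co (x + (\<Sum>i<length fs. fs ! i * z i))"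
      unfolding image_iff Bex_def polys.mem_foldl_adjoin by blast
    then have x: "x \<in> J" "\<And>i. i < length fs \<Longrightarrow> z i \<in> polys V"
      "A = ?co (x + (\<Sum>i<length fs. fs ! i * z i))"
      by blast+
    have "A = ?co (\<Sum>i<length fs. fs ! i * z i)"
      unfolding x(3) using x(1) sumc[OF x(2)] polys.subideal_sub[OF J x(1)]
      by (subst coset_eq_iff[OF J]) (auto intro: polys.add_closed)
    also have "\<dots> = (\<Oplus>\<^bsub>?M\<^esub> i\<in>{..<length fs}. fs ! i \<odot>\<^bsub>?M\<^esub> ?co (z i))"
      by (rule sum[symmetric]) (rule x(2))
    finally show "A \<in> multiples ?M fs"
      unfolding multiples_def using x(2)
      by (intro CollectI exI[of _ "\<lambda>i. ?co (z i)"]) (auto intro: coset_in_quot[OF J])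
  qed
qed

lemma subset_foldl_adjoin: "polys.subideal V N \<Longrightarrow> set fs \<subseteq> polys V \<Longrightarrow> N \<subseteq> foldl (polys.adjoin V) N fs"
  unfolding subset_iff polys.mem_foldl_adjoin
  by (intro allI impI bexI exI[of _ "\<lambda>_. 0"]) (auto intro: polys.zero_closed)

lemma coset_in_image_iff:
  assumes J: "polys.subideal V J" and N: "polys.subideal V N" "J \<subseteq> N" and p: "p \<in> polys V"
  shows "J +>\<^bsub>mpoly_ring V\<^esub> p \<in> (\<lambda>p. J +>\<^bsub>mpoly_ring V\<^esub> p) ` N \<longleftrightarrow> p \<in> N"
proof
  assume "J +>\<^bsub>mpoly_ring V\<^esub> p \<in> (\<lambda>p. J +>\<^bsub>mpoly_ring V\<^esub> p) ` N"
  then obtain q where q: "q \<in> N" "J +>\<^bsub>mpoly_ring V\<^esub> p = J +>\<^bsub>mpoly_ring V\<^esub> q"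
    by blast
  then have "p - q \<in> N"
    using coset_eq_iff[OF J p] polys.subideal_sub[OF N(1)] N(2) by blast
  then show "p \<in> N"
    using polys.subideal_add[OF N(1) _ q(1)] by force
qed blast

lemma regular_sequence_quot:
  fixes J :: "'k::field mpoly set"
  assumes J: "polys.subideal V J" and fs: "set fs \<subseteq> polys V"
  shows "regular_sequence (quotient_module (mpoly_ring V) J) fs \<longleftrightarrow>
    polys.weakly_regular V J fs \<and> foldl (polys.adjoin V) J fs \<noteq> polys V"
proof -
  let ?M = "quotient_module (mpoly_ring V) J"
  let ?co = "\<lambda>p. J +>\<^bsub>mpoly_ring V\<^esub> p"
  let ?N = "\<lambda>i. foldl (polys.adjoin V) J (take i fs)"
  have tk: "set (take i fs) \<subseteq> polys V" for i
    using fs set_take_subset[of i fs] by blast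
  have N: "polys.subideal V (?N i)" "J \<subseteq> ?N i" for i
    by (rule polys.subideal_foldl_adjoin[OF J tk], rule subset_foldl_adjoin[OF J tk])
  have mem: "?co p \<in> multiples ?M (take i fs) \<longleftrightarrow> p \<in> ?N i" if "p \<in> polys V" for p i
    unfolding multiples_quot[OF J tk] by (rule coset_in_image_iff[OF J N that])
  have fsi: "fs ! i \<in> polys V" if "i < length fs" for i
    using fs that by auto
  have "(\<forall>i<length fs. \<forall>x\<in>carrier ?M. fs ! i \<odot>\<^bsub>?M\<^esub> x \<in> multiples ?M (take i fs) \<longrightarrow> x \<in> multiples ?M (take i fs))
    \<longleftrightarrow> polys.weakly_regular V J fs"
    unfolding polys.weakly_regular_iff carrier_quot[OF J] ball_simps
    by (intro all_cong ball_cong refl) (simp add: mem smult_quot[OF J] fsi polys.mult_closed)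
  moreover have "multiples ?M fs = carrier ?M \<longleftrightarrow> foldl (polys.adjoin V) J fs = polys V"
  proof
    assume eq: "multiples ?M fs = carrier ?M"
    show "foldl (polys.adjoin V) J fs = polys V"
    proof (intro equalityI subsetI)
      fix p :: "'k mpoly" assume "p \<in> polys V"
      then show "p \<in> foldl (polys.adjoin V) J fs"
        using mem[of p "length fs"] coset_in_quot[OF J] eq by simp
    qed (use polys.subideal_sub[OF N(1)[of "length fs"]] in simp)
  qed (simp add: multiples_quot[OF J fs] carrier_quot[OF J])
  ultimately show ?thesis
    unfolding regular_sequence_def by simp
qed

section \<open>Stanley depth of quotients by monomial ideals\<close>

lemma coef_mult_single: "coef (p * pmon u c) (u + m) = coef p m * c"
  using coef_single_mult[of u c p m] by (simp add: mult.commute)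

lemma coef_mult_single_notin:
  assumes "\<And>m'. m' \<in> mons p \<Longrightarrow> m \<noteq> u + m'"
  shows "coef (p * pmon u c) m = 0"
proof (rule ccontr)
  assume "coef (p * pmon u c) m \<noteq> 0"
  then have "m \<in> mons (p * pmon u c)"
    by (simp add: in_keys_iff)
  then obtain a b where "a \<in> mons p" "b \<in> mons (pmon u c)" "m = a + b"
    using mons_mult by blast
  then show False
    using assms[of a] by (auto simp: add.commute split: if_splits)
qed

lemma mons_mult_single_cell:
  assumes "p \<in> polys Z"
  shows "mons (p * pmon u c) \<subseteq> cell u Z"
proof
  fix m assume "m \<in> mons (p * pmon u c)"
  then obtain a b where "a \<in> mons p" "b \<in> mons (pmon u c)" "m = a + b"
    using mons_mult by blast
  then show "m \<in> cell u Z"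
    using assms unfolding cell_def polys_def by (auto simp: add.commute split: if_splits)
qed

lemma polys_mono: "Z \<subseteq> V \<Longrightarrow> p \<in> polys Z \<Longrightarrow> p \<in> polys V"
  unfolding polys_def by blast

lemma poly_in_cell:
  assumes "mons p \<subseteq> cell u Z"
  obtains q where "q \<in> polys Z" "p = q * pmon u 1"
proof -
  have "\<forall>m\<in>mons p. \<exists>q. m = u + q \<and> supp q \<subseteq> Z"
    using assms unfolding cell_def by blast
  then obtain f where f: "\<And>m. m \<in> mons p \<Longrightarrow> m = u + f m" "\<And>m. m \<in> mons p \<Longrightarrow> supp (f m) \<subseteq> Z"
    by metis
  let ?q = "\<Sum>m\<in>mons p. pmon (f m) (coef p m)"
  have "?q \<in> polys Z"
    by (intro polys.sum_closed pmon_in_polys f(2))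
  moreover have "p = ?q * pmon u 1"
    by (subst poly_as_sum) (simp add: sum_distrib_right mult_single add.commute flip: f(1))
  ultimately show thesis by (rule that)
qed

definition restrict_mons :: "expo set \<Rightarrow> 'k::field mpoly \<Rightarrow> 'k mpoly" where
  "restrict_mons A p = (\<Sum>m\<in>mons p \<inter> A. pmon m (coef p m))"

lemma coef_restrict_mons: "coef (restrict_mons A p) m = (if m \<in> A then coef p m else 0)"
  unfolding restrict_mons_def lookup_sum by (auto simp: lookup_single when_def in_keys_iff)

lemma mons_restrict_mons: "mons (restrict_mons A p) = mons p \<inter> A"
  by (auto simp: in_keys_iff coef_restrict_mons split: if_splits)

lemma stanley_space_quot:
  assumes J: "polys.subideal V J" and Z: "Z \<subseteq> V" and p: "p \<in> polys V"
  shows "stanley_space (quotient_module (mpoly_ring V) J) (J +>\<^bsub>mpoly_ring V\<^esub> p) Z =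
    (\<lambda>u. J +>\<^bsub>mpoly_ring V\<^esub> (u * p)) ` polys Z"
  unfolding stanley_space_def ring_sel
  using smult_quot[OF J polys_mono[OF Z] p] by (auto simp: image_iff)

text \<open>
  A polynomial is, modulo the ideal, the sum of its restrictions to the cells. Since the cells are
  disjoint and consist of monomials outside the ideal, no cancellation between summands is possible,
  which gives both uniqueness and freeness.
\<close>

lemma stanley_decomposition_of_cells:
  fixes Z :: "nat \<Rightarrow> nat set" and m :: "nat \<Rightarrow> expo" and U :: "expo set"
  assumes U: "upset U" and Z: "\<And>i. i < r \<Longrightarrow> Z i \<subseteq> {1..n}"
    and cover: "{m. supp m \<subseteq> {1..n} \<and> m \<notin> U} = (\<Union>i<r. cell (m i) (Z i))"
    and disj: "\<And>i j. i < r \<Longrightarrow> j < r \<Longrightarrow> i \<noteq> j \<Longrightarrow> cell (m i) (Z i) \<inter> cell (m j) (Z j) = {}"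
  shows "stanley_decomposition n (quotient_module (polynomial_ring n) (mon_ideal {1..n} U :: 'k::field mpoly set))
    (quotient_grading n (mon_ideal {1..n} U)) r
    (\<lambda>i. mon_ideal {1..n} U +>\<^bsub>polynomial_ring n\<^esub> pmon (m i) 1) Z"
proof -
  define V where "V = {1..n}"
  define J :: "'k mpoly set" where "J = mon_ideal V U"
  let ?M = "quotient_module (mpoly_ring V) J"
  let ?co = "\<lambda>p. J +>\<^bsub>mpoly_ring V\<^esub> p"
  let ?x = "\<lambda>i. pmon (m i) (1::'k)"
  note Z = Z[folded V_def] and cover = cover[folded V_def]
  have J: "polys.subideal V J"
    unfolding J_def by (rule subideal_mon_ideal[OF U])
  have "m i \<in> cell (m i) (Z i)" for i
    unfolding cell_def by (auto intro: exI[of _ 0])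
  then have m: "supp (m i) \<subseteq> V" if "i < r" for i
    using that cover by blast
  have x: "?x i \<in> polys V" if "i < r" for i
    by (rule pmon_in_polys[OF m[OF that]])
  have ux: "u * ?x i \<in> polys V" if "i < r" "u \<in> polys (Z i)" for u i
    using polys.mult_closed[OF polys_mono[OF Z that(2)] x] that(1) by blast
  have ssp: "stanley_space ?M (?co (?x i)) (Z i) = (\<lambda>u. ?co (u * ?x i)) ` polys (Z i)" if "i < r" for i
    using stanley_space_quot[OF J Z x] that by blast
  have std: "w \<notin> U" if "w \<in> cell (m i) (Z i)" "i < r" for w i
    using that cover by blast
  have zero: "u = 0" if "i < r" "u \<in> polys (Z i)" "\<And>q. supp q \<subseteq> Z i \<Longrightarrow> coef (u * ?x i) (m i + q) = 0" for u i
  proof (rule ccontr)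
    assume "u \<noteq> 0"
    then obtain q where q: "q \<in> mons u"
      by (metis keys_eq_empty ex_in_conv)
    then have "supp q \<subseteq> Z i"
      using that(2) unfolding polys_def by blast
    then have "coef u q = 0"
      using that(3)[of q] by (simp add: coef_mult_single)
    then show False
      using q by (simp add: in_keys_iff)
  qed
  have "stanley_decomposition n ?M (quotient_grading n J) r (\<lambda>i. ?co (?x i)) Z"
    unfolding stanley_decomposition_def
  proof (intro conjI allI impI ballI)
    fix i assume i: "i < r"
    show "?co (?x i) \<in> carrier ?M"
      by (rule coset_in_quot[OF J x[OF i]])
    show "Z i \<subseteq> {1..n}"
      using Z[OF i] by (simp add: V_def)
    show "homogeneous_elem n (quotient_grading n J) (?co (?x i))"
      unfolding homogeneous_elem_def quotient_grading_def
    proof (rule bexI, rule image_eqI)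
      let ?g = "restrict (\<lambda>j. int (expt (m i) j)) {1..n}"
      show "?g \<in> {1..n} \<rightarrow>\<^sub>E UNIV"
        by auto
      show "?x i \<in> {p \<in> carrier (polynomial_ring n). \<forall>a\<in>mons p. \<forall>j\<in>{1..n}. int (expt a j) = ?g j}"
        using x[OF i] by (auto simp: ring_sel V_def split: if_splits)
    qed (simp add: V_def)
    show "u = 0" if "u \<in> carrier (mpoly_ring (Z i))" "u \<odot>\<^bsub>?M\<^esub> ?co (?x i) = \<zero>\<^bsub>?M\<^esub>" for u
    proof -
      have u: "u \<in> polys (Z i)"
        using that(1) by (simp add: ring_sel)
      have "?co (u * ?x i) = ?co 0"
        using that(2) smult_quot[OF J polys_mono[OF Z[OF i] u] x[OF i]] zero_quot[OF J] by simp
      then have "u * ?x i \<in> J"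
        using coset_eq_iff[OF J ux[OF i u] polys.zero_closed] by simp
      then have "mons (u * ?x i) \<subseteq> U"
        by (simp add: J_def mon_ideal_def)
      then show "u = 0"
        using std[OF _ i] by (intro zero[OF i u]) (auto simp: in_keys_iff cell_def)
    qed
  next
    fix A assume "A \<in> carrier ?M"
    then obtain p where p: "p \<in> polys V" "A = ?co p"
      unfolding carrier_quot[OF J] by blast
    define p' where "p' i = restrict_mons (cell (m i) (Z i)) p" for i
    have "\<exists>q. q \<in> polys (Z i) \<and> p' i = q * ?x i" for i
      using poly_in_cell[of "p' i" "m i" "Z i"] unfolding p'_def mons_restrict_mons by blast
    then obtain q where q: "\<And>i. q i \<in> polys (Z i)" "\<And>i. p' i = q i * ?x i"
      by metis
    have p'V: "p' i \<in> polys V" if "i < r" for i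
      using ux[OF that q(1)] unfolding q(2) .
    have sumV: "(\<Sum>i<r. p' i) \<in> polys V"
      by (intro polys.sum_closed p'V) simp
    have "p - (\<Sum>i<r. p' i) \<in> J"
      unfolding J_def mon_ideal_def
    proof (intro CollectI conjI subsetI)
      show "p - (\<Sum>i<r. p' i) \<in> polys V"
        using p(1) sumV by (rule polys.minus_closed)
      fix w assume "w \<in> mons (p - (\<Sum>i<r. p' i))"
      then have ne: "coef p w \<noteq> (\<Sum>i<r. coef (p' i) w)"
        and wV: "supp w \<subseteq> V"
        using \<open>p - (\<Sum>i<r. p' i) \<in> polys V\<close>
        by (auto simp: in_keys_iff lookup_minus lookup_sum polys_def)
      show "w \<in> U"
      proof (rule ccontr)
        assume "w \<notin> U"
        then obtain i where i: "i < r" "w \<in> cell (m i) (Z i)"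
          using wV cover by blast
        have "(\<Sum>j<r. coef (p' j) w) = (\<Sum>j<r. if j = i then coef p w else 0)"
        proof (rule sum.cong)
          fix j assume "j \<in> {..<r}"
          then show "coef (p' j) w = (if j = i then coef p w else 0)"
            using disj[of i j] i unfolding p'_def coef_restrict_mons by auto
        qed simp
        then show False
          using ne i(1) by simp
      qed
    qed
    then have A: "A = ?co (\<Sum>i<r. p' i)"
      unfolding p(2) using coset_eq_iff[OF J p(1) sumV] by blast
    let ?P = "\<lambda>y. y \<in> (\<Pi>\<^sub>E i\<in>{..<r}. stanley_space ?M (?co (?x i)) (Z i)) \<and> A = (\<Oplus>\<^bsub>?M\<^esub> i\<in>{..<r}. y i)"
    interpret M: module "mpoly_ring V" ?M by (rule quot_module[OF J])
    show "\<exists>!y. ?P y"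
    proof (rule ex1I)
      let ?y = "restrict (\<lambda>i. ?co (p' i)) {..<r}"
      have "(\<Oplus>\<^bsub>?M\<^esub> i\<in>{..<r}. ?y i) = (\<Oplus>\<^bsub>?M\<^esub> i\<in>{..<r}. ?co (p' i))"
        by (intro M.finsum_cong') (auto intro: coset_in_quot[OF J] p'V)
      also have "\<dots> = A"
        unfolding A by (rule finsum_quot[OF J]) (simp add: p'V)
      finally show "?P ?y"
        using ssp q by (auto simp: q(2) restrict_def)
      fix y assume y: "?P y"
      have "\<forall>i\<in>{..<r}. \<exists>u. u \<in> polys (Z i) \<and> y i = ?co (u * ?x i)"
        using y ssp by (auto simp: PiE_iff)
      then obtain u where u: "\<And>i. i < r \<Longrightarrow> u i \<in> polys (Z i)" "\<And>i. i < r \<Longrightarrow> y i = ?co (u i * ?x i)"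
        unfolding bchoice_iff by auto
      have uxs: "(\<Sum>i<r. u i * ?x i) \<in> polys V"
        by (intro polys.sum_closed ux u) simp_all
      have "A = (\<Oplus>\<^bsub>?M\<^esub> i\<in>{..<r}. y i)"
        using y by blast
      also have "\<dots> = (\<Oplus>\<^bsub>?M\<^esub> i\<in>{..<r}. ?co (u i * ?x i))"
        using u by (intro M.finsum_cong') (auto intro: coset_in_quot[OF J] ux)
      also have "\<dots> = ?co (\<Sum>i<r. u i * ?x i)"
        by (rule finsum_quot[OF J]) (simp add: ux u)
      finally have diff: "(\<Sum>i<r. u i * ?x i) - (\<Sum>i<r. p' i) \<in> J"
        unfolding A using coset_eq_iff[OF J sumV uxs] coset_eq_iff[OF J uxs sumV] by metis
      have "u i = q i" if i: "i < r" for i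
      proof -
        have "u i - q i = 0"
        proof (rule zero[OF i])
          show "u i - q i \<in> polys (Z i)"
            by (intro polys.minus_closed u q i)
          fix e assume e: "supp e \<subseteq> Z i"
          let ?w = "m i + e"
          have w: "?w \<in> cell (m i) (Z i)"
            using e unfolding cell_def by blast
          have other: "coef ((u j - q j) * ?x j) ?w = 0" if "j < r" "j \<noteq> i" for j
          proof -
            have "?w \<notin> cell (m j) (Z j)"
              using disj[OF i that(1)] that(2) w by blast
            moreover have "mons ((u j - q j) * ?x j) \<subseteq> cell (m j) (Z j)"
              by (intro mons_mult_single_cell polys.minus_closed u q that)
            ultimately show ?thesis
              by (meson in_keys_iff subsetD)
          qed
          have "(\<Sum>j<r. u j * ?x j) - (\<Sum>j<r. p' j) = (\<Sum>j<r. (u j - q j) * ?x j)"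
            unfolding q(2) by (simp add: sum_subtractf left_diff_distrib)
          then have "coef ((\<Sum>j<r. u j * ?x j) - (\<Sum>j<r. p' j)) ?w = (\<Sum>j<r. coef ((u j - q j) * ?x j) ?w)"
            by (simp add: lookup_sum)
          also have "\<dots> = (\<Sum>j<r. if j = i then coef ((u i - q i) * ?x i) ?w else 0)"
            by (rule sum.cong) (auto simp: other)
          also have "\<dots> = coef ((u i - q i) * ?x i) ?w"
            using i by simp
          finally show "coef ((u i - q i) * ?x i) ?w = 0"
            using diff std[OF w i] unfolding J_def mon_ideal_def by (metis (no_types, lifting) in_keys_iff mem_Collect_eq subsetD)
        qed
        then show ?thesis by simp
      qed
      then show "y = ?y"
        using y u(2) by (intro PiE_ext[of y "{..<r}" _ ?y]) (auto simp: q(2) PiE_iff extensional_def)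
    qed
  qed
  then show ?thesis
    by (simp add: V_def J_def)
qed

lemma sdepth_ge_of_cell_partition:
  fixes U :: "expo set"
  assumes U: "upset U" and part: "cell_partition {1..n} d {m. supp m \<subseteq> {1..n} \<and> m \<notin> U}"
  shows "enat d \<le> sdepth_quotient n (mon_ideal {1..n} U :: 'k::field mpoly set)"
proof -
  obtain r :: nat and m Z where "\<forall>i<r. Z i \<subseteq> {1..n} \<and> d \<le> card (Z i)"
    "{m. supp m \<subseteq> {1..n} \<and> m \<notin> U} = (\<Union>i<r. cell (m i) (Z i))"
    "\<forall>i<r. \<forall>j<r. i \<noteq> j \<longrightarrow> cell (m i) (Z i) \<inter> cell (m j) (Z j) = {}"
    using cell_partition_indexed[OF part] by (elim exE conjE) (rule that)
  then have *: "\<And>i. i < r \<Longrightarrow> Z i \<subseteq> {1..n}" "\<And>i. i < r \<Longrightarrow> d \<le> card (Z i)"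
    "{m. supp m \<subseteq> {1..n} \<and> m \<notin> U} = (\<Union>i<r. cell (m i) (Z i))"
    "\<And>i j. i < r \<Longrightarrow> j < r \<Longrightarrow> i \<noteq> j \<Longrightarrow> cell (m i) (Z i) \<inter> cell (m j) (Z j) = {}"
    by simp_all
  have "enat d \<le> (INF i\<in>{..<r}. enat (card (Z i)))"
    by (rule INF_greatest) (use *(2) in simp)
  also have "\<dots> \<le> sdepth_quotient n (mon_ideal {1..n} U :: 'k mpoly set)"
    unfolding sdepth_def
    by (rule Sup_upper) (use stanley_decomposition_of_cells[OF U *(1,3,4)] in blast)
  finally show ?thesis .
qed

text \<open>
  Homogeneous elements of \<open>S/J\<close> are classes of scalar multiples of monomials. As the class of \<open>x\<^sup>m\<close> is
  nonzero, some summand \<open>w\<^sub>i K[Z\<^sub>i]\<close> contains a nonzero multiple of it, \<open>x\<^sup>q w\<^sub>i\<close>. If \<open>z \<in> P \<inter> Z\<^sub>i\<close>, then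
  \<open>x\<^sub>z x\<^sup>q\<close> kills \<open>w\<^sub>i\<close>, against freeness.
\<close>

lemma sdepth_le_of_socle:
  fixes U :: "expo set"
  assumes U: "upset U" and m: "supp m \<subseteq> {1..n}" "m \<notin> U"
    and P: "P \<subseteq> {1..n}" "\<And>z. z \<in> P \<Longrightarrow> m + unit_exp z \<in> U"
  shows "sdepth_quotient n (mon_ideal {1..n} U :: 'k::field mpoly set) \<le> enat (n - card P)"
  unfolding sdepth_def
proof (rule Sup_least)
  define V where "V = {1..n}"
  define J :: "'k mpoly set" where "J = mon_ideal V U"
  let ?M = "quotient_module (mpoly_ring V) J"
  let ?co = "\<lambda>p. J +>\<^bsub>mpoly_ring V\<^esub> p"
  have J: "polys.subideal V J"
    unfolding J_def by (rule subideal_mon_ideal[OF U])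
  fix s assume "s \<in> {(INF i\<in>{..<r}. enat (card (Z i))) |r w Z. stanley_decomposition n
    (quotient_module (polynomial_ring n) (mon_ideal {1..n} U :: 'k mpoly set)) (quotient_grading n (mon_ideal {1..n} U)) r w Z}"
  then obtain r :: nat and w Z where s: "s = (INF i\<in>{..<r}. enat (card (Z i)))"
    and D: "stanley_decomposition n ?M (quotient_grading n J) r w Z"
    unfolding J_def V_def by blast
  note D1 = D[unfolded stanley_decomposition_def, THEN conjunct1, rule_format]
  note D2 = D[unfolded stanley_decomposition_def, THEN conjunct2, rule_format]
  have Z: "Z i \<subseteq> V" if "i < r" for i
    using D1[OF that] by (simp add: V_def)
  have free: "u = 0" if "i < r" "u \<in> polys (Z i)" "u \<odot>\<^bsub>?M\<^esub> w i = \<zero>\<^bsub>?M\<^esub>" for i u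
    using D1[OF that(1)] that(2,3) by (simp add: ring_sel)
  have "\<exists>e c. supp e \<subseteq> V \<and> w i = ?co (pmon e c)" if i: "i < r" for i
  proof -
    obtain g p where g: "g \<in> {1..n} \<rightarrow>\<^sub>E UNIV" "p \<in> polys V" "w i = ?co p"
      "\<forall>a\<in>mons p. \<forall>j\<in>{1..n}. int (expt a j) = g j"
      using D1[OF i] unfolding homogeneous_elem_def quotient_grading_def ring_sel V_def
      by (auto simp: image_iff)
    have same: "a = b" if "a \<in> mons p" "b \<in> mons p" for a b
    proof (rule poly_mapping_eqI)
      fix j
      show "expt a j = expt b j"
      proof (cases "j \<in> {1..n}")
        case True
        then have "int (expt a j) = int (expt b j)"
          using g(4) that by simp
        then show ?thesis by simp
      next
        case False
        then have "j \<notin> supp a" "j \<notin> supp b"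
          using g(2) that unfolding polys_def V_def by blast+
        then show ?thesis by (simp add: in_keys_iff)
      qed
    qed
    show ?thesis
    proof (cases "mons p = {}")
      case True
      then have "p = pmon 0 0" by simp
      then show ?thesis
        using g(3) by (intro exI[of _ 0]) auto
    next
      case False
      then obtain a where a: "a \<in> mons p" by blast
      then have "mons p = {a}"
        using same by blast
      then have "p = pmon a (coef p a)"
        by (subst poly_as_sum) simp
      moreover have "supp a \<subseteq> V"
        using g(2) a unfolding polys_def by blast
      ultimately show ?thesis
        using g(3) by metis
    qed
  qed
  then obtain e c where e: "\<And>i. i < r \<Longrightarrow> supp (e i) \<subseteq> V" "\<And>i. i < r \<Longrightarrow> w i = ?co (pmon (e i) (c i))"
    by metis
  have ec: "pmon (e i) (c i) \<in> polys V" if "i < r" for i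
    by (rule pmon_in_polys[OF e(1)[OF that]])
  have xm: "pmon m 1 \<in> polys V"
    using m(1) by (simp add: V_def pmon_in_polys)
  obtain y where y: "y \<in> (\<Pi>\<^sub>E i\<in>{..<r}. stanley_space ?M (w i) (Z i))"
    "?co (pmon m 1) = (\<Oplus>\<^bsub>?M\<^esub> i\<in>{..<r}. y i)"
    using D2[OF coset_in_quot[OF J xm]] by blast
  have "\<forall>i\<in>{..<r}. \<exists>u. u \<in> polys (Z i) \<and> y i = ?co (u * pmon (e i) (c i))"
  proof
    fix i assume "i \<in> {..<r}"
    then have i: "i < r" by simp
    then have "y i \<in> stanley_space ?M (w i) (Z i)"
      using y(1) by (auto simp: PiE_iff)
    then show "\<exists>u. u \<in> polys (Z i) \<and> y i = ?co (u * pmon (e i) (c i))"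
      unfolding e(2)[OF i] stanley_space_quot[OF J Z[OF i] ec[OF i]] by blast
  qed
  then obtain u where u: "\<And>i. i < r \<Longrightarrow> u i \<in> polys (Z i)"
    "\<And>i. i < r \<Longrightarrow> y i = ?co (u i * pmon (e i) (c i))"
    unfolding bchoice_iff by auto
  have ue: "u i * pmon (e i) (c i) \<in> polys V" if "i < r" for i
    using polys.mult_closed[OF polys_mono[OF Z u(1)] ec] that by blast
  have uesum: "(\<Sum>i<r. u i * pmon (e i) (c i)) \<in> polys V"
    by (intro polys.sum_closed ue) simp
  interpret M: module "mpoly_ring V" ?M by (rule quot_module[OF J])
  have "?co (pmon m 1) = (\<Oplus>\<^bsub>?M\<^esub> i\<in>{..<r}. ?co (u i * pmon (e i) (c i)))"
    unfolding y(2) using u(2) by (intro M.finsum_cong') (auto intro: coset_in_quot[OF J] ue)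
  also have "\<dots> = ?co (\<Sum>i<r. u i * pmon (e i) (c i))"
    by (rule finsum_quot[OF J]) (simp add: ue)
  finally have "pmon m 1 - (\<Sum>i<r. u i * pmon (e i) (c i)) \<in> J"
    using coset_eq_iff[OF J xm uesum] by blast
  then have "coef (pmon m 1 - (\<Sum>i<r. u i * pmon (e i) (c i))) m = 0"
    using m(2) unfolding J_def mon_ideal_def by (metis (no_types, lifting) in_keys_iff mem_Collect_eq subsetD)
  then have "(\<Sum>i<r. coef (u i * pmon (e i) (c i)) m) = 1"
    by (simp add: lookup_minus lookup_sum)
  then obtain i where i: "i < r" "coef (u i * pmon (e i) (c i)) m \<noteq> 0"
    by (metis (no_types, lifting) lessThan_iff sum.neutral zero_neq_one)
  then obtain q where q: "q \<in> mons (u i)" "m = e i + q"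
    using coef_mult_single_notin[of "u i" m "e i" "c i"] by blast
  have qZ: "supp q \<subseteq> Z i"
    using u(1)[OF i(1)] q(1) unfolding polys_def by blast
  have "Z i \<inter> P = {}"
  proof (rule ccontr)
    assume "Z i \<inter> P \<noteq> {}"
    then obtain z where z: "z \<in> Z i" "z \<in> P" by blast
    let ?v = "pmon (q + unit_exp z) (1::'k)"
    have v: "?v \<in> polys (Z i)"
      using qZ z(1) by (intro pmon_in_polys) (auto simp: supp_plus supp_unit)
    have "?v * pmon (e i) (c i) = pmon (m + unit_exp z) (c i)"
      by (simp add: mult_single q(2) ac_simps)
    moreover have "supp (m + unit_exp z) \<subseteq> V"
      using m(1) z Z[OF i(1)] unfolding V_def by (auto simp: supp_plus supp_unit)
    ultimately have "?v * pmon (e i) (c i) \<in> J"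
      using P(2)[OF z(2)] unfolding J_def mon_ideal_def by (auto intro: pmon_in_polys polys.zero_closed split: if_splits)
    then have "?v \<odot>\<^bsub>?M\<^esub> w i = \<zero>\<^bsub>?M\<^esub>"
      unfolding e(2)[OF i(1)] smult_quot[OF J polys_mono[OF Z[OF i(1)] v] ec[OF i(1)]] zero_quot[OF J]
      by (subst coset_eq_iff[OF J])
        (auto intro: polys.zero_closed polys.mult_closed ec i polys_mono[OF Z[OF i(1)] v])
    then have "?v = 0"
      by (rule free[OF i(1) v])
    then show False
      by (metis lookup_single_eq lookup_zero zero_neq_one)
  qed
  then have "Z i \<subseteq> V - P"
    using Z[OF i(1)] by blast
  then have "card (Z i) \<le> card (V - P)"
    by (intro card_mono) (simp_all add: V_def)
  also have "\<dots> = n - card P"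
    using P(1) by (simp add: V_def card_Diff_subset finite_subset)
  finally have "enat (card (Z i)) \<le> enat (n - card P)" by simp
  moreover have "s \<le> enat (card (Z i))"
    unfolding s by (rule INF_lower) (use i(1) in simp)
  ultimately show "s \<le> enat (n - card P)"
    by (rule order.trans[rotated])
qed

section \<open>Differences of variables\<close>

lemma Var_eq: "Var z = pmon (unit_exp z) 1"
  by (simp add: Var_def unit_exp_def)

text \<open>
  By induction on \<open>i + j\<close>, both \<open>x w\<close> and \<open>y w\<close> lie in \<open>U\<close>.
\<close>

lemma upset_cancel_powers:
  assumes U: "upset U" and crit: "\<And>w. w + unit_exp x \<in> U \<Longrightarrow> w + unit_exp y \<in> U \<Longrightarrow> w \<in> U"
  shows "w + Poly_Mapping.single x i \<in> U \<Longrightarrow> w + Poly_Mapping.single y j \<in> U \<Longrightarrow> w \<in> U"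
proof (induction "i + j" arbitrary: i j w)
  case (Suc k)
  show ?case
  proof (cases "i = 0 \<or> j = 0")
    case False
    then obtain i' j' where ij: "i = Suc i'" "j = Suc j'"
      by (meson not0_implies_Suc)
    have split: "Poly_Mapping.single z (Suc l) = unit_exp z + Poly_Mapping.single z l" for z :: nat and l :: nat
      by (simp add: unit_exp_def flip: single_add)
    have "w + unit_exp x \<in> U"
    proof (rule Suc.hyps(1)[of i' j])
      show "w + unit_exp x + Poly_Mapping.single x i' \<in> U"
        using Suc.prems(1) by (simp add: ij split add.assoc)
      show "w + unit_exp x + Poly_Mapping.single y j \<in> U"
        using Suc.prems(2) U unfolding upset_def by (metis add.assoc add.commute)
    qed (use Suc.hyps(2) ij in simp)
    moreover have "w + unit_exp y \<in> U"
    proof (rule Suc.hyps(1)[of i j'])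
      show "w + unit_exp y + Poly_Mapping.single y j' \<in> U"
        using Suc.prems(2) by (simp add: ij split add.assoc)
      show "w + unit_exp y + Poly_Mapping.single x i \<in> U"
        using Suc.prems(1) U unfolding upset_def by (metis add.assoc add.commute)
    qed (use Suc.hyps(2) ij in simp)
    ultimately show ?thesis by (rule crit)
  qed (use Suc.prems in auto)
qed simp

lemma Var_power: "Var z ^ i = pmon (Poly_Mapping.single z i) 1"
proof (induction i)
  case (Suc i)
  then show ?case
    by (simp add: Var_def mult_single flip: single_add)
qed simp

text \<open>
  If \<open>x - y\<close> kills \<open>p\<close> modulo the ideal, so does its multiple \<open>x\<^sup>N - y\<^sup>N\<close>. For \<open>N\<close> larger than all
  exponents of \<open>p\<close>, the polynomials \<open>x\<^sup>N p\<close> and \<open>y\<^sup>N p\<close> have no monomial in common, so both lie in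
  the ideal, and the powers can be cancelled monomial by monomial.
\<close>

lemma difference_nonzerodivisor:
  assumes U: "upset U" and crit: "\<And>w. w + unit_exp x \<in> U \<Longrightarrow> w + unit_exp y \<in> U \<Longrightarrow> w \<in> U"
    and xy: "x \<noteq> y" "x \<in> V" "y \<in> V"
    and p: "p \<in> polys V" "(Var x - Var y) * p \<in> mon_ideal V U"
  shows "p \<in> mon_ideal V U"
proof -
  define N where "N = Suc (\<Sum>m\<in>mons p. expt m x + expt m y)"
  have N: "expt m x < N" "expt m y < N" if "m \<in> mons p" for m
    using member_le_sum[OF that, of "\<lambda>m. expt m x + expt m y"] unfolding N_def by auto
  let ?X = "Poly_Mapping.single x N" and ?Y = "Poly_Mapping.single y N"
  have V: "Var z \<in> polys V" if "z \<in> V" for z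
    using that by (simp add: Var_eq pmon_in_polys supp_unit)
  let ?S = "\<Sum>i<N. Var y ^ (N - Suc i) * Var x ^ i"
  have "?S \<in> polys V"
    by (intro polys.sum_closed polys.mult_closed polys.power_closed V xy)
  then have "?S * ((Var x - Var y) * p) \<in> mon_ideal V U"
    by (rule polys.subideal_mult[OF subideal_mon_ideal[OF U] _ p(2)])
  also have "?S * ((Var x - Var y) * p) = Var x ^ N * p - Var y ^ N * p"
  proof -
    have "?S * ((Var x - Var y) * p) = ((Var x - Var y) * ?S) * p"
      by (simp only: ac_simps)
    also have "(Var x - Var y) * ?S = Var x ^ N - Var y ^ N"
      by (rule power_diff_sumr2[symmetric])
    finally show ?thesis
      by (simp only: left_diff_distrib)
  qed
  finally have D: "mons (pmon ?X 1 * p - pmon ?Y 1 * p) \<subseteq> U"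
    by (simp add: mon_ideal_def Var_power)
  have "m \<in> U" if m: "m \<in> mons p" for m
  proof (rule upset_cancel_powers[OF U crit])
    have off: "coef (pmon (Poly_Mapping.single b N) 1 * p) (Poly_Mapping.single a N + m) = 0"
      if ab: "a \<noteq> b" and Na: "\<And>m'. m' \<in> mons p \<Longrightarrow> expt m' a < N" for a b
    proof (rule ccontr)
      assume "coef (pmon (Poly_Mapping.single b N) 1 * p) (Poly_Mapping.single a N + m) \<noteq> 0"
      then have "Poly_Mapping.single a N + m \<in> mons (pmon (Poly_Mapping.single b N) 1 * p)"
        by (simp add: in_keys_iff)
      then obtain m' where m': "m' \<in> mons p" "Poly_Mapping.single a N + m = Poly_Mapping.single b N + m'"
        by (auto dest!: mons_mult split: if_splits)
      have "N + expt m a = expt m' a"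
        using arg_cong[OF m'(2), of "\<lambda>e. expt e a"] ab by (simp add: lookup_add lookup_single when_def)
      then show False
        using Na[OF m'(1)] by simp
    qed
    have "coef (pmon ?X 1 * p - pmon ?Y 1 * p) (?X + m) = coef p m"
      using off[OF xy(1)] N by (simp add: lookup_minus coef_single_mult)
    then have "?X + m \<in> U"
      using D m by (metis in_keys_iff subsetD)
    then show "m + ?X \<in> U"
      by (simp add: add.commute)
    have "coef (pmon ?X 1 * p - pmon ?Y 1 * p) (?Y + m) = - coef p m"
      using off[OF xy(1)[symmetric]] N by (simp add: lookup_minus coef_single_mult)
    then have "?Y + m \<in> U"
      using D m by (metis in_keys_iff neg_equal_0_iff_equal subsetD)
    then show "m + ?Y \<in> U"
      by (simp add: add.commute)
  qed
  then show ?thesis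
    using p(1) unfolding mon_ideal_def by blast
qed

section \<open>Identification of variables\<close>

text \<open>
  The image of a finitely supported function under a map of its indices, with values added over the
  fibres. It is used twice: a renaming \<open>\<phi>\<close> of variables acts on exponent vectors, and this action
  in turn acts on polynomials.
\<close>

definition pushforward :: "('a \<Rightarrow> 'b) \<Rightarrow> ('a \<Rightarrow>\<^sub>0 'c) \<Rightarrow> ('b \<Rightarrow>\<^sub>0 'c::comm_monoid_add)" where
  "pushforward \<phi> m = (\<Sum>j\<in>Poly_Mapping.keys m. Poly_Mapping.single (\<phi> j) (Poly_Mapping.lookup m j))"

lemma pushforward_superset:
  assumes "finite A" "Poly_Mapping.keys m \<subseteq> A"
  shows "pushforward \<phi> m = (\<Sum>j\<in>A. Poly_Mapping.single (\<phi> j) (Poly_Mapping.lookup m j))"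
  unfolding pushforward_def using assms
  by (intro sum.mono_neutral_left) (auto simp: in_keys_iff)

lemma pushforward_zero [simp]: "pushforward \<phi> 0 = 0"
  by (simp add: pushforward_def)

lemma pushforward_add: "pushforward \<phi> (a + b) = pushforward \<phi> a + pushforward \<phi> b"
proof -
  let ?A = "Poly_Mapping.keys a \<union> Poly_Mapping.keys b"
  have "Poly_Mapping.keys (a + b) \<subseteq> ?A"
    by (rule Poly_Mapping.keys_add)
  then show ?thesis
    by (simp add: pushforward_superset[of ?A] lookup_add single_add sum.distrib)
qed

lemma pushforward_single [simp]: "pushforward \<phi> (Poly_Mapping.single j c) = Poly_Mapping.single (\<phi> j) c"
  by (simp add: pushforward_superset[of "{j}"])

lemma pushforward_sum: "pushforward \<phi> (sum g A) = (\<Sum>i\<in>A. pushforward \<phi> (g i))"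
  by (induction A rule: infinite_finite_induct) (simp_all add: pushforward_add)

lemma pushforward_diff:
  fixes a b :: "'a \<Rightarrow>\<^sub>0 'c::ab_group_add"
  shows "pushforward \<phi> (a - b) = pushforward \<phi> a - pushforward \<phi> b"
  using pushforward_add[of \<phi> "a - b" b] by (simp add: algebra_simps)

lemma keys_pushforward: "Poly_Mapping.keys (pushforward \<phi> m) \<subseteq> \<phi> ` Poly_Mapping.keys m"
proof -
  have "Poly_Mapping.keys (pushforward \<phi> m)
      \<subseteq> (\<Union>j\<in>Poly_Mapping.keys m. Poly_Mapping.keys (Poly_Mapping.single (\<phi> j) (Poly_Mapping.lookup m j)))"
    unfolding pushforward_def by (rule keys_sum)
  then show ?thesis
    by (auto split: if_splits)
qed

lemma expt_pushforward:
  assumes "finite A" "supp m \<subseteq> A"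
  shows "expt (pushforward \<phi> m) z = (\<Sum>j\<in>A. if \<phi> j = z then expt m j else 0)"
  unfolding pushforward_superset[OF assms] lookup_sum
  by (rule sum.cong) (simp_all add: lookup_single when_def)

definition substitute :: "(nat \<Rightarrow> nat) \<Rightarrow> 'k::field mpoly \<Rightarrow> 'k mpoly" where
  "substitute \<phi> = pushforward (pushforward \<phi>)"

lemma substitute_add: "substitute \<phi> (p + q) = substitute \<phi> p + substitute \<phi> q"
  by (simp add: substitute_def pushforward_add)

lemma substitute_diff: "substitute \<phi> (p - q) = substitute \<phi> p - substitute \<phi> q"
  by (simp add: substitute_def pushforward_diff)

lemma substitute_sum: "substitute \<phi> (sum g A) = (\<Sum>i\<in>A. substitute \<phi> (g i))"
  by (simp add: substitute_def pushforward_sum)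

lemma substitute_mult: "substitute \<phi> (p * q) = substitute \<phi> p * substitute \<phi> q"
proof -
  have "p * q = (\<Sum>a\<in>mons p. \<Sum>b\<in>mons q. pmon (a + b) (coef p a * coef q b))"
  proof -
    have "p * q = (\<Sum>a\<in>mons p. pmon a (coef p a)) * (\<Sum>b\<in>mons q. pmon b (coef q b))"
      by (simp only: poly_as_sum[symmetric])
    then show ?thesis
      by (simp add: sum_product mult_single)
  qed
  then have "substitute \<phi> (p * q) =
      (\<Sum>a\<in>mons p. \<Sum>b\<in>mons q. pmon (pushforward \<phi> a + pushforward \<phi> b) (coef p a * coef q b))"
    by (simp add: substitute_def pushforward_sum pushforward_add)
  also have "\<dots> = substitute \<phi> p * substitute \<phi> q"
    by (simp add: substitute_def pushforward_def[of "pushforward \<phi>"] sum_product mult_single)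
  finally show ?thesis .
qed

lemma substitute_Var: "substitute \<phi> (Var z) = Var (\<phi> z)"
  by (simp add: substitute_def Var_def)

lemma mons_substitute: "mons (substitute \<phi> p) \<subseteq> pushforward \<phi> ` mons p"
  unfolding substitute_def by (rule keys_pushforward)

lemma substitute_in_polys:
  assumes "p \<in> polys V" "\<phi> ` V \<subseteq> V"
  shows "substitute \<phi> p \<in> polys V"
  unfolding polys_def
proof (intro CollectI ballI)
  fix m assume "m \<in> mons (substitute \<phi> p)"
  then obtain a where a: "a \<in> mons p" "m = pushforward \<phi> a"
    using mons_substitute by blast
  then have "supp m \<subseteq> \<phi> ` supp a"
    by (simp add: keys_pushforward)
  also have "\<dots> \<subseteq> V"
    using assms a(1) unfolding polys_def by blast
  finally show "supp m \<subseteq> V" .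
qed

lemma pushforward_sum_mset: "pushforward \<phi> (\<Sum>\<^sub># X) = (\<Sum>\<^sub># (image_mset (pushforward \<phi>) X) :: expo)"
  by (induction X) (simp_all add: pushforward_add)

text \<open>
  The sum over a fibre of \<open>\<phi>\<close> inherits the two conditions from its summands, as they share one \<open>\<kappa>\<close>.
\<close>

lemma chain_pushforward:
  assumes ch: "chain \<kappa> e" and \<phi>: "\<And>j. \<kappa> (\<phi> j) = \<kappa> j"
  shows "chain \<kappa> (\<lambda>l. pushforward \<phi> (e l))"
  unfolding chain_def
proof (intro allI conjI impI)
  fix z l assume l: "l \<noteq> \<kappa> z" "l \<noteq> Suc (\<kappa> z)"
  have "expt (pushforward \<phi> (e l)) z = (\<Sum>j\<in>supp (e l). if \<phi> j = z then expt (e l) j else 0)"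
    by (rule expt_pushforward) auto
  also have "\<dots> = 0"
    using chain_zero[OF ch, of l] l \<phi> by (intro sum.neutral) auto
  finally show "expt (pushforward \<phi> (e l)) z = 0" .
next
  fix z
  let ?k = "\<kappa> z" and ?A = "supp (e (\<kappa> z)) \<union> supp (e (Suc (\<kappa> z)))"
  have "expt (pushforward \<phi> (e (Suc ?k))) z = (\<Sum>j\<in>?A. if \<phi> j = z then expt (e (Suc ?k)) j else 0)"
    by (rule expt_pushforward) auto
  also have "\<dots> \<le> (\<Sum>j\<in>?A. if \<phi> j = z then expt (e ?k) j else 0)"
    using chain_le[OF ch] \<phi> by (intro sum_mono) force
  also have "\<dots> = expt (pushforward \<phi> (e ?k)) z"
    by (rule expt_pushforward[symmetric]) auto
  finally show "expt (pushforward \<phi> (e (Suc ?k))) z \<le> expt (pushforward \<phi> (e ?k)) z" .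
qed

lemma multiset_image_lift:
  assumes "set_mset Y \<subseteq> f ` E"
  shows "\<exists>X. Y = image_mset f X \<and> set_mset X \<subseteq> E"
  using assms
proof (induction Y)
  case (add y Y)
  then obtain X x where "Y = image_mset f X" "set_mset X \<subseteq> E" "y = f x" "x \<in> E"
    by auto
  then show ?case
    by (intro exI[of _ "add_mset x X"]) simp
qed (auto intro: exI[of _ "{#}"])

lemma power_mons_pushforward:
  assumes "m \<in> power_mons E t"
  shows "pushforward \<phi> m \<in> power_mons (pushforward \<phi> ` E) t"
proof -
  obtain X v where X: "m = \<Sum>\<^sub># X + v" "set_mset X \<subseteq> E" "size X = t"
    using assms unfolding power_mons_def by blast
  then have "pushforward \<phi> m = \<Sum>\<^sub># (image_mset (pushforward \<phi>) X) + pushforward \<phi> v"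
    "set_mset (image_mset (pushforward \<phi>) X) \<subseteq> pushforward \<phi> ` E" "size (image_mset (pushforward \<phi>) X) = t"
    by (auto simp: pushforward_add pushforward_sum_mset)
  then show ?thesis
    unfolding power_mons_def by blast
qed

text \<open>
  The substitution \<open>x\<^sub>j \<mapsto> x\<^bsub>\<tau> j\<^esub>\<close> has kernel generated by the differences \<open>x\<^sub>j - x\<^bsub>\<tau> j\<^esub>\<close>. So a
  polynomial lies in \<open>J\<close> plus these differences exactly if its image lies in the substituted monomial
  ideal, and the quotient by some of the differences can be treated as a quotient by a monomial
  ideal again.
\<close>

lemma foldl_adjoin_differences:
  fixes V :: "nat set" and xs :: "nat list"
  assumes E: "\<And>u. u \<in> E \<Longrightarrow> supp u \<subseteq> V"
    and xs: "set xs \<subseteq> V" "\<tau> ` set xs \<subseteq> V - set xs"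
  defines "\<phi> \<equiv> \<lambda>j. if j \<in> set xs then \<tau> j else j"
  shows "p \<in> foldl (polys.adjoin V) (mon_ideal V (power_mons E t)) (map (\<lambda>j. Var j - Var (\<tau> j)) xs)
    \<longleftrightarrow> (p :: 'k::field mpoly) \<in> polys V \<and> substitute \<phi> p \<in> mon_ideal V (power_mons (pushforward \<phi> ` E) t)"
    (is "p \<in> ?N \<longleftrightarrow> _")
proof -
  let ?J = "mon_ideal V (power_mons E t) :: 'k mpoly set"
    and ?J' = "mon_ideal V (power_mons (pushforward \<phi> ` E) t) :: 'k mpoly set"
    and ?h = "\<lambda>j. Var j - Var (\<tau> j) :: 'k mpoly"
  have J: "polys.subideal V ?J" and J': "polys.subideal V ?J'"
    by (rule subideal_mon_ideal[OF upset_power_mons])+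
  have Var: "Var z \<in> polys V" if "z \<in> V" for z
    using that by (simp add: Var_eq pmon_in_polys supp_unit)
  have h: "set (map ?h xs) \<subseteq> polys V"
    using xs by (auto intro!: polys.minus_closed Var)
  note N = polys.subideal_foldl_adjoin[OF J h]
  have JN: "?J \<subseteq> ?N"
    by (rule subset_foldl_adjoin[OF J h])
  have \<phi>V: "\<phi> ` V \<subseteq> V"
    using xs by (auto simp: \<phi>_def)
  have \<phi>h: "substitute \<phi> (?h j) = 0" if "j \<in> set xs" for j
  proof -
    have "\<phi> j = \<tau> j" "\<phi> (\<tau> j) = \<tau> j"
      using that xs(2) by (auto simp: \<phi>_def)
    then show ?thesis
      by (simp add: substitute_diff substitute_Var)
  qed
  have hN: "?h j * q \<in> ?N" if j: "j \<in> set xs" and q: "q \<in> polys V" for j q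
  proof -
    obtain i where i: "i < length xs" "xs ! i = j"
      using j by (auto simp: in_set_conv_nth)
    have "(\<Sum>l<length (map ?h xs). map ?h xs ! l * (if l = i then q else 0)) =
        (\<Sum>l<length xs. if l = i then ?h j * q else 0)"
      by (rule sum.cong) (auto simp: i)
    also have "\<dots> = ?h j * q"
      using i(1) by simp
    finally have "?h j * q = 0 + (\<Sum>l<length (map ?h xs). map ?h xs ! l * (if l = i then q else 0))"
      by simp
    then show ?thesis
      unfolding polys.mem_foldl_adjoin
      by (intro bexI[OF _ polys.subideal_zero[OF J]] exI[of _ "\<lambda>l. if l = i then q else 0"])
        (auto intro: q polys.zero_closed)
  qed
  have mono_diff: "pmon m c - pmon (pushforward \<phi> m) c \<in> ?N" if "supp m \<subseteq> V" for m c
    using that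
  proof (induction m rule: expo_induct)
    case zero
    then show ?case
      by (simp add: polys.subideal_zero[OF N])
  next
    case (add_unit m z)
    then have z: "z \<in> V" and m: "supp m \<subseteq> V"
      by (auto simp: supp_plus supp_unit)
    have "pushforward \<phi> (m + unit_exp z) = pushforward \<phi> m + unit_exp (\<phi> z)"
      by (simp add: pushforward_add unit_exp_def)
    then have eq: "pmon (m + unit_exp z) c - pmon (pushforward \<phi> (m + unit_exp z)) c =
        Var z * (pmon m c - pmon (pushforward \<phi> m) c) + (Var z - Var (\<phi> z)) * pmon (pushforward \<phi> m) c"
      by (simp add: Var_eq right_diff_distrib left_diff_distrib mult_single add.commute)
    have A: "Var z * (pmon m c - pmon (pushforward \<phi> m) c) \<in> ?N"
      using add_unit.IH[OF m] Var[OF z] by (intro polys.subideal_mult[OF N])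
    have B: "(Var z - Var (\<phi> z)) * pmon (pushforward \<phi> m) c \<in> ?N"
    proof (cases "z \<in> set xs")
      case True
      have "supp (pushforward \<phi> m) \<subseteq> V"
        using keys_pushforward[of \<phi> m] m \<phi>V by blast
      then show ?thesis
        using hN[OF True pmon_in_polys] True by (simp add: \<phi>_def)
    qed (simp add: \<phi>_def polys.subideal_zero[OF N])
    show ?case
      unfolding eq by (rule polys.subideal_add[OF N A B])
  qed
  have sub_diff: "q - substitute \<phi> q \<in> ?N" if "q \<in> polys V" for q
  proof -
    have "q - substitute \<phi> q = (\<Sum>m\<in>mons q. pmon m (coef q m) - pmon (pushforward \<phi> m) (coef q m))"
      unfolding substitute_def pushforward_def[of "pushforward \<phi>"] sum_subtractf
      by (simp flip: poly_as_sum)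
    also have "\<dots> \<in> ?N"
      using that by (intro polys.subideal_sum[OF N] mono_diff) (auto simp: polys_def)
    finally show ?thesis .
  qed
  have J'N: "q \<in> ?N" if q: "q \<in> ?J'" for q
  proof (subst poly_as_sum, rule polys.subideal_sum[OF N])
    fix m assume m: "m \<in> mons q"
    then obtain Y v where Y: "m = \<Sum>\<^sub># Y + v" "set_mset Y \<subseteq> pushforward \<phi> ` E" "size Y = t"
      using q unfolding mon_ideal_def power_mons_def by blast
    obtain X where X: "Y = image_mset (pushforward \<phi>) X" "set_mset X \<subseteq> E"
      using multiset_image_lift[OF Y(2)] by blast
    have "supp m \<subseteq> V"
      using m q unfolding mon_ideal_def polys_def by blast
    then have v: "supp v \<subseteq> V"
      by (simp add: Y(1) supp_plus)
    have XV: "supp (\<Sum>\<^sub># X) \<subseteq> V"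
      using X(2) E by (induction X) (auto simp: supp_plus)
    have "pmon (\<Sum>\<^sub># X) 1 \<in> ?J"
      using XV Y(3) X power_mons_dvd[of X E t "\<Sum>\<^sub># X"]
      by (simp add: mon_ideal_def pmon_in_polys exp_dvd_def)
    then have "pmon (\<Sum>\<^sub># X) 1 \<in> ?N"
      using JN by blast
    from polys.subideal_minus[OF N this mono_diff[OF XV, of 1]]
    have "pmon (pushforward \<phi> (\<Sum>\<^sub># X)) 1 \<in> ?N"
      by simp
    then have "pmon v (coef q m) * pmon (pushforward \<phi> (\<Sum>\<^sub># X)) 1 \<in> ?N"
      by (intro polys.subideal_mult[OF N] pmon_in_polys v)
    then show "pmon m (coef q m) \<in> ?N"
      by (simp add: mult_single Y(1) X(1) pushforward_sum_mset add.commute)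
  qed
  show ?thesis
  proof
    assume p: "p \<in> ?N"
    then obtain x y where x: "x \<in> ?J"
      "p = x + (\<Sum>i<length (map ?h xs). map ?h xs ! i * y i)"
      unfolding polys.mem_foldl_adjoin by blast
    have "substitute \<phi> p = substitute \<phi> x + (\<Sum>i<length xs. substitute \<phi> (?h (xs ! i) * y i))"
      unfolding x(2) by (simp add: substitute_add substitute_sum)
    also have "(\<Sum>i<length xs. substitute \<phi> (?h (xs ! i) * y i)) = 0"
      by (intro sum.neutral) (simp add: substitute_mult \<phi>h)
    finally have "substitute \<phi> p = substitute \<phi> x"
      by simp
    moreover have "substitute \<phi> x \<in> ?J'"
      using x(1) substitute_in_polys[OF _ \<phi>V] mons_substitute[of \<phi> x] power_mons_pushforward
      unfolding mon_ideal_def by blast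
    ultimately show "p \<in> polys V \<and> substitute \<phi> p \<in> ?J'"
      using polys.subideal_sub[OF N p] by simp
  next
    assume p: "p \<in> polys V \<and> substitute \<phi> p \<in> ?J'"
    then have "(p - substitute \<phi> p) + substitute \<phi> p \<in> ?N"
      using polys.subideal_add[OF N sub_diff J'N] by blast
    then show "p \<in> ?N" by simp
  qed
qed

text \<open>
  After the substitution that belongs to the earlier differences, the next one is still a difference of
  two variables with the same \<open>\<kappa>\<close>, and the substituted generators still form a chain.
\<close>

theorem differences_weakly_regular:
  fixes V :: "nat set" and xs :: "nat list" and s :: nat
  assumes ch: "chain \<kappa> e" and E: "\<And>l. l \<in> {1..s} \<Longrightarrow> supp (e l) \<subseteq> V"
    and xs: "distinct xs" "set xs \<subseteq> V" "\<tau> ` set xs \<subseteq> V - set xs"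
    and \<kappa>: "\<And>j. j \<in> set xs \<Longrightarrow> \<kappa> (\<tau> j) = \<kappa> j"
  shows "polys.weakly_regular V (mon_ideal V (power_mons (e ` {1..s}) t) :: 'k::field mpoly set)
    (map (\<lambda>j. Var j - Var (\<tau> j)) xs)"
  unfolding polys.weakly_regular_iff length_map
proof (intro allI impI ballI)
  fix i and p :: "'k mpoly"
  let ?h = "\<lambda>j. Var j - Var (\<tau> j) :: 'k mpoly" and ?J = "mon_ideal V (power_mons (e ` {1..s}) t) :: 'k mpoly set"
  assume i: "i < length xs" and p: "p \<in> polys V"
    and "map ?h xs ! i * p \<in> foldl (polys.adjoin V) ?J (take i (map ?h xs))"
  then have hp: "?h (xs ! i) * p \<in> foldl (polys.adjoin V) ?J (map ?h (take i xs))"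
    by (simp add: take_map)
  define \<phi> where "\<phi> = (\<lambda>j. if j \<in> set (take i xs) then \<tau> j else j)"
  have tk: "set (take i xs) \<subseteq> V" "\<tau> ` set (take i xs) \<subseteq> V - set (take i xs)"
    using xs(2,3) set_take_subset[of i xs] by blast+
  have E': "supp u \<subseteq> V" if "u \<in> e ` {1..s}" for u
    using E that by blast
  have char: "q \<in> foldl (polys.adjoin V) ?J (map ?h (take i xs)) \<longleftrightarrow> q \<in> polys V \<and>
      substitute \<phi> q \<in> mon_ideal V (power_mons (pushforward \<phi> ` (e ` {1..s})) t)" for q
    unfolding \<phi>_def by (rule foldl_adjoin_differences[OF _ tk]) (rule E')
  define x where "x = xs ! i"
  define y where "y = \<tau> x"
  have x: "x \<in> set xs" "x \<notin> set (take i xs)"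
    using i xs(1) by (auto simp: x_def set_conv_nth nth_eq_iff_index_eq)
  then have y: "y \<in> V" "y \<notin> set xs" "x \<in> V"
    using xs(2,3) by (auto simp: y_def)
  have "y \<notin> set (take i xs)"
    using y(2) set_take_subset[of i xs] by blast
  then have fixed: "\<phi> x = x" "\<phi> y = y"
    using x(2) by (simp_all add: \<phi>_def)
  have ch': "chain \<kappa> (\<lambda>l. pushforward \<phi> (e l))"
    using \<kappa> set_take_subset[of i xs] by (intro chain_pushforward[OF ch]) (auto simp: \<phi>_def)
  let ?U = "power_mons ((\<lambda>l. pushforward \<phi> (e l)) ` {1..s}) t"
  have "substitute \<phi> (?h x) = ?h x"
    using fixed by (simp add: substitute_diff substitute_Var flip: y_def)
  then have mult: "(Var x - Var y) * substitute \<phi> p \<in> mon_ideal V ?U"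
    using hp unfolding x_def[symmetric] char substitute_mult by (simp add: image_image y_def)
  have sp: "substitute \<phi> p \<in> polys V"
    using tk by (intro substitute_in_polys[OF p]) (auto simp: \<phi>_def)
  have crit: "w \<in> ?U" if "w + unit_exp x \<in> ?U" "w + unit_exp y \<in> ?U" for w
    by (rule chain_no_socle[OF ch' _ _ that]) (use \<kappa>[OF x(1)] x(1) y(2) in \<open>auto simp: y_def\<close>)
  have "x \<noteq> y"
    using x(1) y(2) by blast
  have "substitute \<phi> p \<in> mon_ideal V ?U"
    by (rule difference_nonzerodivisor[OF upset_power_mons _ \<open>x \<noteq> y\<close> y(3,1) sp mult]) (rule crit)
  then show "p \<in> foldl (polys.adjoin V) ?J (take i (map ?h xs))"
    unfolding take_map char using p by (simp add: image_image)
qed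

section \<open>The maximal ideal\<close>

lemma max_ideal_eq:
  "(max_ideal n :: 'k::field mpoly set) = mon_ideal {1..n} (power_mons (unit_exp ` {1..n}) 1)"
proof -
  have "Var ` {1..n} = (\<lambda>u. pmon u (1::'k)) ` unit_exp ` {1..n}"
    by (auto simp: Var_eq image_image)
  then show ?thesis
    unfolding max_ideal_def by (simp only:) (rule genideal_monomials, auto simp: supp_unit)
qed

lemma subideal_max_ideal: "polys.subideal {1..n} (max_ideal n)"
  unfolding max_ideal_eq by (rule subideal_mon_ideal[OF upset_power_mons])

lemma zero_notin_power_mons_Suc: "0 \<notin> E \<Longrightarrow> 0 \<notin> power_mons E (Suc t)"
proof
  assume "0 \<notin> E" "0 \<in> power_mons E (Suc t)"
  then obtain u m where um: "0 = u + m" "u \<in> E"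
    unfolding power_mons_Suc by blast
  then have "supp u = {}"
    by (metis keys_zero supp_plus sup_eq_bot_iff)
  then show False
    using um(2) \<open>0 \<notin> E\<close> by simp
qed

lemma unit_exp_nonzero: "unit_exp z \<noteq> 0"
  using supp_unit[of z] by force

lemma zero_notin_mons_max_ideal: "f \<in> max_ideal n \<Longrightarrow> 0 \<notin> mons f"
  using zero_notin_power_mons_Suc[of "unit_exp ` {1..n}" 0] unit_exp_nonzero
  unfolding max_ideal_eq mon_ideal_def by force

lemma in_max_idealI:
  assumes "f \<in> polys {1..n}" "0 \<notin> mons f"
  shows "f \<in> max_ideal n"
  unfolding max_ideal_eq mon_ideal_def
proof (intro CollectI conjI subsetI assms(1))
  fix m assume m: "m \<in> mons f"
  then have "m \<noteq> 0"
    using assms(2) by metis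
  then obtain z where z: "z \<in> supp m"
    by (metis keys_eq_empty ex_in_conv)
  then have "z \<in> {1..n}"
    using assms(1) m unfolding polys_def by blast
  have "exp_dvd (unit_exp z) m"
    using z by (auto simp: exp_dvd_def expt_unit in_keys_iff)
  then have "m = unit_exp z + (m - unit_exp z)"
    by (simp add: exp_dvd_split)
  then show "m \<in> power_mons (unit_exp ` {1..n}) 1"
    unfolding One_nat_def power_mons_Suc using \<open>z \<in> {1..n}\<close> by auto
qed

lemma Var_in_max_ideal: "z \<in> {1..n} \<Longrightarrow> Var z \<in> max_ideal n"
  using unit_exp_nonzero[of z] by (intro in_max_idealI) (auto simp: Var_eq supp_unit intro!: pmon_in_polys)

lemma depth_quotient_ge:
  fixes J :: "'k::field mpoly set"
  assumes J: "polys.subideal {1..n} J" "J \<subseteq> max_ideal n" and fs: "set fs \<subseteq> max_ideal n"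
    and reg: "polys.weakly_regular {1..n} J fs"
  shows "enat (length fs) \<le> depth_quotient n J"
proof -
  have fsV: "set fs \<subseteq> polys {1..n}"
    using fs polys.subideal_sub[OF subideal_max_ideal] by blast
  have "1 \<notin> foldl (polys.adjoin {1..n}) J fs"
  proof
    assume "1 \<in> foldl (polys.adjoin {1..n}) J fs"
    then obtain x y where xy: "x \<in> J" "\<forall>i<length fs. y i \<in> polys {1..n}"
      "1 = x + (\<Sum>i<length fs. fs ! i * y i)"
      unfolding polys.mem_foldl_adjoin by blast
    have "fs ! i * y i \<in> max_ideal n" if "i < length fs" for i
      using polys.subideal_mult[OF subideal_max_ideal, of "y i" n "fs ! i"] xy(2) fs that
      by (simp add: mult.commute subset_iff)
    then have "(1::'k mpoly) \<in> max_ideal n"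
      unfolding xy(3) using J(2) xy(1)
      by (intro polys.subideal_add[OF subideal_max_ideal] polys.subideal_sum[OF subideal_max_ideal]) auto
    from zero_notin_mons_max_ideal[OF this] show False by simp
  qed
  then have "foldl (polys.adjoin {1..n}) J fs \<noteq> polys {1..n}"
    using polys.one_closed by blast
  then have "regular_sequence (quotient_module (polynomial_ring n) J) fs"
    using regular_sequence_quot[OF J(1) fsV] reg by blast
  then show ?thesis
    unfolding depth_def using fs by (intro Sup_upper) blast
qed

section \<open>Regular sequences are short\<close>

text \<open>
  Gaussian elimination: one equation removes one unknown, the pivot \<open>b\<close>.
\<close>

lemma homogeneous_system_nontrivial:
  fixes g :: "'a \<Rightarrow> 'b \<Rightarrow> 'k::field"
  assumes "finite T" "finite A" "card T < card A"
  shows "\<exists>c. (\<exists>a\<in>A. c a \<noteq> 0) \<and> (\<forall>t\<in>T. (\<Sum>a\<in>A. c a * g a t) = 0)"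
  using assms
proof (induction T arbitrary: A g rule: finite_induct)
  case empty
  then have "A \<noteq> {}"
    by auto
  then show ?case
    by (intro exI[of _ "\<lambda>_. 1"]) auto
next
  case (insert t T)
  show ?case
  proof (cases "\<forall>a\<in>A. g a t = 0")
    case True
    then show ?thesis
      using insert.IH[of A g] insert.prems insert.hyps by auto
  next
    case False
    then obtain b where b: "b \<in> A" "g b t \<noteq> 0"
      by blast
    let ?A = "A - {b}" and ?g = "\<lambda>a i. g a i - g a t / g b t * g b i"
    have "card T < card ?A"
      using insert b by (simp add: card_Diff_singleton)
    then obtain c where c: "\<exists>a\<in>?A. c a \<noteq> 0" "\<And>i. i \<in> T \<Longrightarrow> (\<Sum>a\<in>?A. c a * ?g a i) = 0"
      using insert.IH[of ?A ?g] insert.prems by auto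
    define cb where "cb = - (\<Sum>a\<in>?A. c a * g a t) / g b t"
    let ?c = "c(b := cb)"
    have sum: "(\<Sum>a\<in>A. ?c a * g a i) = cb * g b i + (\<Sum>a\<in>?A. c a * g a i)" for i
      using b(1) insert.prems(1) by (subst sum.remove[of A b]) (auto intro: sum.cong)
    have "(\<Sum>a\<in>?A. c a * ?g a i) = (\<Sum>a\<in>?A. c a * g a i) + cb * g b i" for i
      unfolding cb_def by (simp add: right_diff_distrib sum_subtractf sum_distrib_right sum_divide_distrib mult.assoc)
    then have "(\<Sum>a\<in>A. ?c a * g a i) = 0" if "i \<in> T" for i
      using c(2)[OF that] sum[of i] by (simp add: add.commute)
    moreover have "(\<Sum>a\<in>A. ?c a * g a t) = 0"
      using sum[of t] b(2) by (simp add: cb_def)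
    ultimately show ?thesis
      using c(1) by (intro exI[of _ ?c]) auto
  qed
qed

lemma power_exceeds_polynomial_growth:
  fixes r d D :: nat
  assumes "d < r"
  shows "\<exists>N\<ge>1. (r * (N * D) + 1) ^ d < N ^ r"
proof -
  define N where "N = (r * D + 1) ^ d + 1"
  have N: "N \<ge> 1"
    by (simp add: N_def)
  have "(r * (N * D) + 1) ^ d \<le> (N * (r * D + 1)) ^ d"
    using N by (intro power_mono) (simp_all add: algebra_simps)
  also have "\<dots> = N ^ d * (r * D + 1) ^ d"
    by (rule power_mult_distrib)
  also have "\<dots> < N ^ d * N"
    using N by (intro mult_strict_left_mono) (simp_all add: N_def)
  also have "\<dots> = N ^ Suc d"
    by simp
  also have "\<dots> \<le> N ^ r"
    using assms N by (intro power_increasing) auto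
  finally show ?thesis
    using N by blast
qed

lemma card_bounded_exponents:
  assumes "finite Z"
  shows "finite {a. supp a \<subseteq> Z \<and> (\<forall>z. expt a z \<le> B)}" (is "finite ?T")
    and "card {a. supp a \<subseteq> Z \<and> (\<forall>z. expt a z \<le> B)} \<le> (B + 1) ^ card Z"
proof -
  let ?P = "Z \<rightarrow>\<^sub>E {..B}" and ?f = "\<lambda>a. restrict (expt a) Z"
  have fin: "finite ?P"
    using assms by (intro finite_PiE) auto
  have inj: "inj_on ?f ?T"
  proof (rule inj_onI, rule poly_mapping_eqI)
    fix a b z assume ab: "a \<in> ?T" "b \<in> ?T" "?f a = ?f b"
    show "expt a z = expt b z"
    proof (cases "z \<in> Z")
      case True
      then show ?thesis
        using fun_cong[OF ab(3), of z] by simp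
    next
      case False
      then have "z \<notin> supp a" "z \<notin> supp b"
        using ab by auto
      then show ?thesis
        by (simp add: in_keys_iff)
    qed
  qed
  have sub: "?f ` ?T \<subseteq> ?P"
    by auto
  show "finite ?T"
    using finite_imageD[OF finite_subset[OF sub fin] inj] .
  have "card ?T \<le> card ?P"
    by (rule card_inj_on_le[OF inj sub fin])
  then show "card ?T \<le> (B + 1) ^ card Z"
    using assms by (simp add: card_PiE)
qed

lemma expt_power_le:
  assumes "\<And>a. a \<in> mons f \<Longrightarrow> expt a z \<le> D"
  shows "a \<in> mons (f ^ i) \<Longrightarrow> expt a z \<le> i * D"
proof (induction i arbitrary: a)
  case (Suc i)
  then obtain b c where "a = b + c" "b \<in> mons f" "c \<in> mons (f ^ i)"
    using mons_mult[of a f "f ^ i"] by auto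
  then show ?case
    using assms[of b] Suc.IH[of c] by (simp add: lookup_add)
qed (simp split: if_splits)

lemma expt_digit_monomial_le:
  assumes N: "N \<ge> 1"
  shows "(\<And>f a. f \<in> set fs \<Longrightarrow> a \<in> mons f \<Longrightarrow> expt a z \<le> D) \<Longrightarrow>
    a \<in> mons (digit_monomial N fs j) \<Longrightarrow> expt a z \<le> length fs * (N * D)"
proof (induction fs arbitrary: a j)
  case (Cons f fs)
  obtain b c where bc: "a = b + c" "b \<in> mons (f ^ (j mod N))" "c \<in> mons (digit_monomial N fs (j div N))"
    using mons_mult[of a "f ^ (j mod N)" "digit_monomial N fs (j div N)"] Cons.prems(2)
    unfolding digit_monomial.simps by blast
  have "expt b z \<le> (j mod N) * D"
    by (rule expt_power_le[OF _ bc(2)]) (use Cons.prems(1) in auto)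
  also have "\<dots> \<le> N * D"
    using N by (intro mult_le_mono1) (simp add: less_imp_le)
  finally have "expt b z \<le> N * D" .
  moreover have "expt c z \<le> length fs * (N * D)"
    using Cons.IH[OF _ bc(3)] Cons.prems(1) by auto
  ultimately show ?case
    by (simp add: bc(1) lookup_add)
qed (simp split: if_splits)

lemma digit_monomial_in_polys: "set fs \<subseteq> polys V \<Longrightarrow> digit_monomial N fs j \<in> polys V"
  by (induction fs arbitrary: j) (auto intro: polys.one_closed polys.mult_closed polys.power_closed)

text \<open>
  The weighted powers of elements without constant term consist of polynomials of growing order, which
  separates any given monomial from them.
\<close>

lemma wpower_degree:
  fixes V :: "nat set" and ws :: "('k::field mpoly \<times> nat) list"
  defines "deg \<equiv> \<lambda>a. \<Sum>z\<in>V. expt a z"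
  shows "B \<ge> 1 \<Longrightarrow> (\<And>fw. fw \<in> set ws \<Longrightarrow> snd fw \<le> B) \<Longrightarrow>
    (\<And>fw a. fw \<in> set ws \<Longrightarrow> a \<in> mons (fst fw) \<Longrightarrow> 1 \<le> deg a) \<Longrightarrow>
    p \<in> wpower U ws k \<Longrightarrow> q * B \<le> k \<Longrightarrow> a \<in> mons p \<Longrightarrow> q \<le> deg a"
proof (induction U ws k arbitrary: p q a rule: wpower.induct)
  case (4 U fw fs k)
  obtain x y where xy: "p = fst fw * x + y" "x \<in> wpower U (fw # fs) (k - (snd fw - 1))"
    "y \<in> wpower U fs (Suc k)"
    using "4.prems"(4) unfolding wpower.simps by blast
  have "a \<in> mons (fst fw * x) \<or> a \<in> mons y"
    using Poly_Mapping.keys_add[of "fst fw * x" y] "4.prems"(6) xy(1) by blast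
  then show ?case
  proof
    assume "a \<in> mons y"
    show ?thesis
    proof (rule "4.IH"(2)[OF "4.prems"(1) _ _ xy(3) "4.prems"(5) \<open>a \<in> mons y\<close>])
      show "snd gw \<le> B" if "gw \<in> set fs" for gw
        using "4.prems"(2)[of gw] that by simp
      show "1 \<le> deg b" if "gw \<in> set fs" "b \<in> mons (fst gw)" for gw b
        using "4.prems"(3)[of gw b] that by simp
    qed
  next
    assume "a \<in> mons (fst fw * x)"
    then obtain b c where bc: "a = b + c" "b \<in> mons (fst fw)" "c \<in> mons x"
      using mons_mult by blast
    have "1 \<le> deg b"
      using "4.prems"(3)[of fw b] bc(2) by simp
    have "deg a = deg b + deg c"
      by (simp add: bc(1) deg_def lookup_add sum.distrib)
    show ?thesis
    proof (cases q)
      case (Suc q')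
      have "snd fw \<le> B"
        using "4.prems"(2) by simp
      then have "q' * B \<le> k - (snd fw - 1)"
        using "4.prems"(1,5) Suc by simp
      then have "q' \<le> deg c"
        using "4.IH"(1)[OF "4.prems"(1) "4.prems"(2,3) xy(2) _ bc(3)] by simp
      then show ?thesis
        using \<open>1 \<le> deg b\<close> \<open>deg a = deg b + deg c\<close> Suc by simp
    qed simp
  qed
qed auto

text \<open>
  If the sequence had more than \<open>d = n - |P|\<close> elements, there would be more monomials in it with
  exponents below \<open>N\<close> than monomials of bounded degree in the \<open>d\<close> variables outside \<open>P\<close>. Hence
  some nontrivial linear combination \<open>G\<close> has only monomials that involve \<open>P\<close>, and \<open>G x\<^sup>m \<in> J\<close>. This
  contradicts \<open>digit_monomials_independent\<close>.
\<close>

theorem depth_le_of_socle: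
  fixes U :: "expo set"
  assumes U: "upset U" and m: "supp m \<subseteq> {1..n}" "m \<notin> U"
    and P: "P \<subseteq> {1..n}" "\<And>z. z \<in> P \<Longrightarrow> m + unit_exp z \<in> U"
  shows "depth_quotient n (mon_ideal {1..n} U :: 'k::field mpoly set) \<le> enat (n - card P)"
  unfolding depth_def
proof (rule Sup_least)
  define V where "V = {1..n}"
  define J :: "'k mpoly set" where "J = mon_ideal V U"
  have J: "polys.subideal V J"
    unfolding J_def by (rule subideal_mon_ideal[OF U])
  fix l assume "l \<in> {enat (length fs) |fs. set fs \<subseteq> max_ideal n \<and>
    regular_sequence (quotient_module (polynomial_ring n) (mon_ideal {1..n} U :: 'k mpoly set)) fs}"
  then obtain fs where l: "l = enat (length fs)" and fsm: "set fs \<subseteq> max_ideal n"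
    and "regular_sequence (quotient_module (mpoly_ring V) J) fs"
    unfolding V_def J_def by blast
  moreover have fsV: "set fs \<subseteq> polys V"
    using fsm polys.subideal_sub[OF subideal_max_ideal] unfolding V_def by blast
  ultimately have reg: "polys.weakly_regular V J fs"
    using regular_sequence_quot[OF J] by blast
  let ?r = "length fs" and ?Z = "V - P" and ?y = "pmon m (1::'k)"
  have cZ: "card ?Z = n - card P"
    using P(1) by (simp add: V_def card_Diff_subset finite_subset)
  show "l \<le> enat (n - card P)"
  proof (rule ccontr)
    assume "\<not> l \<le> enat (n - card P)"
    then have r: "card ?Z < ?r"
      by (simp add: l cZ)
    \<comment> \<open>a bound for all exponents in the sequence\<close>
    define D where "D = (\<Sum>f\<in>set fs. \<Sum>a\<in>mons f. \<Sum>z\<in>V. expt a z)"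
    have D: "expt a z \<le> D" if fa: "f \<in> set fs" "a \<in> mons f" for f a z
    proof (cases "z \<in> V")
      case True
      have "expt a z \<le> (\<Sum>z\<in>V. expt a z)"
        using True by (intro member_le_sum) (auto simp: V_def)
      also have "\<dots> \<le> (\<Sum>a\<in>mons f. \<Sum>z\<in>V. expt a z)"
        using fa(2) by (intro member_le_sum[of a]) auto
      also have "\<dots> \<le> D"
        unfolding D_def using fa(1) by (intro member_le_sum[of f]) auto
      finally show ?thesis .
    next
      case False
      then have "z \<notin> supp a"
        using fa fsV unfolding polys_def by blast
      then show ?thesis
        by (simp add: in_keys_iff)
    qed
    obtain N where N: "N \<ge> 1" "(?r * (N * D) + 1) ^ card ?Z < N ^ ?r"
      using power_exceeds_polynomial_growth[OF r] by blast
    let ?T = "{a. supp a \<subseteq> ?Z \<and> (\<forall>z. expt a z \<le> ?r * (N * D))}" and ?M = "digit_monomial N fs"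
    have finZ: "finite ?Z"
      by (simp add: V_def)
    have "card ?T < card {..<N ^ ?r}"
      using card_bounded_exponents(2)[OF finZ, of "?r * (N * D)"] N(2) by simp
    then obtain c where c: "\<exists>j\<in>{..<N ^ ?r}. c j \<noteq> 0"
      "\<And>a. a \<in> ?T \<Longrightarrow> (\<Sum>j<N ^ ?r. c j * coef (?M j) a) = 0"
      using homogeneous_system_nontrivial[OF card_bounded_exponents(1)[OF finZ], of "{..<N ^ ?r}" _ "\<lambda>j. coef (?M j)"]
      by blast
    define G where "G = (\<Sum>j<N ^ ?r. pmon 0 (c j) * ?M j)"
    have Gc: "coef G a = (\<Sum>j<N ^ ?r. c j * coef (?M j) a)" for a
    proof -
      have "coef (pmon 0 k * p) a = k * coef p a" for k and p :: "'k mpoly"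
        using coef_single_mult[of 0 k p a] by simp
      then show ?thesis
        by (simp add: G_def lookup_sum)
    qed
    have cV: "pmon 0 (c j) \<in> polys V" for j
      by (simp add: pmon_in_polys)
    have GV: "G \<in> polys V"
      unfolding G_def by (intro polys.sum_closed polys.mult_closed cV digit_monomial_in_polys fsV)
    have yV: "?y \<in> polys V"
      using m(1) by (simp add: V_def pmon_in_polys)
    have dep: "G * ?y \<in> J"
      unfolding J_def mon_ideal_def
    proof (intro CollectI conjI subsetI polys.mult_closed GV yV)
      fix w assume "w \<in> mons (G * ?y)"
      then obtain g where g: "g \<in> mons G" "w = m + g"
        by (auto dest!: mons_mult simp: add.commute split: if_splits)
      have "supp g \<inter> P \<noteq> {}"
      proof
        assume "supp g \<inter> P = {}"
        then have gZ: "supp g \<subseteq> ?Z"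
          using g(1) GV unfolding polys_def by blast
        have "(\<Sum>j<N ^ ?r. c j * coef (?M j) g) \<noteq> 0"
          using g(1) by (simp add: in_keys_iff flip: Gc)
        then obtain j where "c j * coef (?M j) g \<noteq> 0"
          by (meson sum.neutral)
        then have gj: "g \<in> mons (?M j)"
          by (simp add: in_keys_iff)
        have "expt g z \<le> ?r * (N * D)" for z
          by (rule expt_digit_monomial_le[OF N(1) _ gj]) (rule D)
        then have "g \<in> ?T"
          using gZ by blast
        from c(2)[OF this] show False
          using \<open>(\<Sum>j<N ^ ?r. c j * coef (?M j) g) \<noteq> 0\<close> by simp
      qed
      then obtain z where z: "z \<in> supp g" "z \<in> P"
        by blast
      have "exp_dvd (unit_exp z) g"
        using z(1) by (auto simp: exp_dvd_def expt_unit in_keys_iff)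
      then have "g = unit_exp z + (g - unit_exp z)"
        by (simp add: exp_dvd_split)
      then have "w = (m + unit_exp z) + (g - unit_exp z)"
        unfolding g(2) by (metis add.assoc)
      then show "w \<in> U"
        using U P(2)[OF z(2)] unfolding upset_def by metis
    qed
    let ?ws = "digit_weights N 1 fs"
    \<comment> \<open>\<open>B\<close> bounds the weights, so step \<open>q B\<close> consists of polynomials of order at least \<open>q\<close>\<close>
    define B where "B = Suc (sum_list (map snd ?ws))"
    define q where "q = Suc (\<Sum>z\<in>V. expt m z)"
    have sep: "?y \<notin> polys.filt V J ?ws (q * B)"
    proof
      assume "?y \<in> polys.filt V J ?ws (q * B)"
      then obtain x j where x: "x \<in> wpower (polys V) ?ws (q * B)" "j \<in> J" "?y = x + j"
        unfolding polys.filt_iff by blast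
      have "coef j m = 0"
        using x(2) m(2) unfolding J_def mon_ideal_def by (auto simp: in_keys_iff)
      moreover have "coef ?y m = coef x m + coef j m"
        by (simp only: x(3) lookup_add)
      ultimately have mx: "m \<in> mons x"
        by (simp add: in_keys_iff)
      have "q \<le> (\<Sum>z\<in>V. expt m z)"
      proof (rule wpower_degree[OF _ _ _ x(1) order.refl mx])
        show "snd fw \<le> B" if "fw \<in> set ?ws" for fw
          using member_le_sum_list[of "snd fw" "map snd ?ws"] that by (simp add: B_def)
        show "1 \<le> (\<Sum>z\<in>V. expt a z)" if fw: "fw \<in> set ?ws" and a: "a \<in> mons (fst fw)" for fw a
        proof -
          have f: "fst fw \<in> set fs"
            using fw map_fst_digit_weights[of N 1 fs] by (metis image_eqI set_map)
          then have "a \<noteq> 0"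
            using a zero_notin_mons_max_ideal fsm by blast
          then obtain z where z: "z \<in> supp a"
            by (metis keys_eq_empty ex_in_conv)
          then have "z \<in> V"
            using f fsV a unfolding polys_def by blast
          then have "expt a z \<le> (\<Sum>z\<in>V. expt a z)"
            by (intro member_le_sum) (auto simp: V_def)
          moreover have "1 \<le> expt a z"
            using z by (simp add: in_keys_iff)
          ultimately show ?thesis
            by linarith
        qed
      qed (simp add: B_def)
      then show False
        by (simp add: q_def)
    qed
    obtain j where j: "j < N ^ ?r" "c j \<noteq> 0"
      using c(1) by blast
    have "pmon 0 (c j) = 0"
    proof (rule polys.digit_monomials_independent[OF J fsV reg N(1) yV sep, where c = "\<lambda>j. pmon 0 (c j)"])
      show "\<exists>d\<in>polys V. d * pmon 0 (c i) = 1" if "pmon 0 (c i) \<noteq> 0" for i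
      proof (rule bexI)
        have "c i \<noteq> 0"
          using that by auto
        then show "pmon 0 (inverse (c i)) * pmon 0 (c i) = 1"
          by (simp add: mult_single)
      qed (simp add: pmon_in_polys)
      have "(\<Sum>j<N ^ ?r. pmon 0 (c j) * (?M j * ?y)) = G * ?y"
        by (simp add: G_def sum_distrib_right mult.assoc)
      then show "(\<Sum>j<N ^ ?r. pmon 0 (c j) * (?M j * ?y)) \<in> J"
        using dep by simp
    qed (use cV j(1) in auto)
    then show False
      using j(2) by (metis lookup_single_eq lookup_zero)
  qed
qed

section \<open>Interval ideals\<close>

lemma expt_sum_unit: "finite A \<Longrightarrow> expt (\<Sum>j\<in>A. unit_exp j) z = (if z \<in> A then 1 else 0)"
  by (simp add: lookup_sum expt_unit)

lemma pmon_sum_unit: "pmon (\<Sum>j\<in>A. unit_exp j) (1::'k::field) = (\<Prod>j\<in>A. Var j)"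
proof -
  have "pmon (u + v) (1::'k) = pmon u 1 * pmon v 1" for u v
    by (simp add: mult_single)
  then show ?thesis
    by (induction A rule: infinite_finite_induct) (simp_all add: Var_eq)
qed

lemma max_ideal_mon_ideal:
  assumes "0 \<notin> E"
  shows "(mon_ideal {1..n} (power_mons E (Suc t)) :: 'k::field mpoly set) \<subseteq> max_ideal n"
  using zero_notin_power_mons_Suc[OF assms] by (auto simp: mon_ideal_def intro!: in_max_idealI)

text \<open>
  Without generators there is no private variable to subtract. The sequence starts with \<open>x\<^sub>1\<close> and
  continues with the differences \<open>x\<^sub>j - x\<^sub>1\<close>, which are regular modulo \<open>x\<^sub>1\<close>: this is the chain with the
  single monomial \<open>x\<^sub>1\<close>.
\<close>

lemma depth_zero_ideal_ge:
  assumes "n \<ge> 1"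
  shows "enat n \<le> depth_quotient n (mon_ideal {1..n} {} :: 'k::field mpoly set)"
proof -
  define V where "V = {1..n}"
  let ?J = "mon_ideal V {} :: 'k mpoly set"
  let ?e = "\<lambda>l::nat. if l = 1 then unit_exp 1 else 0" and ?h = "\<lambda>j. Var j - Var 1 :: 'k mpoly"
  let ?fs = "Var 1 # map ?h [2..<Suc n]"
  have one: "1 \<in> V"
    using assms by (simp add: V_def)
  have J0: "?J = {0}"
    by (auto simp: mon_ideal_def polys.zero_closed)
  have J: "polys.subideal V ?J"
    unfolding J0 by (rule polys.subideal_singleton_zero)
  have pw: "power_mons (?e ` {1..1}) 1 = {unit_exp 1 + m | m. True}"
    unfolding One_nat_def power_mons_Suc by auto
  have VarV: "Var 1 \<in> polys V"
    using one by (simp add: Var_eq supp_unit pmon_in_polys)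
  have adj: "polys.adjoin V ?J (Var 1) = mon_ideal V (power_mons (?e ` {1..1}) 1)"
  proof (intro equalityI subsetI)
    fix p :: "'k mpoly" assume "p \<in> polys.adjoin V ?J (Var 1)"
    then obtain q where q: "q \<in> polys V" "p = Var 1 * q"
      unfolding polys.adjoin_iff J0 by auto
    have "m \<in> power_mons (?e ` {1..1}) 1" if "m \<in> mons p" for m
      using that unfolding q(2) pw Var_eq by (auto dest!: mons_mult)
    then show "p \<in> mon_ideal V (power_mons (?e ` {1..1}) 1)"
      using polys.mult_closed[OF VarV q(1)] unfolding mon_ideal_def q(2) by blast
  next
    fix p :: "'k mpoly" assume p: "p \<in> mon_ideal V (power_mons (?e ` {1..1}) 1)"
    have "mons p \<subseteq> cell (unit_exp 1) V"
    proof
      fix w assume w: "w \<in> mons p"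
      then obtain m where m: "w = unit_exp 1 + m"
        using p unfolding mon_ideal_def pw by blast
      have "supp w \<subseteq> V"
        using p w unfolding mon_ideal_def polys_def by blast
      then show "w \<in> cell (unit_exp 1) V"
        unfolding cell_def m by (auto simp: supp_plus)
    qed
    then obtain q where "q \<in> polys V" "p = q * pmon (unit_exp 1) 1"
      by (rule poly_in_cell)
    then show "p \<in> polys.adjoin V ?J (Var 1)"
      unfolding polys.adjoin_iff J0 Var_eq by (auto simp: mult.commute)
  qed
  have nzd: "x = 0" if "Var 1 * x = 0" for x :: "'k mpoly"
  proof (rule poly_mapping_eqI)
    fix k
    have "coef x k = coef (pmon (unit_exp 1) 1 * x) (unit_exp 1 + k)"
      by (simp only: coef_single_mult mult_1)
    also have "\<dots> = coef 0 k"
      using that by (simp only: Var_eq lookup_zero)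
    finally show "coef x k = coef 0 k" .
  qed
  have tail: "polys.weakly_regular V (polys.adjoin V ?J (Var 1)) (map ?h [2..<Suc n])"
    unfolding adj
    by (rule differences_weakly_regular[where \<kappa> = "\<lambda>_. 1"])
      (use one in \<open>auto simp: chain_def supp_unit V_def\<close>)
  have "\<forall>x\<in>polys V. Var 1 * x \<in> ?J \<longrightarrow> x \<in> ?J"
    unfolding J0 using nzd by blast
  then have reg: "polys.weakly_regular V ?J ?fs"
    unfolding polys.weakly_regular.simps using tail by blast
  have Jm: "?J \<subseteq> max_ideal n"
    using polys.subideal_zero[OF subideal_max_ideal] by (simp add: J0)
  have fsm: "set ?fs \<subseteq> max_ideal n"
    using one by (auto simp: V_def intro!: Var_in_max_ideal polys.subideal_minus[OF subideal_max_ideal])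
  have "enat (length ?fs) \<le> depth_quotient n ?J"
    using J Jm fsm reg unfolding V_def by (rule depth_quotient_ge)
  moreover have "length ?fs = n"
    using assms by (simp del: upt_Suc)
  ultimately show ?thesis
    by (simp only: V_def)
qed

theorem theorem1p10:
  fixes n s :: nat and a b :: "nat \<Rightarrow> nat" and I :: "('k::field mpoly) set"
  assumes "n \<ge> 1" and "s \<le> n"
    and "strict_mono_on {1..s} a" and "strict_mono_on {1..s} b"
    and "s \<ge> 1 \<Longrightarrow> 1 \<le> a 1" and "s \<ge> 1 \<Longrightarrow> b s \<le> n"
    and "\<And>i. i \<in> {1..s} \<Longrightarrow> a i \<le> b i"
    and "I = interval_ideal n s a b"
    and "\<And>k. 1 \<le> k \<Longrightarrow> k + 2 \<le> s \<Longrightarrow> a (k + 2) > b k + 1"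
  shows "\<forall>t \<ge> 1. sdepth_quotient n (ideal_power n I t) = depth_quotient n (ideal_power n I t)
    \<and> depth_quotient n (ideal_power n I t) = enat (n - s)"
proof (intro allI impI)
  fix t :: nat assume "t \<ge> 1"
  then obtain t' where t: "t = Suc t'"
    by (cases t) auto
  define V where "V = {1..n}"
  have amono: "a k < a l" if "k \<in> {1..s}" "l \<in> {1..s}" "k < l" for k l
    using assms(3) that by (rule strict_mono_onD)
  have bmono: "b k < b l" if "k \<in> {1..s}" "l \<in> {1..s}" "k < l" for k l
    using assms(4) that by (rule strict_mono_onD)
  define e where "e l = (if l \<in> {1..s} then \<Sum>j\<in>{a l..b l}. unit_exp j else 0)" for l
  have e: "expt (e l) z = (if l \<in> {1..s} \<and> z \<in> {a l..b l} then 1 else 0)" for l z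
    by (simp add: e_def expt_sum_unit)
  \<comment> \<open>the first variable of interval \<open>k\<close> beyond interval \<open>k - 1\<close>; it precedes interval \<open>k + 1\<close> by the gap condition\<close>
  define c where "c k = (if k = 1 then a 1 else max (a k) (b (k - 1) + 1))" for k
  have c_in: "c k \<in> {a k..b k}" if k: "k \<in> {1..s}" for k
  proof (cases "k = 1")
    case False
    then have "b (k - 1) < b k"
      using k by (intro bmono) auto
    then show ?thesis
      using assms(7)[OF k] False by (simp add: c_def)
  qed (use assms(7)[OF k] in \<open>simp add: c_def\<close>)
  have c_private: "l = k" if k: "k \<in> {1..s}" and l: "l \<in> {1..s}" and cl: "c k \<in> {a l..b l}" for k l
  proof (rule ccontr)
    assume "l \<noteq> k"
    then consider "l < k" | "k < l"
      by linarith
    then show False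
    proof cases
      case 1
      have "b l \<le> b (k - 1)"
      proof (cases "l = k - 1")
        case False
        then have "l < k - 1" "k - 1 \<in> {1..s}"
          using 1 k l by auto
        then show ?thesis
          using bmono[OF l, of "k - 1"] by simp
      qed simp
      then show False
        using 1 cl l by (simp add: c_def split: if_splits)
    next
      case 2
      then have "a (Suc k) \<le> a l"
        using amono[of "Suc k" l] k l by (cases "l = Suc k") auto
      moreover have "c k < a (Suc k)"
        using amono[of k "Suc k"] assms(9)[of "k - 1"] k l 2 by (auto simp: c_def)
      ultimately show False
        using cl by simp
    qed
  qed
  have priv: "expt (e l) (c k) = (if l = k then 1 else 0)" if "k \<in> {1..s}" "l \<in> {1..s}" for k l
    using c_in[OF that(1)] c_private[OF that] that by (auto simp: e)
  have V: "supp (e l) \<subseteq> V" if l: "l \<in> {1..s}" for l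
  proof
    fix z assume "z \<in> supp (e l)"
    then have "z \<in> {a l..b l}"
      by (simp add: in_keys_iff e split: if_splits)
    moreover have "1 \<le> a l"
      using amono[of 1 l] assms(5) l by (cases "l = 1") auto
    moreover have "b l \<le> n"
      using bmono[of l s] assms(6) l by (cases "l = s") auto
    ultimately show "z \<in> V"
      by (simp add: V_def)
  qed
  have finV: "finite V"
    by (simp add: V_def)
  have cV: "c ` {1..s} \<subseteq> V"
  proof
    fix z assume "z \<in> c ` {1..s}"
    then obtain k where k: "k \<in> {1..s}" "z = c k"
      by blast
    have "c k \<in> supp (e k)"
      using c_in[OF k(1)] k(1) by (simp add: in_keys_iff e)
    then show "z \<in> V"
      using V[OF k(1)] k(2) by blast
  qed
  have c_inj: "inj_on c {1..s}"
    using c_in c_private by (intro inj_onI) metis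
  then have card_c: "card (c ` {1..s}) = s"
    by (simp add: card_image)
  define hit where "hit z k \<longleftrightarrow> k \<in> {1..s} \<and> z \<in> {a k..b k}" for z k
  \<comment> \<open>the first interval through \<open>z\<close>; the default \<open>1\<close> for variables in no interval makes \<open>c (\<kappa> z)\<close> meaningful\<close>
  define \<kappa> where "\<kappa> z = (if \<exists>k. hit z k then LEAST k. hit z k else 1)" for z
  have hit_zero: "expt (e l) z = (if hit z l then 1 else 0)" for l z
    by (simp add: e hit_def)
  have \<kappa>_hit: "hit z (\<kappa> z)" "\<kappa> z \<le> k" if "hit z k" for z k
    using that LeastI[of "hit z" k] Least_le[of "hit z" k] by (auto simp: \<kappa>_def)
  have ch: "chain \<kappa> e"
    unfolding chain_def
  proof (intro allI conjI impI)
    fix z l assume l: "l \<noteq> \<kappa> z" "l \<noteq> Suc (\<kappa> z)"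
    have "\<not> hit z l"
    proof
      assume h: "hit z l"
      then have far: "\<kappa> z + 2 \<le> l"
        using \<kappa>_hit(2)[OF h] l by simp
      have k: "\<kappa> z \<in> {1..s}" "z \<le> b (\<kappa> z)" and l: "l \<in> {1..s}" "a l \<le> z"
        using \<kappa>_hit(1)[OF h] h by (simp_all add: hit_def)
      have "a (\<kappa> z + 2) \<le> a l"
        using amono[of "\<kappa> z + 2" l] far k l by (cases "l = \<kappa> z + 2") auto
      then show False
        using assms(9)[of "\<kappa> z"] far k l by simp
    qed
    then show "expt (e l) z = 0"
      by (simp add: hit_zero)
  next
    fix z
    show "expt (e (Suc (\<kappa> z))) z \<le> expt (e (\<kappa> z)) z"
      using \<kappa>_hit(1)[of z "Suc (\<kappa> z)"] by (simp add: hit_zero)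
  qed
  let ?E = "e ` {1..s}"
  have "I = mon_ideal V (power_mons ?E 1)"
  proof -
    have "(\<lambda>i. \<Prod>j\<in>{a i..b i}. Var j) ` {1..s} = (\<lambda>u. pmon u (1::'k)) ` ?E"
      unfolding image_image by (intro image_cong) (simp_all add: e_def pmon_sum_unit)
    then show ?thesis
      unfolding assms(8) interval_ideal_def V_def[symmetric]
      by (simp only:) (rule genideal_monomials, use V in blast)
  qed
  then have It: "ideal_power n I t = mon_ideal {1..n} (power_mons ?E t)"
    using power_of_monomial_ideal[of ?E V t] V unfolding V_def by blast
  note up = upset_power_mons[of ?E t]
  have "\<exists>m. supp m \<subseteq> V \<and> m \<notin> power_mons ?E t \<and> (\<forall>k\<in>{1..s}. m + unit_exp (c k) \<in> power_mons ?E t)"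
  proof (rule power_mons_socle[of V s e c t'])
    show "finite V" "c ` {1..s} \<subseteq> V"
      by (fact finV, fact cV)
    show "expt (e l) z \<le> 1" for l z
      by (simp add: e)
    show "\<exists>m. supp m \<subseteq> V \<and> m \<notin> power_mons ?E t \<and> (\<forall>k\<in>{1..s}. m + unit_exp (c k) \<in> power_mons ?E t)"
      if "supp m \<subseteq> V" "m \<notin> power_mons ?E (Suc t')"
        "\<And>k. k \<in> {1..s} \<Longrightarrow> m + unit_exp (c k) \<in> power_mons ?E (Suc t')" for m
      unfolding t using that by blast
  qed (fact V, fact priv)
  then obtain m where m: "supp m \<subseteq> V" "m \<notin> power_mons ?E t"
    "\<And>k. k \<in> {1..s} \<Longrightarrow> m + unit_exp (c k) \<in> power_mons ?E t"
    by blast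
  have P: "m + unit_exp z \<in> power_mons ?E t" if "z \<in> c ` {1..s}" for z
    using m(3) that by blast
  have d_le: "depth_quotient n (ideal_power n I t) \<le> enat (n - s)"
    using depth_le_of_socle[OF up m(1)[unfolded V_def] m(2) cV[unfolded V_def] P]
    unfolding It card_c by simp
  have sd_le: "sdepth_quotient n (ideal_power n I t) \<le> enat (n - s)"
    using sdepth_le_of_socle[OF up m(1)[unfolded V_def] m(2) cV[unfolded V_def] P]
    unfolding It card_c by simp
  have "cell_partition V (card V - s) {m. supp m \<subseteq> V \<and> m \<notin> power_mons ?E t}"
    by (rule standard_cell_partition[OF ch finV V])
  then have sd_ge: "enat (n - s) \<le> sdepth_quotient n (ideal_power n I t)"
    unfolding It V_def by (intro sdepth_ge_of_cell_partition up) simp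
  have d_ge: "enat (n - s) \<le> depth_quotient n (ideal_power n I t)"
  proof (cases "s = 0")
    case True
    then have "power_mons ?E t = {}"
      by (simp add: t power_mons_empty)
    then show ?thesis
      using depth_zero_ideal_ge[OF assms(1)] unfolding It by (simp add: True)
  next
    case False
    define xs where "xs = sorted_list_of_set (V - c ` {1..s})"
    define \<tau> where "\<tau> j = c (\<kappa> j)" for j
    have "card (V - c ` {1..s}) = card V - card (c ` {1..s})"
      by (rule card_Diff_subset[OF _ cV]) simp
    then have "card (V - c ` {1..s}) = n - s"
      unfolding card_c by (simp add: V_def)
    then have xs: "set xs = V - c ` {1..s}" "distinct xs" "length xs = n - s"
      by (simp_all add: xs_def finV)
    have \<kappa>s: "\<kappa> j \<in> {1..s}" for j
    proof (cases "\<exists>k. hit j k")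
      case True
      then show ?thesis
        using \<kappa>_hit(1) by (auto simp: hit_def)
    next
      case no_hit: False
      then show ?thesis
        using \<open>s \<noteq> 0\<close> by (simp add: \<kappa>_def)
    qed
    have \<kappa>c: "\<kappa> (c k) = k" if k: "k \<in> {1..s}" for k
    proof -
      have "hit (c k) k"
        using c_in[OF k] k by (simp add: hit_def)
      then have "hit (c k) (\<kappa> (c k))"
        by (rule \<kappa>_hit(1))
      then show ?thesis
        using c_private[OF k] by (simp add: hit_def)
    qed
    let ?fs = "map (\<lambda>j. Var j - Var (\<tau> j) :: 'k mpoly) xs"
    have \<tau>: "\<tau> j \<in> c ` {1..s}" for j
      using \<kappa>s by (simp add: \<tau>_def)
    have "polys.weakly_regular V (mon_ideal V (power_mons ?E t)) ?fs"
      by (rule differences_weakly_regular[OF ch V xs(2)])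
        (use xs(1) \<tau> cV \<kappa>c[OF \<kappa>s] in \<open>auto simp: \<tau>_def\<close>)
    moreover have "polys.subideal V (mon_ideal V (power_mons ?E t) :: 'k mpoly set)"
      by (rule subideal_mon_ideal[OF up])
    moreover have "0 \<notin> ?E"
      using priv by (metis imageE lookup_zero zero_neq_one)
    then have "(mon_ideal V (power_mons ?E t) :: 'k mpoly set) \<subseteq> max_ideal n"
      unfolding t V_def by (rule max_ideal_mon_ideal)
    moreover have "Var j - Var (\<tau> j) \<in> (max_ideal n :: 'k mpoly set)" if "j \<in> set xs" for j
    proof (intro polys.subideal_minus[OF subideal_max_ideal] Var_in_max_ideal)
      show "j \<in> {1..n}" "\<tau> j \<in> {1..n}"
        using that xs(1) \<tau> cV unfolding V_def by blast+
    qed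
    then have "set ?fs \<subseteq> max_ideal n"
      by auto
    ultimately have "enat (length ?fs) \<le> depth_quotient n (mon_ideal V (power_mons ?E t) :: 'k mpoly set)"
      unfolding V_def by (intro depth_quotient_ge)
    then show ?thesis
      unfolding It V_def by (simp add: xs(3))
  qed
  show "sdepth_quotient n (ideal_power n I t) = depth_quotient n (ideal_power n I t)
    \<and> depth_quotient n (ideal_power n I t) = enat (n - s)"
    using d_le sd_le d_ge sd_ge by (metis order.antisym)
qed

end
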